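(* Let $q$ be even with $q \ge 2048$. Then $m'_2(3,q) < q^2 - 2q + 3\sqrt{q} + 2$.
   Context: A $k$-cap of the projective space $\mathrm{PG}(n,q)$, $n \ge 3$, is a set of $k$ points no three of which are collinear. A $k$-cap is complete if it is not contained in a $(k+1)$-cap. $m'_2(n,q)$ denotes the second largest value of $k$ for which there exists a complete $k$-cap in $\mathrm{PG}(n,q)$ (i.e. the largest size of a complete cap that is not of maximum size; for $q$ even, $q>2$, the maximum size of a cap in $\mathrm{PG}(3,q)$ is $q^2+1$). *)

theory Defs
  imports "HOL-Analysis.Cartesian_Space" "HOL-Library.Numeral_Type"
begin

text \<open>
  The projective space PG(n,q) over a finite field \<open>'f\<close> of order q is modelled by the
  subspaces of \<open>'f ^ 'n\<close>, where \<open>CARD('n) = n + 1\<close>: projective dimension is vector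
  space dimension minus one, and incidence is inclusion. In particular PG(3,q) belongs to
  \<open>'f ^ 4\<close>. Since a finite field is determined by its order up to isomorphism, the choice
  of \<open>'f\<close> with \<open>CARD('f) = q\<close> is immaterial.
\<close>

definition pg_points :: "('f::field ^ 'n::finite) set set" where
  "pg_points = {P. vec.subspace P \<and> vec.dim P = 1}"

definition pg_lines :: "('f::field ^ 'n::finite) set set" where
  "pg_lines = {L. vec.subspace L \<and> vec.dim L = 2}"

definition pg_collinear :: "('f::field ^ 'n::finite) set set \<Rightarrow> bool" where
  "pg_collinear S \<longleftrightarrow> (\<exists>L\<in>pg_lines. \<forall>P\<in>S. P \<subseteq> L)"

definition is_cap :: "nat \<Rightarrow> ('f::field ^ 'n::finite) set set \<Rightarrow> bool" where
  "is_cap k K \<longleftrightarrow> K \<subseteq> pg_points \<and> finite K \<and> card K = k \<and>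
    (\<forall>P\<in>K. \<forall>Q\<in>K. \<forall>R\<in>K. P \<noteq> Q \<and> P \<noteq> R \<and> Q \<noteq> R \<longrightarrow> \<not> pg_collinear {P, Q, R})"

definition is_complete_cap :: "nat \<Rightarrow> ('f::field ^ 'n::finite) set set \<Rightarrow> bool" where
  "is_complete_cap k K \<longleftrightarrow> is_cap k K \<and> \<not> (\<exists>K'. is_cap (k + 1) K' \<and> K \<subseteq> K')"

definition complete_cap_sizes :: "('f::{field,finite} ^ 'n::finite) itself \<Rightarrow> nat set" where
  "complete_cap_sizes _ = {k. \<exists>K :: ('f ^ 'n) set set. is_complete_cap k K}"

text \<open>
  \<open>m2' TYPE('f ^ 'n)\<close> is $m'_2(n,q)$. As \<open>Max {}\<close> is unspecified, a bound on it has content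
  only if complete caps of at least two different sizes exist.
\<close>

definition m2' :: "('f::{field,finite} ^ 'n::finite) itself \<Rightarrow> nat" where
  "m2' T = Max (complete_cap_sizes T - {Max (complete_cap_sizes T)})"

end

theory Submission
  imports Defs "HOL-Computational_Algebra.Polynomial" "HOL-Library.Product_Plus"
begin

text \<open>
  Let \<open>K\<close> be a complete cap of size \<open>k \<ge> q\<^sup>2 - 2q + 3\<surd>q + 2\<close>. Every point of \<open>K\<close> lies on
  \<open>t = q\<^sup>2 + q + 2 - k \<le> 3q - 3\<surd>q\<close> tangents, and a plane \<open>E\<close> meeting \<open>K\<close> in \<open>a\<close> points contains
  \<open>m = q + 2 - a\<close> of the tangents at each of these points. By an elementary form of Segre's theorem
  (the tangents of an arc form a dual curve of degree \<open>m\<close>), \<open>K \<inter> E\<close> is contained in a hyperoval if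
  \<open>m (m - 1) < q\<close>; the \<open>m\<close> additional points are the nuclei of \<open>E\<close>.

  A point outside \<open>K\<close> lies on a secant \<open>s\<close>, and the values \<open>m\<close> of the planes through \<open>s\<close> sum up to \<open>t\<close>.
  Hence no point is a nucleus of three planes, which bounds \<open>t\<close> by \<open>2.15 q\<close>, and, averaging over the
  secants, every point outside \<open>K\<close> lies on at most about \<open>t\<close> tangents. Counting the pairs of
  intersecting tangents turns this into a bound on the second moment of \<open>m\<close> over the planes through a
  point \<open>P\<close> of \<open>K\<close>, which forces the tangents at \<open>P\<close> to lie in one plane, so that \<open>k = q\<^sup>2 + 1\<close>, or in
  two planes, each of them containing nearly all its lines through \<open>P\<close> as tangents. In the latter
  case the tangent structure at each point is determined exactly, and the number of planes with a
  given \<open>m\<close> fails to be an integer.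

  Elliptic quadrics have \<open>q\<^sup>2 + 1\<close> points, and a complete cap containing a planar hyperoval cannot be
  that large, so complete caps of two different sizes exist.
\<close>

section \<open>Binary forms\<close>

text \<open>The summand \<open>3 * sqrt q\<close> of the bound comes from the nuclei. A plane to
  which the extension theorem applies has \<open>m < sqrt q + 1\<close>, so three such planes with a
  common nucleus contain more than \<open>3 q + 3 - 3 sqrt q\<close> points of \<open>K\<close> in
  total, each joined to the nucleus by a tangent, whereas the count along a secant allows only
  \<open>t + 3\<close>. It is first proved with an error term, and the constants rest on
  \<open>sqrt q >= 45.2\<close>. The approximate bound suffices to locate the planes that are nearly
  full of tangents. After that every plane meeting \<open>K\<close> either admits the extension
  theorem or has \<open>a <= m\<close>; both kinds are harmless, the error term disappears, and the
  counts become exact enough for divisibility to decide.\<close>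

definition binary_form :: "nat \<Rightarrow> ('f::field \<Rightarrow> 'f \<Rightarrow> 'f) \<Rightarrow> bool" where
  "binary_form t h \<longleftrightarrow> (\<exists>p. degree p \<le> t \<and> (\<forall>y z. z \<noteq> 0 \<longrightarrow> h y z = z ^ t * poly p (y / z)) \<and>
     (\<forall>y. h y 0 = coeff p t * y ^ t))"

lemma binary_form_const: "binary_form 0 (\<lambda>y z. c)"
  unfolding binary_form_def by (intro exI[of _ "[:c:]"]) simp

lemma binary_form_zero: "binary_form t (\<lambda>y z. 0)"
  unfolding binary_form_def by (intro exI[of _ 0]) simp

lemma binary_form_linear_mult:
  assumes "binary_form t h"
  shows "binary_form (Suc t) (\<lambda>y z. (\<alpha> * y + \<beta> * z) * h y z)"
proof -
  obtain p where p: "degree p \<le> t" "\<And>y z. z \<noteq> 0 \<Longrightarrow> h y z = z ^ t * poly p (y / z)"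
    "\<And>y. h y 0 = coeff p t * y ^ t"
    using assms unfolding binary_form_def by blast
  have "degree ([:\<beta>, \<alpha>:] * p) \<le> Suc t"
    by (rule order.trans[OF degree_mult_le]) (use p(1) in \<open>auto split: if_splits\<close>)
  moreover have "coeff ([:\<beta>, \<alpha>:] * p) (Suc t) = \<alpha> * coeff p t"
    using p(1) by (simp add: coeff_eq_0)
  ultimately show ?thesis
    unfolding binary_form_def
    by (intro exI[of _ "[:\<beta>, \<alpha>:] * p"]) (auto simp: p field_simps)
qed

lemma binary_form_prod_linear:
  assumes "finite S"
  shows "binary_form (card S) (\<lambda>y z. \<Prod>k\<in>S. \<alpha> k * y + \<beta> k * z)"
  using assms
proof (induction S rule: finite_induct)
  case empty
  then show ?case by (simp add: binary_form_const)
next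
  case (insert x F)
  show ?case using binary_form_linear_mult[OF insert.IH, of "\<alpha> x" "\<beta> x"] insert(1,2) by simp
qed

lemma binary_form_add:
  assumes "binary_form t h" "binary_form t h'"
  shows "binary_form t (\<lambda>y z. h y z + h' y z)"
proof -
  obtain p where p: "degree p \<le> t" "\<And>y z. z \<noteq> 0 \<Longrightarrow> h y z = z ^ t * poly p (y / z)"
    "\<And>y. h y 0 = coeff p t * y ^ t"
    using assms(1) unfolding binary_form_def by blast
  obtain p' where p': "degree p' \<le> t" "\<And>y z. z \<noteq> 0 \<Longrightarrow> h' y z = z ^ t * poly p' (y / z)"
    "\<And>y. h' y 0 = coeff p' t * y ^ t"
    using assms(2) unfolding binary_form_def by blast
  show ?thesis unfolding binary_form_def
    by (intro exI[of _ "p + p'"]) (use p p' in \<open>auto simp: degree_add_le algebra_simps\<close>)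
qed

lemma binary_form_cmult:
  assumes "binary_form t h"
  shows "binary_form t (\<lambda>y z. c * h y z)"
proof -
  obtain p where p: "degree p \<le> t" "\<And>y z. z \<noteq> 0 \<Longrightarrow> h y z = z ^ t * poly p (y / z)"
    "\<And>y. h y 0 = coeff p t * y ^ t"
    using assms(1) unfolding binary_form_def by blast
  show ?thesis unfolding binary_form_def
    by (intro exI[of _ "smult c p"]) (use p degree_smult_le[of c p] in \<open>auto\<close>)
qed

lemma binary_form_sum:
  assumes "\<And>i. i \<in> I \<Longrightarrow> binary_form t (h i)"
  shows "binary_form t (\<lambda>y z. \<Sum>i\<in>I. h i y z)"
  using assms
proof (induction I rule: infinite_finite_induct)
  case (insert x F)
  then show ?case using binary_form_add[of t "h x" "\<lambda>y z. \<Sum>i\<in>F. h i y z"] by simp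
qed (simp_all add: binary_form_zero)

lemma binary_form_eq_0:
  fixes h :: "'f::field \<Rightarrow> 'f \<Rightarrow> 'f"
  assumes h: "binary_form t h" and B: "finite B" "card B \<ge> Suc t" "t \<ge> 1"
    and ind: "\<And>b b'. b \<in> B \<Longrightarrow> b' \<in> B \<Longrightarrow> b \<noteq> b' \<Longrightarrow> y b * z b' \<noteq> y b' * z b"
    and zero: "\<And>b. b \<in> B \<Longrightarrow> h (y b) (z b) = 0"
  shows "h u v = 0"
proof -
  obtain p where p: "degree p \<le> t" "\<And>y z. z \<noteq> 0 \<Longrightarrow> h y z = z ^ t * poly p (y / z)"
    "\<And>y. h y 0 = coeff p t * y ^ t"
    using h unfolding binary_form_def by blast
  define B1 where "B1 = {b\<in>B. z b \<noteq> 0}"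
  have inj: "inj_on (\<lambda>b. y b / z b) B1"
    by (rule inj_onI) (use ind in \<open>auto simp: B1_def field_simps\<close>)
  have sub: "(\<lambda>b. y b / z b) ` B1 \<subseteq> {x. poly p x = 0}"
  proof
    fix x assume "x \<in> (\<lambda>b. y b / z b) ` B1"
    then obtain b where b: "b \<in> B" "z b \<noteq> 0" "x = y b / z b" by (auto simp: B1_def)
    then show "x \<in> {x. poly p x = 0}" using zero[OF b(1)] p(2)[OF b(2), of "y b"] by simp
  qed
  have fB: "finite B1" using B by (simp add: B1_def)
  have c: "card B1 \<le> degree p" if "p \<noteq> 0"
  proof -
    have "card B1 = card ((\<lambda>b. y b / z b) ` B1)" using inj by (simp add: card_image)
    also have "\<dots> \<le> card {x. poly p x = 0}"
      by (rule card_mono[OF poly_roots_finite[OF that] sub])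
    also have "\<dots> \<le> degree p" by (rule card_poly_roots_bound[OF that])
    finally show ?thesis .
  qed
  have "p = 0"
  proof (cases "B1 = B")
    case True
    then show ?thesis using c B p(1) by fastforce
  next
    case False
    then obtain b0 where b0: "b0 \<in> B" "z b0 = 0" by (auto simp: B1_def)
    have B1: "B1 = B - {b0}" using ind[of b0] b0 by (force simp: B1_def)
    \<comment> \<open>Independence says nothing about a single member; a second one is needed to see
      that \<open>y b0\<close> is nonzero.\<close>
    have "B \<noteq> {b0}" using B by auto
    then obtain b1 where "b1 \<in> B" "b1 \<noteq> b0" using b0 by blast
    then have "y b0 \<noteq> 0" using ind[of b0 b1] b0 by auto
    then have "coeff p t = 0" using zero[OF b0(1)] p(3) b0 by auto
    then have "p = 0 \<or> degree p < t" using p(1) by (metis leading_coeff_0_iff nat_less_le)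
    then show ?thesis using c B1 B b0 by (auto simp: card_Diff_singleton)
  qed
  then show ?thesis using p by (cases "v = 0") auto
qed

section \<open>Triples\<close>

text \<open>Triples serve both as points and, through \<open>dot\<close>, as linear forms, that is,
  as lines of the plane. Accordingly \<open>cross\<close> is the join of two points as well as the
  intersection of two lines.\<close>

fun dot :: "'f::comm_ring_1 \<times> 'f \<times> 'f \<Rightarrow> 'f \<times> 'f \<times> 'f \<Rightarrow> 'f" where
  "dot (a, b, c) (x, y, z) = a * x + b * y + c * z"

fun cross :: "'f::comm_ring_1 \<times> 'f \<times> 'f \<Rightarrow> 'f \<times> 'f \<times> 'f \<Rightarrow> 'f \<times> 'f \<times> 'f" where
  "cross (a, b, c) (x, y, z) = (b * z - c * y, c * x - a * z, a * y - b * x)"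

fun smul :: "'f::comm_ring_1 \<Rightarrow> 'f \<times> 'f \<times> 'f \<Rightarrow> 'f \<times> 'f \<times> 'f" where
  "smul s (x, y, z) = (s * x, s * y, s * z)"

definition triple_det :: "'f::comm_ring_1 \<times> 'f \<times> 'f \<Rightarrow> 'f \<times> 'f \<times> 'f \<Rightarrow> 'f \<times> 'f \<times> 'f \<Rightarrow> 'f" where
  "triple_det P Q R = dot (cross P Q) R"

lemma dot_add: "dot u (v + w) = dot u v + dot u w" "dot (v + w) u = dot v u + dot w u"
  by (cases u; cases v; cases w; simp add: algebra_simps)+

lemma dot_diff: "dot u (v - w) = dot u v - dot u w" "dot (v - w) u = dot v u - dot w u"
  by (cases u; cases v; cases w; simp add: algebra_simps)+

lemma dot_smul: "dot u (smul s v) = s * dot u v" "dot (smul s v) u = s * dot v u"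
  by (cases u; cases v; simp add: algebra_simps)+

lemma dot_zero [simp]: "dot u 0 = 0" "dot 0 u = 0"
  by (cases u; simp add: zero_prod_def)+

lemma cross_self [simp]: "cross P P = 0"
  by (cases P; simp add: zero_prod_def)

lemma dot_cross_self [simp]: "dot (cross P Q) P = 0" "dot (cross P Q) Q = 0"
  "dot P (cross P Q) = 0" "dot Q (cross P Q) = 0"
  by (cases P; cases Q; simp add: algebra_simps)+

lemma triple_det_rotate: "triple_det P Q R = triple_det Q R P"
  by (cases P; cases Q; cases R; simp add: triple_det_def algebra_simps)

lemma triple_det_swap: "triple_det Q P R = - triple_det P Q R"
  by (cases P; cases Q; cases R; simp add: triple_det_def algebra_simps)

lemma triple_det_eq [simp]: "triple_det P P R = 0" "triple_det P R P = 0" "triple_det R P P = 0"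
  by (cases P; cases R; simp add: triple_det_def algebra_simps)+

lemma cross_cross: "cross (cross P S) (cross P S') = smul (triple_det P S S') P"
  by (cases P; cases S; cases S'; simp add: triple_det_def algebra_simps)

text \<open>The three cross products are the basis dual to \<open>P\<close>, \<open>Q\<close>,
  \<open>R\<close> up to the factor \<open>triple_det P Q R\<close>; keeping this factor on the left
  makes it a ring identity.\<close>

lemma cramer_dual:
  "smul (triple_det P Q R) u =
     smul (dot u P) (cross Q R) + smul (dot u Q) (cross R P) + smul (dot u R) (cross P Q)"
  by (cases P; cases Q; cases R; cases u; simp add: triple_det_def algebra_simps)

lemma cramer_primal:
  "smul (triple_det P Q R) S =
     smul (triple_det S Q R) P + smul (triple_det P S R) Q + smul (triple_det P Q S) R"
  by (cases P; cases Q; cases R; cases S; simp add: triple_det_def algebra_simps)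

lemma smul_zero [simp]: "smul 0 v = 0" "smul s 0 = 0"
  by (cases v; simp add: zero_prod_def)+

lemma smul_one [simp]: "smul 1 v = v"
  by (cases v) simp

lemma smul_smul: "smul s (smul s' v) = smul (s * s') v"
  by (cases v) (simp add: mult_ac)

lemma smul_eq_0_iff: "smul (s :: 'f :: field) v = 0 \<longleftrightarrow> s = 0 \<or> v = 0"
  by (cases v) (auto simp: zero_prod_def)

lemma smul_cancel: "(s :: 'f :: field) \<noteq> 0 \<Longrightarrow> smul s v = smul s w \<Longrightarrow> v = w"
  by (cases v; cases w) auto

lemma cross_smul: "cross (smul s u) v = smul s (cross u v)" "cross u (smul s v) = smul s (cross u v)"
  by (cases u; cases v; simp add: algebra_simps)+

lemma cross_add: "cross (u + w) v = cross u v + cross w v" "cross v (u + w) = cross v u + cross v w"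
  by (cases u; cases v; cases w; simp add: algebra_simps)+

lemma cross_uminus: "cross v u = - cross u v"
  by (cases u; cases v; simp add: algebra_simps)

lemma smul_add: "smul (s + s') v = smul s v + smul s' v" "smul s (v + w) = smul s v + smul s w"
  by (cases v; cases w; simp add: algebra_simps)+

lemma ex_triple_det_nonzero:
  fixes N :: "'f::field \<times> 'f \<times> 'f"
  assumes "N \<noteq> 0"
  shows "\<exists>Q R. triple_det N Q R \<noteq> 0"
proof -
  obtain a b c where N: "N = (a, b, c)" by (cases N)
  have "a \<noteq> 0 \<or> b \<noteq> 0 \<or> c \<noteq> 0" using assms N by (auto simp: zero_prod_def)
  moreover have "triple_det N (0,1,0) (0,0,1) = a" "triple_det N (0,0,1) (1,0,0) = b"
    "triple_det N (1,0,0) (0,1,0) = c"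
    by (simp_all add: N triple_det_def)
  ultimately show ?thesis by metis
qed

lemma ex_dot_nonzero:
  fixes w :: "'f::field \<times> 'f \<times> 'f"
  assumes "w \<noteq> 0"
  shows "\<exists>X. dot w X \<noteq> 0"
proof -
  obtain a b c where w: "w = (a, b, c)" by (cases w)
  have "a \<noteq> 0 \<or> b \<noteq> 0 \<or> c \<noteq> 0" using assms w by (auto simp: zero_prod_def)
  moreover have "dot w (1,0,0) = a" "dot w (0,1,0) = b" "dot w (0,0,1) = c"
    by (simp_all add: w)
  ultimately show ?thesis by metis
qed

lemma cross_eq_0_imp_proportional:
  fixes u :: "'f::field \<times> 'f \<times> 'f"
  assumes "cross u u' = 0" "u \<noteq> 0"
  shows "\<exists>s. u' = smul s u"
proof -
  obtain v w where vw: "triple_det u v w \<noteq> 0" using ex_triple_det_nonzero[OF assms(2)] by blast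
  have "triple_det u u' w = 0" using assms(1) by (simp add: triple_det_def)
  moreover have "triple_det u v u' = - triple_det u u' v"
    by (metis triple_det_rotate triple_det_swap)
  then have "triple_det u v u' = 0" using assms(1) by (simp add: triple_det_def)
  ultimately have "smul (triple_det u v w) u' = smul (triple_det u' v w) u"
    using cramer_primal[of u v w u'] by simp
  then have "smul (triple_det u v w) u' = smul (triple_det u v w) (smul (triple_det u' v w / triple_det u v w) u)"
    using vw by (simp add: smul_smul)
  then show ?thesis using smul_cancel[OF vw] by blast
qed

text \<open>Stands for a form of degree \<open>t\<close> in three variables. Only its restrictions
  to the lines of the dual plane are ever used, so only these are required to be polynomial.\<close>

definition triple_form :: "nat \<Rightarrow> ('f::field \<times> 'f \<times> 'f \<Rightarrow> 'f) \<Rightarrow> bool" where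
  "triple_form t F \<longleftrightarrow> (\<forall>v w. binary_form t (\<lambda>y z. F (smul y v + smul z w)))"

lemma triple_form_prod_dot:
  assumes "finite S"
  shows "triple_form (card S) (\<lambda>u. \<Prod>k\<in>S. dot u (g k))"
  unfolding triple_form_def
proof (intro allI)
  fix v w
  show "binary_form (card S) (\<lambda>y z. \<Prod>k\<in>S. dot (smul y v + smul z w) (g k))"
    using binary_form_prod_linear[OF assms, of "\<lambda>k. dot v (g k)" "\<lambda>k. dot w (g k)"]
    by (simp add: dot_add dot_smul mult.commute)
qed

lemma triple_form_cmult: "triple_form t F \<Longrightarrow> triple_form t (\<lambda>u. c * F u)"
  unfolding triple_form_def by (auto intro: binary_form_cmult)

lemma triple_form_add: "triple_form t F \<Longrightarrow> triple_form t G \<Longrightarrow> triple_form t (\<lambda>u. F u + G u)"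
  unfolding triple_form_def by (auto intro: binary_form_add)

lemma triple_form_diff: "triple_form t F \<Longrightarrow> triple_form t G \<Longrightarrow> triple_form t (\<lambda>u. F u - G u)"
  using triple_form_add[of t F "\<lambda>u. (-1) * G u"] triple_form_cmult[of t G "-1"] by simp

lemma triple_form_sum:
  "(\<And>i. i \<in> I \<Longrightarrow> triple_form t (F i)) \<Longrightarrow> triple_form t (\<lambda>u. \<Sum>i\<in>I. F i u)"
  unfolding triple_form_def by (auto intro: binary_form_sum)

text \<open>The linear forms vanishing at \<open>N\<close> are spanned by \<open>cross N Q\<close>
  and \<open>cross R N\<close>. In the coordinates supplied by \<open>cramer_dual\<close> this
  becomes the root count for binary forms.\<close>

lemma triple_form_eq_0_on_pencil:
  assumes F: "triple_form t F" and D: "triple_det N Q R \<noteq> 0"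
    and U: "finite U" "card U \<ge> Suc t" "t \<ge> 1"
    and on: "\<And>u. u \<in> U \<Longrightarrow> dot u N = 0" and zero: "\<And>u. u \<in> U \<Longrightarrow> F u = 0"
    and ind: "\<And>u u'. u \<in> U \<Longrightarrow> u' \<in> U \<Longrightarrow> u \<noteq> u' \<Longrightarrow> cross u u' \<noteq> 0"
    and w: "dot w N = 0"
  shows "F w = 0"
proof -
  let ?D = "triple_det N Q R"
  define y where "y = (\<lambda>u. dot u R / ?D)"
  define z where "z = (\<lambda>u. dot u Q / ?D)"
  let ?v = "cross N Q" and ?w = "cross R N"
  have rep: "u = smul (y u) ?v + smul (z u) ?w" if "dot u N = 0" for u
  proof -
    have "smul ?D u = smul ?D (smul (y u) ?v + smul (z u) ?w)"
      using cramer_dual[of N Q R u] that D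
      by (simp add: smul_add smul_smul y_def z_def add.commute)
    then show ?thesis using D smul_cancel by blast
  qed
  have "F (smul (y w) ?v + smul (z w) ?w) = 0"
  proof (rule binary_form_eq_0[where h="\<lambda>y z. F (smul y ?v + smul z ?w)" and B=U and y=y and z=z and t=t])
    show "binary_form t (\<lambda>y z. F (smul y ?v + smul z ?w))" using F unfolding triple_form_def by blast
    show "F (smul (y b) ?v + smul (z b) ?w) = 0" if "b \<in> U" for b
      using rep[OF on[OF that]] zero[OF that] by simp
    show "y b * z b' \<noteq> y b' * z b" if "b \<in> U" "b' \<in> U" "b \<noteq> b'" for b b'
    proof
      assume eq: "y b * z b' = y b' * z b"
      have "cross b b' = cross (smul (y b) ?v + smul (z b) ?w) (smul (y b') ?v + smul (z b') ?w)"
        using rep[OF on[OF that(1)]] rep[OF on[OF that(2)]] by simp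
      also have "\<dots> = smul (y b * z b') (cross ?v ?w) + smul (y b' * z b) (cross ?w ?v)"
        by (simp add: cross_add cross_smul smul_smul mult.commute)
      also have "\<dots> = 0"
        unfolding eq by (subst (2) cross_uminus) (cases "cross ?v ?w", simp add: zero_prod_def)
      finally show False using ind that by blast
    qed
  qed (use U in auto)
  then show ?thesis using rep[OF w] by simp
qed

section \<open>Arcs in planes of even order\<close>

text \<open>\<open>A\<close> holds one coordinate vector for each point of the arc. Every point has
  \<open>t\<close> tangents (\<open>card_tangents\<close>), and \<open>t_le\<close> provides the
  \<open>t + 2\<close> points between which \<open>envelope\<close> interpolates.\<close>

locale even_arc =
  fixes A :: "('f::{field,finite} \<times> 'f \<times> 'f) set" and t :: nat
  assumes char2: "(2::'f) = 0"
    and arc: "\<And>P Q R. P \<in> A \<Longrightarrow> Q \<in> A \<Longrightarrow> R \<in> A \<Longrightarrow> P \<noteq> Q \<Longrightarrow> P \<noteq> R \<Longrightarrow> Q \<noteq> R \<Longrightarrow> triple_det P Q R \<noteq> 0"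
    and card_A: "card A + t = CARD('f) + 2"
    and t_pos: "t \<ge> 1"
    and t_le: "t + 2 \<le> card A"
begin

lemma uminus_eq: "- (x::'f) = x"
  using char2 by (metis add_eq_0_iff mult_2 mult_zero_left)

lemma uminus_triple_eq: "- (v::'f\<times>'f\<times>'f) = v"
  by (cases v) (simp add: uminus_eq)

lemma cross_commute: "cross (u::'f\<times>'f\<times>'f) v = cross v u"
  by (subst cross_uminus) (simp add: uminus_triple_eq)

lemma card_A_ge: "card A \<ge> 3" using t_pos t_le by simp

lemma ex_other: "\<exists>Q\<in>A. Q \<noteq> P \<and> Q \<noteq> R"
proof (rule ccontr)
  assume "\<not> ?thesis"
  then have "A \<subseteq> {P, R}" by auto
  then have "card A \<le> card {P, R}" by (intro card_mono) auto
  also have "\<dots> \<le> 2" by (cases "P = R") auto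
  finally show False using card_A_ge by simp
qed

lemma arc_nonzero: "P \<in> A \<Longrightarrow> P \<noteq> 0"
proof -
  assume P: "P \<in> A"
  obtain Q where "Q \<in> A" "Q \<noteq> P" using ex_other by blast
  moreover obtain R where "R \<in> A" "R \<noteq> P" "R \<noteq> Q" using ex_other by blast
  ultimately have "triple_det P Q R \<noteq> 0" using arc P by auto
  then show "P \<noteq> 0" unfolding triple_det_def
    by (cases Q; cases R) (auto simp: zero_prod_def)
qed

definition ref :: "'f \<times> 'f \<times> 'f \<Rightarrow> 'f \<times> 'f \<times> 'f" where
  "ref P = (SOME Q. Q \<in> A \<and> Q \<noteq> P)"

lemma ref: "ref P \<in> A" "ref P \<noteq> P"
  using someI_ex[of "\<lambda>Q. Q \<in> A \<and> Q \<noteq> P"] ex_other[of P P] unfolding ref_def by blast+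

text \<open>Each tangent at \<open>P\<close> is represented by its linear form that takes the value 1 at the auxiliary
  arc point \<open>ref P\<close>.\<close>

definition tangents :: "'f \<times> 'f \<times> 'f \<Rightarrow> ('f \<times> 'f \<times> 'f) set" where
  "tangents P = {u. dot u P = 0 \<and> dot u (ref P) = 1 \<and> (\<forall>S\<in>A. S \<noteq> P \<longrightarrow> dot u S \<noteq> 0)}"

section \<open>Segre's lemma of tangents\<close>

lemma form_eq_0:
  assumes "triple_det P Q R \<noteq> (0::'f)" "dot u P = 0" "dot u Q = 0" "dot u R = 0"
  shows "u = 0"
  using cramer_dual[of P Q R u] assms by (simp add: smul_eq_0_iff)

lemma proportional_tangents:
  assumes u: "u \<in> tangents P" "u' \<in> tangents P" and "triple_det P Q R \<noteq> 0"
    and "Q \<in> A" "R \<in> A" "Q \<noteq> P" "R \<noteq> P"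
    and eq: "dot u Q / dot u R = dot u' Q / dot u' R"
  shows "u = u'"
proof -
  have nz: "dot u R \<noteq> 0" "dot u' R \<noteq> 0" using assms by (auto simp: tangents_def)
  define s where "s = dot u' R / dot u R"
  have "u' - smul s u = 0"
  proof (rule form_eq_0[OF assms(3)])
    show "dot (u' - smul s u) P = 0" using u by (simp add: dot_diff dot_smul tangents_def)
    show "dot (u' - smul s u) Q = 0" using nz eq by (simp add: dot_diff dot_smul s_def field_simps)
    show "dot (u' - smul s u) R = 0" using nz by (simp add: dot_diff dot_smul s_def)
  qed
  then have eq: "u' = smul s u" by simp
  have "dot u' (ref P) = s * dot u (ref P)" unfolding eq by (simp add: dot_smul)
  then have "s = 1" using u by (simp add: tangents_def)
  then show ?thesis using eq by simp
qed

text \<open>Wilson's theorem. Inversion permutes the nonzero elements, so the product is its own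
  inverse, and in characteristic 2 the only square root of 1 is 1.\<close>

lemma prod_units: "(\<Prod>x\<in>UNIV - {0::'f}. x) = 1"
proof -
  let ?w = "\<Prod>x\<in>UNIV - {0::'f}. x"
  have nz: "?w \<noteq> 0" by simp
  have "bij_betw inverse (UNIV - {0::'f}) (UNIV - {0::'f})"
    by (rule bij_betwI[where g=inverse]) auto
  from prod.reindex_bij_betw[OF this, of "\<lambda>x. x"]
  have "(\<Prod>x\<in>UNIV - {0::'f}. inverse x) = ?w" .
  then have "inverse ?w = ?w" by (simp add: prod_inversef[symmetric])
  then have "?w * ?w = 1" using nz by (metis right_inverse)
  then have "(?w + 1) * (?w + 1) = 2 * (?w + 1)" by (simp add: algebra_simps)
  then have "?w + 1 = 0" using char2 by simp
  then show ?thesis using uminus_eq by (metis add_eq_0_iff)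
qed

text \<open>The forms vanishing at \<open>P\<close> but neither at \<open>Q\<close> nor at \<open>R\<close> are classified by the ratio of
  their values at \<open>Q\<close> and \<open>R\<close>, which runs through all nonzero field elements. They are the
  tangents at \<open>P\<close> and the secants joining \<open>P\<close> to the other points of the arc.\<close>

lemma ratios:
  assumes P: "P \<in> A" and Q: "Q \<in> A" and R: "R \<in> A" and ne: "P \<noteq> Q" "P \<noteq> R" "Q \<noteq> R"
  defines "\<phi> \<equiv> \<lambda>u. dot u Q / dot u R"
    and "\<psi> \<equiv> \<lambda>S. triple_det P Q S / triple_det R P S"
  shows "inj_on \<phi> (tangents P)" "inj_on \<psi> (A - {P, Q, R})"
    "\<phi> ` tangents P \<inter> \<psi> ` (A - {P, Q, R}) = {}"
    "\<phi> ` tangents P \<union> \<psi> ` (A - {P, Q, R}) = UNIV - {0}"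
proof -
  let ?D = "triple_det P Q R"
  have D: "?D \<noteq> 0" using arc P Q R ne by blast
  have D': "triple_det R P S \<noteq> 0" "triple_det P Q S \<noteq> 0" if "S \<in> A - {P,Q,R}" for S
    using arc P Q R ne that by (metis Diff_iff insertCI)+
  have nz: "dot u Q \<noteq> 0" "dot u R \<noteq> 0" if "u \<in> tangents P" for u
    using that Q R ne by (auto simp: tangents_def)
  \<comment> \<open>The line through \<open>P\<close> whose values at \<open>Q\<close> and
    \<open>R\<close> have ratio \<open>d\<close>.\<close>
  define form where "form = (\<lambda>d. smul d (cross R P) + cross P Q)"
  have form: "dot (form d) P = 0" "dot (form d) Q = d * ?D" "dot (form d) R = ?D"
    "dot (form d) S = d * triple_det R P S + triple_det P Q S" for d S
    by (simp_all add: form_def dot_add dot_smul triple_det_def[symmetric])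
       (metis triple_det_rotate)
  show "inj_on \<phi> (tangents P)"
    by (rule inj_onI) (use proportional_tangents D Q R ne in \<open>unfold \<phi>_def, metis\<close>)
  \<comment> \<open>\<open>form (\<psi> S)\<close> is thus the secant joining \<open>P\<close> and
    \<open>S\<close>; the sign that \<open>\<psi>\<close> should carry is absorbed by characteristic
    2.\<close>
  have root: "dot (form (\<psi> S)) S = 0" if "S \<in> A - {P,Q,R}" for S
    using D'[OF that] char2 by (simp add: form \<psi>_def)
  show "inj_on \<psi> (A - {P, Q, R})"
  proof (rule inj_onI)
    fix S S' assume S: "S \<in> A - {P,Q,R}" "S' \<in> A - {P,Q,R}" and eq: "\<psi> S = \<psi> S'"
    show "S = S'"
    proof (rule ccontr)
      assume "S \<noteq> S'"
      then have "triple_det P S S' \<noteq> 0" using arc[of P S S'] P S by blast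
      moreover have "dot (form (\<psi> S)) P = 0" by (rule form(1))
      moreover have "dot (form (\<psi> S)) S = 0" by (rule root[OF S(1)])
      moreover have "dot (form (\<psi> S)) S' = 0" unfolding eq by (rule root[OF S(2)])
      ultimately have "form (\<psi> S) = 0" by (rule form_eq_0)
      then show False using form(3)[of "\<psi> S"] D by simp
    qed
  qed
  show "\<phi> ` tangents P \<inter> \<psi> ` (A - {P, Q, R}) = {}"
  proof (rule ccontr)
    assume "\<phi> ` tangents P \<inter> \<psi> ` (A - {P, Q, R}) \<noteq> {}"
    then obtain u S where u: "u \<in> tangents P" and S: "S \<in> A - {P,Q,R}" and eq: "\<phi> u = \<psi> S" by blast
    have "smul ?D u = smul (dot u R) (form (\<phi> u))"
      using cramer_dual[of P Q R u] u nz[OF u]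
      by (simp add: tangents_def form_def \<phi>_def smul_add smul_smul)
    then have "dot (smul ?D u) S = 0" using root[OF S] eq by (simp add: dot_smul)
    then have "dot u S = 0" using D by (simp add: dot_smul)
    then show False using u S by (auto simp: tangents_def)
  qed
  show "\<phi> ` tangents P \<union> \<psi> ` (A - {P, Q, R}) = UNIV - {0}"
  proof (intro equalityI subsetI)
    fix d assume "d \<in> \<phi> ` tangents P \<union> \<psi> ` (A - {P, Q, R})"
    then show "d \<in> UNIV - {0}"
    proof
      assume "d \<in> \<phi> ` tangents P"
      then show ?thesis using nz by (elim imageE) (simp add: \<phi>_def)
    next
      assume "d \<in> \<psi> ` (A - {P, Q, R})"
      then obtain S where "S \<in> A - {P, Q, R}" "d = \<psi> S" by (rule imageE)
      then show ?thesis using D'[of S] by (simp add: \<psi>_def)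
    qed
  next
    fix d :: 'f assume d: "d \<in> UNIV - {0}"
    show "d \<in> \<phi> ` tangents P \<union> \<psi> ` (A - {P, Q, R})"
    proof (cases "d \<in> \<psi> ` (A - {P, Q, R})")
      case False
      have n0: "dot (form d) S \<noteq> 0" if "S \<in> A" "S \<noteq> P" for S
      proof (cases "S \<in> {Q, R}")
        case True then show ?thesis using form D d by auto
      next
        case F: False
        then have S: "S \<in> A - {P,Q,R}" using that by auto
        show ?thesis
        proof
          assume "dot (form d) S = 0"
          then have "d = - (triple_det P Q S / triple_det R P S)"
            using form(4)[of d S] D'[OF S] by (simp add: field_simps add_eq_0_iff)
          then have "d = \<psi> S" by (simp add: uminus_eq \<psi>_def)
          then show False using False S by blast
        qed
      qed
      define u where "u = smul (1 / dot (form d) (ref P)) (form d)"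
      have r: "dot (form d) (ref P) \<noteq> 0" using n0 ref by blast
      have "u \<in> tangents P" using n0 r by (auto simp: tangents_def u_def dot_smul form(1))
      moreover have "\<phi> u = d" using r D by (simp add: \<phi>_def u_def dot_smul form(2,3))
      ultimately show ?thesis by blast
    qed auto
  qed
qed

text \<open>By \<open>ratios\<close> the \<open>q - 1\<close> nonzero ratios are shared between the
  tangents at \<open>P\<close> and the secants to the \<open>card A - 3\<close> remaining
  points.\<close>

lemma card_tangents:
  assumes "P \<in> A"
  shows "card (tangents P) = t"
proof -
  obtain Q where Q: "Q \<in> A" "Q \<noteq> P" using ex_other by blast
  obtain R where R: "R \<in> A" "R \<noteq> P" "R \<noteq> Q" using ex_other by blast
  note r = ratios[OF assms Q(1) R(1) Q(2)[symmetric] R(2)[symmetric] R(3)[symmetric]]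
  have "card (UNIV - {0::'f}) = card (tangents P) + card (A - {P,Q,R})"
    unfolding r(4)[symmetric] by (subst card_Un_disjoint) (use r in \<open>simp_all add: card_image\<close>)
  moreover have "card (A - {P,Q,R}) = card A - 3"
    using assms Q R by (subst card_Diff_subset) auto
  moreover have "card (UNIV - {0::'f}) = CARD('f) - 1"
    by (subst card_Diff_subset) auto
  ultimately show ?thesis using card_A card_A_ge by simp
qed

definition g :: "'f \<times> 'f \<times> 'f \<Rightarrow> 'f \<times> 'f \<times> 'f \<Rightarrow> 'f" where
  "g P X = (\<Prod>u\<in>tangents P. dot u X)"

lemma g_nonzero: "S \<in> A \<Longrightarrow> S \<noteq> P \<Longrightarrow> g P S \<noteq> 0"
  by (simp add: g_def) (auto simp: tangents_def)

text \<open>The factors run exactly once through the nonzero field elements, so this is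
  \<open>prod_units\<close>.\<close>

lemma g_ratio:
  assumes "P \<in> A" "Q \<in> A" "R \<in> A" "P \<noteq> Q" "P \<noteq> R" "Q \<noteq> R"
  shows "g P Q / g P R * (\<Prod>S\<in>A - {P, Q, R}. triple_det P Q S / triple_det R P S) = 1"
proof -
  note r = ratios[OF assms]
  let ?\<phi> = "\<lambda>u. dot u Q / dot u R" and ?\<psi> = "\<lambda>S. triple_det P Q S / triple_det R P S"
  have "g P Q / g P R * (\<Prod>S\<in>A - {P, Q, R}. ?\<psi> S) =
    (\<Prod>u\<in>tangents P. ?\<phi> u) * (\<Prod>S\<in>A - {P, Q, R}. ?\<psi> S)"
    by (simp add: g_def prod_dividef)
  also have "\<dots> = (\<Prod>x\<in>?\<phi> ` tangents P. x) * (\<Prod>x\<in>?\<psi> ` (A - {P, Q, R}). x)"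
    by (simp only: prod.reindex[OF r(1)] prod.reindex[OF r(2)] o_def)
  also have "\<dots> = (\<Prod>x\<in>?\<phi> ` tangents P \<union> ?\<psi> ` (A - {P, Q, R}). x)"
    by (rule prod.union_disjoint[symmetric]) (use r(3) in auto)
  also have "\<dots> = 1" unfolding r(4) by (rule prod_units)
  finally show ?thesis .
qed

text \<open>In the product of the three cyclic instances of \<open>g_ratio\<close> the contribution
  of every further point \<open>S\<close> telescopes to 1. In general a sign depending on
  \<open>t\<close> remains; characteristic 2 removes it.\<close>

lemma lemma_of_tangents:
  assumes "P \<in> A" "Q \<in> A" "R \<in> A" "P \<noteq> Q" "P \<noteq> R" "Q \<noteq> R"
  shows "g P Q * g Q R * g R P = g P R * g Q P * g R Q"
proof -
  let ?\<psi> = "\<lambda>P Q R S. triple_det P Q S / triple_det R P S"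
  let ?B = "A - {P, Q, R}"
  have s: "A - {Q, R, P} = ?B" "A - {R, P, Q} = ?B" by auto
  have 1: "g P Q / g P R * (\<Prod>S\<in>?B. ?\<psi> P Q R S) = 1"
    by (rule g_ratio) (use assms in auto)
  have 2: "g Q R / g Q P * (\<Prod>S\<in>?B. ?\<psi> Q R P S) = 1"
    using g_ratio[of Q R P] assms s by auto
  have 3: "g R P / g R Q * (\<Prod>S\<in>?B. ?\<psi> R P Q S) = 1"
    using g_ratio[of R P Q] assms s by auto
  have "(\<Prod>S\<in>?B. ?\<psi> P Q R S) * (\<Prod>S\<in>?B. ?\<psi> Q R P S) * (\<Prod>S\<in>?B. ?\<psi> R P Q S) =
    (\<Prod>S\<in>?B. ?\<psi> P Q R S * ?\<psi> Q R P S * ?\<psi> R P Q S)"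
    by (simp only: prod.distrib)
  also have "\<dots> = 1"
  proof (rule prod.neutral, rule ballI)
    fix S assume "S \<in> ?B"
    then have "triple_det P Q S \<noteq> 0" "triple_det Q R S \<noteq> 0" "triple_det R P S \<noteq> 0"
      using arc assms by (metis Diff_iff insertCI)+
    then show "?\<psi> P Q R S * ?\<psi> Q R P S * ?\<psi> R P Q S = 1" by simp
  qed
  finally have 4: "(\<Prod>S\<in>?B. ?\<psi> P Q R S) * (\<Prod>S\<in>?B. ?\<psi> Q R P S) * (\<Prod>S\<in>?B. ?\<psi> R P Q S) = 1" .
  have "(g P Q / g P R) * (g Q R / g Q P) * (g R P / g R Q) * 
     ((\<Prod>S\<in>?B. ?\<psi> P Q R S) * (\<Prod>S\<in>?B. ?\<psi> Q R P S) * (\<Prod>S\<in>?B. ?\<psi> R P Q S)) = 1"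
    using arg_cong2[OF arg_cong2[OF 1 2, of "(*)"] 3, of "(*)"] by (simp only: mult_1 mult_ac)
  then have "(g P Q / g P R) * (g Q R / g Q P) * (g R P / g R Q) = 1" by (simp only: 4 mult_1_right)
  moreover have "g P R \<noteq> 0" "g Q P \<noteq> 0" "g R Q \<noteq> 0" using assms g_nonzero by auto
  ultimately show ?thesis by (simp add: field_simps)
qed

text \<open>Rescaling makes every product agree with that of a base point \<open>P0\<close>; the
  lemma of tangents for \<open>P0\<close>, \<open>P\<close>, \<open>Q\<close> then carries the
  symmetry over to all pairs.\<close>

lemma symmetric_scaling:
  "\<exists>f. (\<forall>P\<in>A. \<exists>c. c \<noteq> 0 \<and> (\<forall>X. f P X = c * g P X)) \<and> (\<forall>P\<in>A. \<forall>Q\<in>A. P \<noteq> Q \<longrightarrow> f P Q = f Q P)"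
proof -
  obtain P0 where P0: "P0 \<in> A" using ex_other by blast
  define c where "c = (\<lambda>P. if P = P0 then 1 else g P0 P / g P P0)"
  have c: "c P \<noteq> 0" if "P \<in> A" for P
    using that P0 g_nonzero by (auto simp: c_def)
  have "c P * g P Q = c Q * g Q P" if "P \<in> A" "Q \<in> A" "P \<noteq> Q" for P Q
  proof -
    consider "P = P0" | "Q = P0" | "P \<noteq> P0" "Q \<noteq> P0" by blast
    then show ?thesis
    proof cases
      case 3
      have "g P0 P * g P Q * g Q P0 = g P0 Q * g P P0 * g Q P"
        by (rule lemma_of_tangents) (use 3 that P0 in auto)
      moreover have "g P P0 \<noteq> 0" "g Q P0 \<noteq> 0" using 3 that P0 g_nonzero by metis+
      ultimately show ?thesis using 3 by (simp add: c_def field_simps)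
    qed (use that P0 g_nonzero in \<open>auto simp: c_def\<close>)
  qed
  then show ?thesis using c
    by (intro exI[of _ "\<lambda>P X. c P * g P X"] conjI) blast+
qed

section \<open>The dual envelope and the extension of arcs\<close>

lemma pencil_form:
  assumes "dot (u::'f\<times>'f\<times>'f) P = 0" "triple_det P Q R \<noteq> 0"
  shows "u = cross P (smul (1 / triple_det P Q R) (smul (dot u R) Q - smul (dot u Q) R))"
proof -
  \<comment> \<open>The second argument of \<open>cross\<close> represents the intersection of the
    line \<open>u\<close> with the join of \<open>Q\<close> and \<open>R\<close>.\<close>
  have "smul (triple_det P Q R) u = cross P (smul (dot u R) Q - smul (dot u Q) R)"
  proof -
    have "smul (triple_det P Q R) u =
        cross P (smul (dot u R) Q - smul (dot u Q) R) + smul (dot u P) (cross Q R)"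
      by (cases P; cases Q; cases R; cases u) (simp add: triple_det_def algebra_simps)
    then show ?thesis using assms(1) by simp
  qed
  then have "smul (1 / triple_det P Q R) (smul (triple_det P Q R) u) =
      smul (1 / triple_det P Q R) (cross P (smul (dot u R) Q - smul (dot u Q) R))"
    by (rule arg_cong)
  moreover have "1 / triple_det P Q R * triple_det P Q R = 1" using assms(2) by (simp only: times_divide_eq_left mult_1_left divide_self_if if_False)
  ultimately show ?thesis by (simp only: cross_smul smul_smul smul_one)
qed

text \<open>The lines \<open>P\<^sup>*\<close> of the dual plane with \<open>P\<close> in the arc are in general position, and
  the rescaled products of tangents are forms of degree \<open>t\<close> on them that agree at the points of
  intersection. They are therefore induced by a single form of degree \<open>t\<close> on the dual plane.\<close>

lemma envelope:
  assumes f: "\<And>P X. P \<in> A \<Longrightarrow> f P X = c P * g P X"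
    and sym: "\<And>P Q. P \<in> A \<Longrightarrow> Q \<in> A \<Longrightarrow> P \<noteq> Q \<Longrightarrow> f P Q = f Q P"
  shows "\<exists>F. triple_form t F \<and> (\<forall>P\<in>A. \<forall>X. F (cross P X) = f P X)"
proof -
  obtain E where E: "E \<subseteq> A" "card E = t + 2"
    using obtain_subset_with_card_n[OF t_le] by metis
  have fE: "finite E" by simp
  obtain e where e: "bij_betw e {0..<t+2} E" using ex_bij_betw_nat_finite[OF fE] E by metis
  define I where "I = {(a, b). b < a \<and> a < t + 2}"
  have fI: "finite I" by (rule finite_subset[of _ "{..<t+2} \<times> {..<t+2}"]) (auto simp: I_def)
  \<comment> \<open>Lagrange interpolation at the secants of \<open>E\<close>: the product over the
    \<open>t\<close> points other than \<open>e a\<close> and \<open>e b\<close> vanishes at every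
    other secant of \<open>E\<close>, since that secant passes through one of these points. The
    condition \<open>b < a\<close> in \<open>I\<close> counts each secant once.\<close>
  define W where "W = (\<lambda>(a,b). E - {e a, e b})"
  define cc where "cc = (\<lambda>(a,b). f (e a) (e b) / (\<Prod>k\<in>W (a,b). dot (cross (e a) (e b)) k))"
  define F where "F = (\<lambda>u. \<Sum>i\<in>I. cc i * (\<Prod>k\<in>W i. dot u k))"
  have inj: "e a = e b \<longleftrightarrow> a = b" if "a < t + 2" "b < t + 2" for a b
    using e that by (auto simp: bij_betw_def inj_on_def)
  have eE: "e a \<in> E" if "a < t + 2" for a
    using e that by (auto simp: bij_betw_def)
  have cardW: "card (W i) = t" if "i \<in> I" for i
  proof -
    obtain a b where i0: "i = (a, b)" by (cases i)
    then have i: "i = (a, b)" "b < a" "a < t + 2" using that by (simp_all add: I_def)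
    have "card {e a, e b} = 2" using inj[of a b] i by (auto simp: card_insert_if)
    then show ?thesis using i eE[of a] eE[of b] E unfolding W_def by (simp add: card_Diff_subset)
  qed
  have "triple_form t (\<lambda>u. \<Prod>k\<in>W i. dot u k)" if "i \<in> I" for i
    using triple_form_prod_dot[of "W i" "\<lambda>k. k"] cardW[OF that] by simp
  then have F: "triple_form t F" unfolding F_def by (intro triple_form_sum triple_form_cmult)
  have val: "F (cross (e a) (e b)) = f (e a) (e b)" if ab: "b < a" "a < t + 2" for a b
  proof -
    have "F (cross (e a) (e b)) = (\<Sum>i\<in>{(a,b)}. cc i * (\<Prod>k\<in>W i. dot (cross (e a) (e b)) k))"
      unfolding F_def
    proof (rule sum.mono_neutral_right[OF fI])
      show "{(a, b)} \<subseteq> I" using ab by (auto simp: I_def)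
      show "\<forall>i\<in>I - {(a, b)}. cc i * (\<Prod>k\<in>W i. dot (cross (e a) (e b)) k) = 0"
      proof
        fix i assume "i \<in> I - {(a, b)}"
        moreover obtain a' b' where i0: "i = (a', b')" by (cases i)
        ultimately have i: "i = (a', b')" "b' < a'" "a' < t + 2" "(a', b') \<noteq> (a, b)"
          by (simp_all add: I_def)
        then have "a \<notin> {a', b'} \<or> b \<notin> {a', b'}" using ab by auto
        then have "e a \<in> W i \<or> e b \<in> W i"
          using i ab eE[of a] eE[of b] inj[of a a'] inj[of a b'] inj[of b a'] inj[of b b']
          by (auto simp: W_def)
        then have "(\<Prod>k\<in>W i. dot (cross (e a) (e b)) k) = 0"
          by (metis dot_cross_self(1,2) finite prod_zero)
        then show "cc i * (\<Prod>k\<in>W i. dot (cross (e a) (e b)) k) = 0" by simp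
      qed
    qed
    moreover have "(\<Prod>k\<in>W (a,b). dot (cross (e a) (e b)) k) \<noteq> 0"
    proof -
      have "dot (cross (e a) (e b)) k \<noteq> 0" if "k \<in> W (a, b)" for k
      proof -
        have k: "k \<in> A" "e a \<noteq> k" "e b \<noteq> k" using that E(1) unfolding W_def by blast+
        have "e a \<in> A" "e b \<in> A" "e a \<noteq> e b" using inj[of a b] eE[of a] eE[of b] ab E(1) by auto
        then have "triple_det (e a) (e b) k \<noteq> 0" using arc[of "e a" "e b" k] k by blast
        then show ?thesis by (simp only: triple_det_def not_False_eq_True)
      qed
      then show ?thesis unfolding prod_zero_iff[OF finite] by blast
    qed
    moreover have "cc (a, b) = f (e a) (e b) / (\<Prod>k\<in>W (a,b). dot (cross (e a) (e b)) k)"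
      by (simp only: cc_def prod.case)
    ultimately show ?thesis
      by (simp only: sum.insert sum.empty finite.emptyI empty_iff not_False_eq_True add_0_right
          times_divide_eq_left nonzero_mult_div_cancel_right)
  qed
  have valE: "F (cross P Q) = f P Q" if PQ: "P \<in> E" "Q \<in> E" "P \<noteq> Q" for P Q
  proof -
    have "E = e ` {0..<t+2}" using e by (simp only: bij_betw_def)
    then obtain a b where "a \<in> {0..<t+2}" "b \<in> {0..<t+2}" and Pe: "P = e a" "Q = e b"
      using PQ(1,2) by blast
    then have ab: "a < t + 2" "b < t + 2" "P = e a" "Q = e b" by simp_all
    then consider "b < a" | "a < b" using PQ(3) by (metis linorder_neqE_nat)
    then show ?thesis
    proof cases
      case 2
      then have "F (cross Q P) = f Q P" using val[of a b] ab by blast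
      moreover have "f P Q = f Q P" using sym PQ E(1) by blast
      ultimately show ?thesis by (simp only: cross_commute[of P Q])
    qed (use val[of b a] ab in blast)
  qed
  have agree: "F (cross P X) = f P X"
    if P: "P \<in> A" and B: "B \<subseteq> A - {P}" "card B \<ge> t + 1" "\<And>S. S \<in> B \<Longrightarrow> F (cross P S) = f P S"
    for P B X
  proof -
    obtain Q where Q: "Q \<in> A" "Q \<noteq> P" using ex_other by blast
    obtain R where R: "R \<in> A" "R \<noteq> P" "R \<noteq> Q" using ex_other by blast
    let ?D = "triple_det P Q R"
    have D: "?D \<noteq> 0" using arc P Q R by auto
    define d where "d = 1 / ?D"
    \<comment> \<open>\<open>f P S\<close> depends on \<open>S\<close> only through the line
      \<open>cross P S\<close>. The map \<open>h\<close> recovers linearly from a line through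
      \<open>P\<close> a point on it, which makes \<open>f P\<close> a form of degree
      \<open>t\<close> in the line.\<close>
    define h where "h = (\<lambda>u. smul d (smul (dot u R) Q - smul (dot u Q) R))"
    have h: "dot w (h (cross P S)) = dot w S" if "dot w P = 0" for w S
    proof -
      have "dot w (smul (dot (cross P S) R) Q - smul (dot (cross P S) Q) R) = ?D * dot w S"
      proof -
        have "dot w (smul (dot (cross P S) R) Q - smul (dot (cross P S) Q) R) =
            ?D * dot w S - triple_det S Q R * dot w P"
          by (cases P; cases Q; cases R; cases S; cases w) (simp add: triple_det_def algebra_simps)
        then show ?thesis using that by simp
      qed
      then show ?thesis using D by (simp add: h_def d_def dot_smul)
    qed
    have fh: "f P (h (cross P S)) = f P S" for S
      using P h by (simp add: f g_def tangents_def)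
    have lin: "h (smul y v + smul z w) = smul y (h v) + smul z (h w)" for y z v w
      by (cases Q; cases R; cases v; cases w) (simp add: h_def algebra_simps)
    have "binary_form t (\<lambda>y z. \<Prod>w\<in>tangents P. dot w (h (smul y v' + smul z w')))" for v' w'
      unfolding lin dot_add dot_smul
      using binary_form_prod_linear[of "tangents P" "\<lambda>w. dot w (h v')" "\<lambda>w. dot w (h w')"]
      by (simp add: card_tangents[OF P] mult.commute)
    then have fhf: "triple_form t (\<lambda>u. f P (h u))"
      using P unfolding triple_form_def f[OF P] g_def by (auto intro: binary_form_cmult)
    have ind: "cross (cross P S) (cross P S') \<noteq> 0" if "S \<in> B" "S' \<in> B" "S \<noteq> S'" for S S'
    proof -
      have "triple_det P S S' \<noteq> 0" using arc[of P S S'] that P B(1) by blast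
      then show ?thesis using arc_nonzero[OF P] by (simp only: cross_cross smul_eq_0_iff) simp
    qed
    have inj: "inj_on (cross P) B" by (rule inj_onI) (metis ind cross_self)
    have "F (cross P X) - f P (h (cross P X)) = 0"
    proof (rule triple_form_eq_0_on_pencil[where U="cross P ` B" and N=P and Q=Q and R=R and t=t
          and F="\<lambda>u. F u - f P (h u)" and w="cross P X"])
      show "triple_form t (\<lambda>u. F u - f P (h u))" by (rule triple_form_diff[OF F fhf])
      show "Suc t \<le> card (cross P ` B)" using B inj by (simp add: card_image)
      show "\<And>u u'. u \<in> cross P ` B \<Longrightarrow> u' \<in> cross P ` B \<Longrightarrow> u \<noteq> u' \<Longrightarrow> cross u u' \<noteq> 0"
        using ind by blast
      show "F u - f P (h u) = 0" if "u \<in> cross P ` B" for u using that B(3) fh by (elim imageE) simp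
      show "dot u P = 0" if "u \<in> cross P ` B" for u using that by (elim imageE) simp
    qed (use D t_pos in simp_all)
    then show ?thesis using fh by simp
  qed
  \<comment> \<open>The choice of \<open>t + 2\<close> points for \<open>E\<close> leaves
    \<open>t + 1\<close> nodes in the pencil of each of its points, just enough for forms of degree
    \<open>t\<close>.\<close>
  have onE: "F (cross P X) = f P X" if P: "P \<in> E" for P X
  proof (rule agree[where B="E - {P}"])
    show "t + 1 \<le> card (E - {P})" using E P by simp
  qed (use P E valE in blast)+
  have "F (cross P X) = f P X" if P: "P \<in> A" for P X
  proof (cases "P \<in> E")
    case False
    show ?thesis
    proof (rule agree[where B=E])
      show "F (cross P S) = f P S" if "S \<in> E" for S
      proof -
        have "f P S = f S P" using sym[of P S] P False that E(1) by blast
        then show ?thesis using onE[OF that, of P] by (simp only: cross_commute[of P S])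
      qed
    qed (use P False E in simp_all, blast)
  qed (use onE in simp)
  with F show ?thesis by blast
qed

text \<open>A common multiple would be tangent at both points, so \<open>P = P'\<close>, and the
  normalization at \<open>ref P\<close> makes the factor 1. Hence the representatives of tangents
  are distinct points of the dual plane.\<close>

lemma cross_tangents:
  assumes "P \<in> A" "P' \<in> A" "u \<in> tangents P" "u' \<in> tangents P'" "u \<noteq> u'"
  shows "cross u u' \<noteq> 0"
proof
  assume eq: "cross u u' = 0"
  have u0: "u \<noteq> 0" using assms by (auto simp: tangents_def)
  obtain s where s: "u' = smul s u" using cross_eq_0_imp_proportional[OF eq u0] by blast
  have "s \<noteq> 0" using s assms(4) by (auto simp: tangents_def)
  then have "P = P'" using s assms by (auto simp: tangents_def dot_smul)
  then have "s = 1" using s assms by (auto simp: tangents_def dot_smul)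
  then show False using s assms by simp
qed

text \<open>If every point of one tangent \<open>u0\<close> were on at most \<open>t\<close>
  tangents, all tangents together would number at most \<open>1 + (q + 1) (t - 1)\<close>; against
  \<open>card A * t\<close> this means \<open>q <= t (t - 1)\<close>. So some point \<open>N\<close>
  of \<open>u0\<close> is on \<open>t + 1\<close> tangents, and the envelope form vanishes on the
  whole pencil of \<open>N\<close>. At a secant the form is a nonzero multiple of
  \<open>g P Q\<close>, hence no secant passes through \<open>N\<close>.\<close>

lemma extension:
  assumes small: "t * (t - 1) < CARD('f)"
  shows "\<exists>N. \<forall>P\<in>A. \<forall>Q\<in>A. P \<noteq> Q \<longrightarrow> triple_det P Q N \<noteq> 0"
proof -
  obtain f where f1: "\<forall>P\<in>A. \<exists>c. c \<noteq> 0 \<and> (\<forall>X. f P X = c * g P X)"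
    and f2: "\<forall>P\<in>A. \<forall>Q\<in>A. P \<noteq> Q \<longrightarrow> f P Q = f Q P"
    using symmetric_scaling by blast
  obtain c where c: "\<And>P. P \<in> A \<Longrightarrow> c P \<noteq> 0" "\<And>P X. P \<in> A \<Longrightarrow> f P X = c P * g P X"
    using bchoice[OF f1] by blast
  obtain F where F: "triple_form t F" "\<And>P X. P \<in> A \<Longrightarrow> F (cross P X) = f P X"
    using envelope[of f c] c f2 by blast
  define T where "T = (\<Union>P\<in>A. tangents P)"
  have cardT: "card T = card A * t"
    unfolding T_def
    by (subst card_UN_disjoint) (auto simp: card_tangents, auto simp: tangents_def)
  have zeroT: "F u = 0" if "u \<in> T" for u
  proof -
    obtain P where P: "P \<in> A" "u \<in> tangents P" using \<open>u \<in> T\<close> by (auto simp: T_def)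
    obtain Q where Q: "Q \<in> A" "Q \<noteq> P" using ex_other by blast
    obtain R where R: "R \<in> A" "R \<noteq> P" "R \<noteq> Q" using ex_other by blast
    have D: "triple_det P Q R \<noteq> 0" using arc P Q R by auto
    define X where "X = smul (1 / triple_det P Q R) (smul (dot u R) Q - smul (dot u Q) R)"
    have "u = cross P X" unfolding X_def by (rule pencil_form) (use P D in \<open>auto simp: tangents_def\<close>)
    moreover have "dot u X = 0" by (simp add: X_def dot_smul dot_diff)
    moreover from this P(2) have "g P X = 0" unfolding g_def by (metis finite prod_zero)
    ultimately show ?thesis using F(2)[OF P(1), of X] c(2)[OF P(1), of X] by simp
  qed
  have crossT: "cross u u' \<noteq> 0" if "u \<in> T" "u' \<in> T" "u \<noteq> u'" for u u'
    using that cross_tangents unfolding T_def by blast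
  obtain P0 where P0: "P0 \<in> A" using ex_other by blast
  have "tangents P0 \<noteq> {}" using card_tangents[OF P0] t_pos by auto
  then obtain u0 where u0: "u0 \<in> tangents P0" by blast
  then have u0T: "u0 \<in> T" using P0 by (auto simp: T_def)
  have "dot u0 P0 = 0" using u0 by (simp add: tangents_def)
  obtain Q where Q: "Q \<in> A" "Q \<noteq> P0" using ex_other by blast
  obtain R where R: "R \<in> A" "R \<noteq> P0" "R \<noteq> Q" using ex_other by blast
  have "triple_det P0 Q R \<noteq> 0" using arc P0 Q R by blast
  then obtain X0 where X0: "u0 = cross P0 X0" using pencil_form[OF \<open>dot u0 P0 = 0\<close>] by blast
  have u0X0: "dot u0 X0 = 0" unfolding X0 by simp
  \<comment> \<open>The \<open>q + 1\<close> points of the line \<open>u0\<close>, indexed by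
    \<open>None\<close> for \<open>P0\<close> and by the field for the others. Every line meets
    \<open>u0\<close> in one of them.\<close>
  define pt where "pt = (\<lambda>i. case i of None \<Rightarrow> P0 | Some l \<Rightarrow> X0 + smul l P0)"
  have ptu0: "dot u0 (pt i) = 0" for i
    using u0X0 \<open>dot u0 P0 = 0\<close> by (cases i) (simp_all add: pt_def dot_add dot_smul)
  have pt0: "pt i \<noteq> 0" for i
  proof
    assume "pt i = 0"
    moreover have "cross P0 (pt i) = u0 \<or> pt i = P0"
      by (cases i) (simp_all add: pt_def cross_add cross_smul X0[symmetric])
    moreover have "u0 \<noteq> 0" using u0 by (auto simp: tangents_def)
    ultimately show False using arc_nonzero[OF P0]
      by (cases P0) (auto simp: zero_prod_def)
  qed
  have cover: "\<exists>i. dot u (pt i) = 0" for u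
  proof (cases "dot u P0 = 0")
    case True then show ?thesis by (intro exI[of _ None]) (simp add: pt_def)
  next
    case False then show ?thesis
      by (intro exI[of _ "Some (- dot u X0 / dot u P0)"]) (simp add: pt_def dot_add dot_smul)
  qed
  have "\<exists>i. card {u\<in>T. dot u (pt i) = 0} \<ge> Suc t"
  proof (rule ccontr)
    assume neg: "\<not> ?thesis"
    have le: "card {u\<in>T - {u0}. dot u (pt i) = 0} \<le> t - 1" for i
    proof -
      have "{u\<in>T. dot u (pt i) = 0} = insert u0 {u\<in>T - {u0}. dot u (pt i) = 0}"
        using u0T ptu0 by auto
      then have "card {u\<in>T. dot u (pt i) = 0} = Suc (card {u\<in>T - {u0}. dot u (pt i) = 0})"
        by simp
      moreover have "card {u\<in>T. dot u (pt i) = 0} < Suc t" using neg by (meson not_le)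
      ultimately show ?thesis by simp
    qed
    have "T - {u0} \<subseteq> (\<Union>i. {u\<in>T - {u0}. dot u (pt i) = 0})" using cover by auto
    then have "card (T - {u0}) \<le> card (\<Union>i. {u\<in>T - {u0}. dot u (pt i) = 0})"
      by (intro card_mono) auto
    also have "\<dots> \<le> (\<Sum>i\<in>UNIV. card {u\<in>T - {u0}. dot u (pt i) = 0})"
      by (rule card_UN_le) simp
    also have "\<dots> \<le> (\<Sum>i\<in>(UNIV :: 'f option set). t - 1)" by (intro sum_mono le)
    also have "\<dots> = (CARD('f) + 1) * (t - 1)" by simp
    finally have "card A * t - 1 \<le> (CARD('f) + 1) * (t - 1)"
      using cardT u0T by simp
    then have "card A * t \<le> (CARD('f) + 1) * (t - 1) + 1" by simp
    moreover obtain t' where t': "t = Suc t'" using t_pos by (cases t) auto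
    ultimately have "card A * Suc t' \<le> (CARD('f) + 1) * t' + 1" by simp
    moreover have "card A + t' = CARD('f) + 1" using card_A t' by simp
    moreover have "t' * t' + t' < CARD('f)" using small t' by simp
    ultimately have "int (card A) * (int t' + 1) \<le> (int CARD('f) + 1) * int t' + 1"
      "int (card A) = int CARD('f) + 1 - int t'" "int t' * int t' + int t' < int CARD('f)"
      by (simp_all flip: of_nat_mult of_nat_add of_nat_Suc of_nat_1 add: algebra_simps)
    then show False by (simp add: algebra_simps)
  qed
  then obtain i where i: "card {u\<in>T. dot u (pt i) = 0} \<ge> Suc t" by blast
  define N where "N = pt i"
  have N0: "N \<noteq> 0" using pt0 by (simp add: N_def)
  obtain Q R where QR: "triple_det N Q R \<noteq> 0" using ex_triple_det_nonzero[OF N0] by blast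
  have all0: "F u = 0" if "dot u N = 0" for u
    by (rule triple_form_eq_0_on_pencil[where U="{u\<in>T. dot u (pt i) = 0}", OF F(1) QR])
       (use i t_pos zeroT crossT that in \<open>auto simp: N_def\<close>)
  have "triple_det P Q N \<noteq> 0" if PQ: "P \<in> A" "Q \<in> A" "P \<noteq> Q" for P Q
  proof
    assume D: "triple_det P Q N = 0"
    have gN: "g P N = 0" if "P \<in> A" for P
      using all0[of "cross P N"] F(2)[OF that, of N] c[OF that] by simp
    obtain u where u: "u \<in> tangents P" "dot u N = 0" using gN[OF PQ(1)] by (auto simp: g_def)
    have "cross P N = 0"
    proof (rule ccontr)
      assume "cross P N \<noteq> 0"
      then obtain X where X: "triple_det P N X \<noteq> 0"
        using ex_dot_nonzero unfolding triple_det_def by blast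
      have "smul (triple_det P N X) u = smul (dot u X) (cross P N)"
        using cramer_dual[of P N X u] u by (simp add: tangents_def)
      then have "triple_det P N X * dot u Q = dot u X * triple_det P N Q"
        by (metis dot_smul(2) triple_det_def)
      moreover have "triple_det P N Q = 0"
        using D by (metis neg_0_equal_iff_equal triple_det_rotate triple_det_swap)
      ultimately have "dot u Q = 0" using X by simp
      then show False using u PQ by (auto simp: tangents_def)
    qed
    then have "dot (cross P Q) N = 0" by (metis D triple_det_def)
    then have "F (cross P Q) = 0" by (rule all0)
    then show False using F(2)[OF PQ(1), of Q] c[OF PQ(1)] g_nonzero[of Q P] PQ by auto
  qed
  then show ?thesis by blast
qed

end

section \<open>Projective spaces of dimension three\<close>

text \<open>The partition arguments below (points into lines or planes, lines into planes) are
  instances of this double count.\<close>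

lemma sum_card_unique:
  assumes "finite X" "finite Y" "\<And>x. x \<in> X \<Longrightarrow> \<exists>!y. y \<in> Y \<and> R x y"
  shows "(\<Sum>y\<in>Y. card {x\<in>X. R x y}) = card X"
proof -
  have "X = (\<Union>y\<in>Y. {x\<in>X. R x y})" using assms(3) by blast
  then have "card X = card (\<Union>y\<in>Y. {x\<in>X. R x y})" by simp
  also have "\<dots> = (\<Sum>y\<in>Y. card {x\<in>X. R x y})"
    by (rule card_UN_disjoint) (use assms in auto)
  finally show ?thesis by simp
qed

text \<open>Lines and planes are sets of points, so that every count is a cardinality of
  intersections. The assumptions are the incidence facts of PG(3,q) on which the counting is built;
  \<open>pg3_axioms\<close> verifies them for the vector space model.\<close>

locale pg3 =
  fixes q :: nat and Pts :: "'p set" and Lns Pls :: "'p set set"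
  assumes q_pos: "q > 0"
    and card_Pts: "card Pts = q^3 + q^2 + q + 1"
    and line_pts: "L \<in> Lns \<Longrightarrow> L \<subseteq> Pts" and card_line: "L \<in> Lns \<Longrightarrow> card L = q + 1"
    and plane_pts: "E \<in> Pls \<Longrightarrow> E \<subseteq> Pts" and card_plane: "E \<in> Pls \<Longrightarrow> card E = q^2 + q + 1"
    and line_ex: "P \<in> Pts \<Longrightarrow> Q \<in> Pts \<Longrightarrow> P \<noteq> Q \<Longrightarrow> \<exists>L\<in>Lns. P \<in> L \<and> Q \<in> L"
    and line_unique: "L \<in> Lns \<Longrightarrow> L' \<in> Lns \<Longrightarrow> P \<in> L \<Longrightarrow> Q \<in> L \<Longrightarrow> P \<in> L' \<Longrightarrow> Q \<in> L' \<Longrightarrow> P \<noteq> Q \<Longrightarrow> L = L'"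
    and plane_ex: "L \<in> Lns \<Longrightarrow> P \<in> Pts \<Longrightarrow> P \<notin> L \<Longrightarrow> \<exists>E\<in>Pls. L \<subseteq> E \<and> P \<in> E"
    and plane_line: "E \<in> Pls \<Longrightarrow> L \<in> Lns \<Longrightarrow> P \<in> E \<Longrightarrow> Q \<in> E \<Longrightarrow> P \<in> L \<Longrightarrow> Q \<in> L \<Longrightarrow> P \<noteq> Q \<Longrightarrow> L \<subseteq> E"
    and plane_inter: "E \<in> Pls \<Longrightarrow> E' \<in> Pls \<Longrightarrow> E \<noteq> E' \<Longrightarrow> E \<inter> E' \<in> Lns"
    and lines_meet: "E \<in> Pls \<Longrightarrow> L \<in> Lns \<Longrightarrow> L' \<in> Lns \<Longrightarrow> L \<subseteq> E \<Longrightarrow> L' \<subseteq> E \<Longrightarrow> L \<inter> L' \<noteq> {}"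
begin

lemma finite_Pts [simp]: "finite Pts"
  using card_Pts by (metis Suc_eq_plus1 card.infinite nat.distinct(1))

lemma finite_sub [simp]: "X \<subseteq> Pts \<Longrightarrow> finite X" by (rule finite_subset[OF _ finite_Pts])

lemma finite_Lns [simp]: "finite Lns"
  by (rule finite_subset[of _ "Pow Pts"]) (use line_pts in auto)

lemma finite_Pls [simp]: "finite Pls"
  by (rule finite_subset[of _ "Pow Pts"]) (use plane_pts in auto)

lemma finite_line [simp]: "L \<in> Lns \<Longrightarrow> finite L" using line_pts by auto

lemma finite_plane [simp]: "E \<in> Pls \<Longrightarrow> finite E" using plane_pts by auto

definition lines_at :: "'p \<Rightarrow> 'p set set" where "lines_at P = {L\<in>Lns. P \<in> L}"

definition planes_on :: "'p set \<Rightarrow> 'p set set" where "planes_on L = {E\<in>Pls. L \<subseteq> E}"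

definition planes_at :: "'p \<Rightarrow> 'p set set" where "planes_at P = {E\<in>Pls. P \<in> E}"

lemma finite_lines_at [simp]: "finite (lines_at P)" by (simp add: lines_at_def)
lemma finite_planes_on [simp]: "finite (planes_on L)" by (simp add: planes_on_def)
lemma finite_planes_at [simp]: "finite (planes_at L)" by (simp add: planes_at_def)

lemma plane_ex1:
  assumes "L \<in> Lns" "P \<in> Pts" "P \<notin> L"
  shows "\<exists>!E. E \<in> planes_on L \<and> P \<in> E"
proof -
  obtain E where E: "E \<in> Pls" "L \<subseteq> E" "P \<in> E" using plane_ex assms by blast
  moreover have "E' = E" if "E' \<in> Pls" "L \<subseteq> E'" "P \<in> E'" for E'
  proof (rule ccontr)
    assume "E' \<noteq> E"
    then have l: "E' \<inter> E \<in> Lns" using plane_inter that E by blast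
    have "L \<subseteq> E' \<inter> E" using that E by blast
    then have "L = E' \<inter> E"
      using card_line[OF l] card_line[OF assms(1)] by (intro card_subset_eq) (use l in auto)
    then show False using assms that E by blast
  qed
  ultimately show ?thesis unfolding planes_on_def by blast
qed

lemma two_points:
  assumes "L \<in> Lns"
  shows "\<exists>Q\<in>L. Q \<noteq> P"
proof (rule ccontr)
  assume "\<not> ?thesis"
  then have "L \<subseteq> {P}" by auto
  then have "card L \<le> 1" using card_mono[of "{P}" L] by simp
  then show False using card_line[OF assms] q_pos by simp
qed

lemma two_lines_plane:
  assumes "L \<in> Lns" "L' \<in> Lns" "P \<in> L" "P \<in> L'" "L \<noteq> L'"
  shows "\<exists>!E. E \<in> planes_on L \<and> L' \<subseteq> E"
proof -
  obtain Q where Q: "Q \<in> L'" "Q \<noteq> P" using two_points assms by blast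
  then have "Q \<notin> L" using line_unique assms by blast
  then have u: "\<exists>!E. E \<in> planes_on L \<and> Q \<in> E" using plane_ex1 assms Q line_pts by blast
  have "L' \<subseteq> E \<longleftrightarrow> Q \<in> E" if "E \<in> planes_on L" for E
    using that Q assms plane_line[of E L' P Q] by (auto simp: planes_on_def)
  then show ?thesis using u by metis
qed

lemma sum_lines_at:
  assumes "P \<in> Pts" "X \<subseteq> Pts"
  shows "(\<Sum>L\<in>lines_at P. card (L \<inter> X - {P})) = card (X - {P})"
proof -
  have "(\<Sum>L\<in>lines_at P. card {x\<in>X - {P}. x \<in> L}) = card (X - {P})"
  proof (rule sum_card_unique)
    fix x assume x: "x \<in> X - {P}"
    then show "\<exists>!L. L \<in> lines_at P \<and> x \<in> L"
      using line_ex[of P x] line_unique[of _ _ P x] assms unfolding lines_at_def by blast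
  qed (use assms in simp_all)
  moreover have "{x\<in>X - {P}. x \<in> L} = L \<inter> X - {P}" for L by auto
  ultimately show ?thesis by simp
qed

lemma sum_lines_in_plane:
  assumes "E \<in> Pls" "P \<in> E" "X \<subseteq> E"
  shows "(\<Sum>L | L \<in> lines_at P \<and> L \<subseteq> E. card (L \<inter> X - {P})) = card (X - {P})"
proof -
  have "(\<Sum>L | L \<in> lines_at P \<and> L \<subseteq> E. card {x\<in>X - {P}. x \<in> L}) = card (X - {P})"
  proof (rule sum_card_unique)
    fix x assume x: "x \<in> X - {P}"
    have "P \<in> Pts" "x \<in> Pts" using assms x plane_pts by blast+
    then show "\<exists>!L. L \<in> {L \<in> lines_at P. L \<subseteq> E} \<and> x \<in> L"
      using line_ex[of P x] line_unique[of _ _ P x] plane_line[of E _ P x] assms x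
      unfolding lines_at_def by blast
  next
    show "finite (X - {P})" using assms finite_subset[OF assms(3)] by simp
  qed simp
  moreover have "{x\<in>X - {P}. x \<in> L} = L \<inter> X - {P}" for L by auto
  ultimately show ?thesis by simp
qed

lemma sum_planes_on:
  assumes "L \<in> Lns" "X \<subseteq> Pts"
  shows "(\<Sum>E\<in>planes_on L. card (E \<inter> X - L)) = card (X - L)"
proof -
  have "(\<Sum>E\<in>planes_on L. card {x\<in>X - L. x \<in> E}) = card (X - L)"
  proof (rule sum_card_unique)
    show "\<exists>!E. E \<in> planes_on L \<and> x \<in> E" if "x \<in> X - L" for x
      using plane_ex1[OF assms(1), of x] that assms(2) by blast
  qed (use assms in simp_all)
  moreover have "{x\<in>X - L. x \<in> E} = E \<inter> X - L" for E by auto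
  ultimately show ?thesis by simp
qed

lemma sum_planes_on_lines:
  assumes "s \<in> Lns" "N \<in> s" "A \<subseteq> lines_at N"
  shows "(\<Sum>E\<in>planes_on s. card {x\<in>A - {s}. x \<subseteq> E}) = card (A - {s})"
proof (rule sum_card_unique)
  show "finite (A - {s})" using assms(3) finite_lines_at finite_subset by blast
  show "\<exists>!E. E \<in> planes_on s \<and> x \<subseteq> E" if "x \<in> A - {s}" for x
    using two_lines_plane[of s x N] assms that unfolding lines_at_def by blast
qed simp

lemma card_lines_at:
  assumes "P \<in> Pts"
  shows "card (lines_at P) = q^2 + q + 1"
proof -
  have "card (L \<inter> Pts - {P}) = q" if "L \<in> lines_at P" for L
    using that line_pts[of L] card_line[of L] by (simp add: lines_at_def Int_absorb2)
  then have "card (lines_at P) * q = card (Pts - {P})"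
    using sum_lines_at[OF assms, of Pts] by simp
  also have "\<dots> = (q^2 + q + 1) * q"
    using assms card_Pts by (simp add: algebra_simps power2_eq_square power3_eq_cube)
  finally show ?thesis using q_pos by (simp only: mult_cancel2 power_eq_0_iff) auto
qed

lemma card_lines_in_plane:
  assumes "E \<in> Pls" "P \<in> E"
  shows "card {L \<in> lines_at P. L \<subseteq> E} = q + 1"
proof -
  have "card (L \<inter> E - {P}) = q" if "L \<in> {L \<in> lines_at P. L \<subseteq> E}" for L
    using that card_line[of L] by (simp add: lines_at_def Int_absorb2)
  then have "card {L \<in> lines_at P. L \<subseteq> E} * q = card (E - {P})"
    using sum_lines_in_plane[OF assms order.refl] by simp
  also have "\<dots> = (q + 1) * q"
    using assms card_plane by (simp add: algebra_simps power2_eq_square)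
  finally show ?thesis using q_pos by (simp only: mult_cancel2 power_eq_0_iff) auto
qed

lemma card_planes_on:
  assumes "L \<in> Lns"
  shows "card (planes_on L) = q + 1"
proof -
  have "card (E \<inter> Pts - L) = q^2" if "E \<in> planes_on L" for E
    using that plane_pts[of E] card_plane[of E] card_line[OF assms] assms
    by (simp add: planes_on_def Int_absorb2 card_Diff_subset)
  then have "card (planes_on L) * q^2 = card (Pts - L)"
    using sum_planes_on[OF assms, of Pts] by simp
  also have "\<dots> = (q + 1) * q^2"
    using assms card_Pts card_line line_pts
    by (simp add: card_Diff_subset algebra_simps power2_eq_square power3_eq_cube)
  finally show ?thesis using q_pos by (simp only: mult_cancel2 power_eq_0_iff) auto
qed

lemma sum_planes_at_lines:
  fixes f :: "'p set \<Rightarrow> 'p set \<Rightarrow> 'b::comm_monoid_add"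
  assumes "A \<subseteq> lines_at P"
  shows "(\<Sum>E\<in>planes_at P. \<Sum>L | L \<in> A \<and> L \<subseteq> E. f E L) = (\<Sum>L\<in>A. \<Sum>E\<in>planes_on L. f E L)"
proof -
  have fA: "finite A" using assms finite_lines_at finite_subset by blast
  have "(\<Sum>E\<in>planes_at P. \<Sum>L | L \<in> A \<and> L \<subseteq> E. f E L) =
    (\<Sum>L\<in>A. \<Sum>E | E \<in> planes_at P \<and> L \<subseteq> E. f E L)"
    by (rule sum.swap_restrict) (use fA in auto)
  moreover have "{E. E \<in> planes_at P \<and> L \<subseteq> E} = planes_on L" if "L \<in> A" for L
    using that assms by (auto simp: planes_at_def planes_on_def lines_at_def)
  ultimately show ?thesis by simp
qed

lemma card_planes_at:
  assumes "P \<in> Pts"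
  shows "card (planes_at P) = q^2 + q + 1"
proof -
  have "(\<Sum>E\<in>planes_at P. \<Sum>L | L \<in> lines_at P \<and> L \<subseteq> E. 1) = (\<Sum>L\<in>lines_at P. \<Sum>E\<in>planes_on L. (1::nat))"
    by (rule sum_planes_at_lines) simp
  moreover have "(\<Sum>E\<in>planes_at P. \<Sum>L | L \<in> lines_at P \<and> L \<subseteq> E. 1) = card (planes_at P) * (q + 1)"
  proof -
    have "(\<Sum>L | L \<in> lines_at P \<and> L \<subseteq> E. (1::nat)) = q + 1" if "E \<in> planes_at P" for E
      using that card_lines_in_plane[of E P] by (simp add: planes_at_def)
    then show ?thesis by simp
  qed
  moreover have "(\<Sum>L\<in>lines_at P. \<Sum>E\<in>planes_on L. (1::nat)) = card (lines_at P) * (q + 1)"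
  proof -
    have "(\<Sum>E\<in>planes_on L. (1::nat)) = q + 1" if "L \<in> lines_at P" for L
      using that card_planes_on[of L] by (simp add: lines_at_def)
    then show ?thesis by simp
  qed
  ultimately show ?thesis using card_lines_at[OF assms] by (simp del: add_Suc_right)
qed

end

section \<open>Caps\<close>

locale pg3_cap = pg3 +
  fixes K :: "'a set"
  assumes K_pts: "K \<subseteq> Pts" and K_nonempty: "K \<noteq> {}"
    and K_line: "L \<in> Lns \<Longrightarrow> card (L \<inter> K) \<le> 2"
begin

lemma finite_K [simp]: "finite K" using K_pts by simp

definition k :: nat where "k = card K"

definition t :: nat where "t = q^2 + q + 2 - k"

definition a :: "'a set \<Rightarrow> nat" where "a E = card (E \<inter> K)"

text \<open>For a plane meeting \<open>K\<close> this is the number of tangents in \<open>E\<close>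
  at each of its points of \<open>K\<close>. For a plane disjoint from \<open>K\<close> it is
  \<open>q + 2\<close> and has no such meaning. By \<open>a_m\<close> the subtraction is never
  truncated on planes.\<close>

definition m :: "'a set \<Rightarrow> nat" where "m E = q + 2 - a E"

definition tans :: "'a \<Rightarrow> 'a set set" where "tans N = {L \<in> lines_at N. card (L \<inter> K) = 1}"

definition secs :: "'a \<Rightarrow> 'a set set" where "secs N = {L \<in> lines_at N. card (L \<inter> K) = 2}"

section \<open>Tangents and secants at the points of the cap\<close>

lemma tans_sub: "tans N \<subseteq> lines_at N" and secs_sub: "secs N \<subseteq> lines_at N"
  by (auto simp: tans_def secs_def)

lemma finite_tans [simp]: "finite (tans N)" "finite (secs N)"
  by (simp_all add: tans_def secs_def)

lemma tans_K_iff: "P \<in> K \<Longrightarrow> L \<in> tans P \<longleftrightarrow> L \<in> Lns \<and> L \<inter> K = {P}"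
  by (auto simp: tans_def lines_at_def card_1_singleton_iff) (metis IntI singletonD)

lemma card_line_minus:
  assumes "P \<in> K" "L \<in> lines_at P"
  shows "card (L \<inter> K - {P}) + (if L \<in> tans P then 1 else 0) = 1"
proof -
  have L: "L \<in> Lns" "P \<in> L \<inter> K" using assms by (auto simp: lines_at_def)
  then have "card (L \<inter> K) > 0" by (metis card_gt_0_iff empty_iff finite_Int finite_K)
  then have "card (L \<inter> K) = 1 \<or> card (L \<inter> K) = 2" using K_line[OF L(1)] by linarith
  then show ?thesis using L assms by (auto simp: tans_def)
qed

lemma tans_or_secs:
  assumes "P \<in> K" "L \<in> lines_at P" "L \<notin> tans P"
  shows "L \<in> secs P"
  using card_line_minus[OF assms(1,2)] assms by (auto simp: secs_def lines_at_def)

lemma tans_not_secs: "L \<in> tans P \<Longrightarrow> L \<notin> secs P'"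
  by (auto simp: tans_def secs_def)

lemma k_tans:
  assumes "P \<in> K"
  shows "k + card (tans P) = q^2 + q + 2"
proof -
  have P: "P \<in> Pts" using assms K_pts by blast
  have "(\<Sum>L\<in>lines_at P. card (L \<inter> K - {P}) + (if L \<in> tans P then 1 else 0)) = (\<Sum>L\<in>lines_at P. 1)"
    by (rule sum.cong) (use card_line_minus[OF assms] in auto)
  then have "card (K - {P}) + card (tans P) = q^2 + q + 1"
    using sum_lines_at[OF P K_pts] card_lines_at[OF P] tans_sub[of P]
    by (simp add: sum.distrib sum.If_cases Int_absorb1)
  moreover have "card K = Suc (card (K - {P}))" by (rule card.remove) (use assms in auto)
  ultimately show ?thesis by (simp add: k_def)
qed

lemma k_t: "k + t = q^2 + q + 2"
proof -
  obtain P where "P \<in> K" using K_nonempty by blast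
  then have "k \<le> q^2 + q + 2" using k_tans by (metis le_add1)
  then show ?thesis by (simp add: t_def)
qed

lemma card_tans: "P \<in> K \<Longrightarrow> card (tans P) = t"
  using k_tans[of P] k_t by simp

lemma card_secs:
  assumes "P \<in> K"
  shows "card (secs P) + 1 = k"
proof -
  have "lines_at P = tans P \<union> secs P" "tans P \<inter> secs P = {}"
    using tans_or_secs[OF assms] tans_sub secs_sub tans_not_secs by blast+
  then have "card (lines_at P) = card (tans P) + card (secs P)"
    by (simp add: card_Un_disjoint)
  then show ?thesis using card_tans[OF assms] card_lines_at[of P] k_t assms K_pts by auto
qed

lemma card_tans_plane':
  assumes "P \<in> K" "E \<in> Pls" "P \<in> E"
  shows "a E + card {L \<in> tans P. L \<subseteq> E} = q + 2"
proof -
  let ?B = "{L. L \<in> lines_at P \<and> L \<subseteq> E}"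
  have fB: "finite ?B" by simp
  have "(\<Sum>L\<in>?B. card (L \<inter> K - {P}) + (if L \<in> tans P then 1 else 0)) = (\<Sum>L\<in>?B. 1)"
    by (rule sum.cong) (use card_line_minus[OF assms(1)] in auto)
  moreover have "(\<Sum>L\<in>?B. card (L \<inter> (E \<inter> K) - {P})) = card (E \<inter> K - {P})"
    by (rule sum_lines_in_plane) (use assms in auto)
  moreover have "(\<Sum>L\<in>?B. card (L \<inter> (E \<inter> K) - {P})) = (\<Sum>L\<in>?B. card (L \<inter> K - {P}))"
    by (rule sum.cong) (auto intro!: arg_cong[where f=card])
  moreover have "(\<Sum>L\<in>?B. (if L \<in> tans P then 1 else 0)) = card {L \<in> tans P. L \<subseteq> E}"
    using tans_sub[of P] by (subst sum.If_cases) (auto intro!: arg_cong[where f=card])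
  ultimately have "card (E \<inter> K - {P}) + card {L \<in> tans P. L \<subseteq> E} = q + 1"
    using card_lines_in_plane[OF assms(2,3)] by (simp add: sum.distrib)
  moreover have "card (E \<inter> K) = Suc (card (E \<inter> K - {P}))"
    by (rule card.remove) (use assms in auto)
  ultimately show ?thesis by (simp add: a_def)
qed

lemma a_m: "E \<in> Pls \<Longrightarrow> a E + m E = q + 2"
proof (cases "E \<inter> K = {}")
  case False
  assume "E \<in> Pls"
  then show ?thesis using False card_tans_plane' by (fastforce simp: m_def)
qed (simp add: a_def m_def)

lemma card_tans_plane:
  assumes "P \<in> K" "E \<in> Pls" "P \<in> E"
  shows "card {L \<in> tans P. L \<subseteq> E} = m E"
  using card_tans_plane'[OF assms] a_m[OF assms(2)] by simp

lemma m_pos: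
  assumes "P \<in> K" "l \<in> tans P" "E \<in> planes_on l"
  shows "m E \<ge> 1"
proof -
  have "E \<in> Pls" "P \<in> E" "l \<in> {L \<in> tans P. L \<subseteq> E}" using assms by (auto simp: planes_on_def tans_def lines_at_def)
  then show ?thesis using card_tans_plane[OF assms(1), of E]
    by (metis (no_types, lifting) One_nat_def Suc_leI card_gt_0_iff empty_iff finite_tans(1) finite_Collect_conjI mem_Collect_eq finite_subset subsetI)
qed

text \<open>Every other tangent at \<open>P\<close> lies in one plane on \<open>l\<close>, and
  \<open>l\<close> itself in all \<open>q + 1\<close>, giving \<open>(t - 1) + (q + 1)\<close>. For
  a secant the second summand is missing.\<close>

lemma sum_m_tangent:
  assumes "P \<in> K" "l \<in> tans P"
  shows "(\<Sum>E\<in>planes_on l. m E) = t + q"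
proof -
  have l: "l \<in> Lns" "P \<in> l" using assms by (auto simp: tans_def lines_at_def)
  have "card {x \<in> tans P - {l}. x \<subseteq> E} + 1 = m E" if "E \<in> planes_on l" for E
  proof -
    have E: "E \<in> Pls" "P \<in> E" "l \<in> {L \<in> tans P. L \<subseteq> E}" using assms l that by (auto simp: planes_on_def)
    have "{x \<in> tans P - {l}. x \<subseteq> E} = {L \<in> tans P. L \<subseteq> E} - {l}" by auto
    moreover have "card {L \<in> tans P. L \<subseteq> E} = Suc (card ({L \<in> tans P. L \<subseteq> E} - {l}))"
      by (rule card.remove) (use E in auto)
    ultimately show ?thesis using card_tans_plane[OF assms(1) E(1,2)] by simp
  qed
  then have "(\<Sum>E\<in>planes_on l. m E) = (\<Sum>E\<in>planes_on l. card {x \<in> tans P - {l}. x \<subseteq> E} + 1)"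
    by (intro sum.cong) auto
  also have "\<dots> = card (tans P - {l}) + (q + 1)"
    using sum_planes_on_lines[OF l tans_sub] card_planes_on[OF l(1)] by (simp add: sum_Suc)
  also have "\<dots> = t + q" using card_tans[OF assms(1)] card.remove[OF finite_tans(1) assms(2)] by simp
  finally show ?thesis .
qed

lemma sum_m_secant:
  assumes "P \<in> K" "s \<in> secs P"
  shows "(\<Sum>E\<in>planes_on s. m E) = t"
proof -
  have l: "s \<in> Lns" "P \<in> s" using assms by (auto simp: secs_def lines_at_def)
  have n: "tans P - {s} = tans P" using assms tans_not_secs by blast
  have "card {x \<in> tans P - {s}. x \<subseteq> E} = m E" if "E \<in> planes_on s" for E
    using card_tans_plane[OF assms(1), of E] l that n by (auto simp: planes_on_def)
  then have "(\<Sum>E\<in>planes_on s. m E) = card (tans P - {s})"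
    using sum_planes_on_lines[OF l tans_sub] by simp
  then show ?thesis using n card_tans[OF assms(1)] by simp
qed

section \<open>Tangents and secants through points outside the cap\<close>

lemma tau_sigma:
  assumes "N \<in> Pts - K"
  shows "card (tans N) + 2 * card (secs N) = k"
proof -
  have c: "card (L \<inter> K - {N}) = (if L \<in> tans N then 1 else 0) + (if L \<in> secs N then 2 else 0)"
    if "L \<in> lines_at N" for L
  proof -
    have "L \<in> Lns" using that by (simp add: lines_at_def)
    then have "card (L \<inter> K) = 0 \<or> card (L \<inter> K) = 1 \<or> card (L \<inter> K) = 2"
      using K_line[of L] by linarith
    moreover have "L \<inter> K - {N} = L \<inter> K" using assms by auto
    ultimately show ?thesis using that by (auto simp: tans_def secs_def)
  qed
  have "card (K - {N}) = (\<Sum>L\<in>lines_at N. card (L \<inter> K - {N}))"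
    using sum_lines_at[of N K] assms K_pts by simp
  also have "\<dots> = (\<Sum>L\<in>lines_at N. (if L \<in> tans N then 1 else 0) + (if L \<in> secs N then 2 else 0))"
    by (rule sum.cong) (use c in auto)
  also have "\<dots> = card (tans N) + 2 * card (secs N)"
    using tans_sub[of N] secs_sub[of N] by (simp add: sum.distrib sum.If_cases Int_absorb1)
  finally show ?thesis using assms by (simp add: k_def)
qed

lemma tau_sigma_plane:
  assumes "N \<in> Pts - K" "E \<in> Pls" "N \<in> E"
  shows "card {L \<in> tans N. L \<subseteq> E} + 2 * card {L \<in> secs N. L \<subseteq> E} = a E"
proof -
  let ?B = "{L. L \<in> lines_at N \<and> L \<subseteq> E}"
  have c: "card (L \<inter> (E \<inter> K) - {N}) = (if L \<in> tans N then 1 else 0) + (if L \<in> secs N then 2 else 0)"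
    if "L \<in> ?B" for L
  proof -
    have "L \<in> Lns" using that by (simp add: lines_at_def)
    then have "card (L \<inter> K) = 0 \<or> card (L \<inter> K) = 1 \<or> card (L \<inter> K) = 2"
      using K_line[of L] by linarith
    moreover have "L \<inter> (E \<inter> K) - {N} = L \<inter> K" using assms that by auto
    ultimately show ?thesis using that by (auto simp: tans_def secs_def)
  qed
  have "card (E \<inter> K - {N}) = (\<Sum>L\<in>?B. card (L \<inter> (E \<inter> K) - {N}))"
    using sum_lines_in_plane[OF assms(2,3), of "E \<inter> K"] by simp
  also have "\<dots> = (\<Sum>L\<in>?B. (if L \<in> tans N then 1 else 0) + (if L \<in> secs N then 2 else 0))"
    by (rule sum.cong) (use c in auto)
  also have "\<dots> = card (?B \<inter> tans N) + 2 * card (?B \<inter> secs N)"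
    by (simp add: sum.distrib sum.If_cases)
  also have "?B \<inter> tans N = {L \<in> tans N. L \<subseteq> E}" using tans_sub by blast
  also have "?B \<inter> secs N = {L \<in> secs N. L \<subseteq> E}" using secs_sub by blast
  finally show ?thesis using assms by (simp add: a_def)
qed

lemma sum_tau_planes:
  assumes "s \<in> Lns" "N \<in> s" "s \<notin> tans N"
  shows "(\<Sum>E\<in>planes_on s. card {L \<in> tans N. L \<subseteq> E}) = card (tans N)"
  using sum_planes_on_lines[OF assms(1,2) tans_sub] assms(3) by simp

lemma a_pos: "P \<in> K \<Longrightarrow> P \<in> E \<Longrightarrow> a E \<ge> 1"
  unfolding a_def by (metis IntI One_nat_def Suc_leI card_gt_0_iff empty_iff finite_Int finite_K)

text \<open>Counts the tangents at other points that meet \<open>l\<close>, once by the point of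
  intersection and once by the plane spanned with \<open>l\<close>. A plane \<open>E\<close>
  contributes \<open>m E\<close> tangents at each of its \<open>a E - 1\<close> further points of
  \<open>K\<close>, because lines of \<open>E\<close> always meet. The summand \<open>q\<close> is
  \<open>l\<close> itself, counted at each of its points outside \<open>K\<close>.\<close>

lemma sum_tau_tangent:
  assumes P: "P \<in> K" and l: "l \<in> tans P"
  shows "(\<Sum>N\<in>l - {P}. card (tans N)) = (\<Sum>E\<in>planes_on l. (a E - 1) * m E) + q"
proof -
  have l': "l \<in> Lns" "l \<inter> K = {P}" using tans_K_iff[OF P] l by auto
  define X where "X = {x\<in>Lns. card (x \<inter> K) = 1 \<and> x \<noteq> l \<and> P \<notin> x \<and> x \<inter> l \<noteq> {}}"
  have fX: "finite X" by (simp add: X_def)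
  have "(\<Sum>N\<in>l - {P}. card {x\<in>X. N \<in> x}) = card X"
  proof (rule sum_card_unique[OF fX])
    show "finite (l - {P})" using l' by simp
    fix x assume x: "x \<in> X"
    then obtain N where N: "N \<in> x" "N \<in> l" by (auto simp: X_def)
    have "N' = N" if "N' \<in> x" "N' \<in> l" for N'
      using line_unique[of x l N' N] x l' N that by (auto simp: X_def)
    then show "\<exists>!N. N \<in> l - {P} \<and> N \<in> x" using N x unfolding X_def by blast
  qed
  moreover have "card {x\<in>X. N \<in> x} + 1 = card (tans N)" if N: "N \<in> l - {P}" for N
  proof -
    have lN: "l \<in> tans N" using l' N by (simp add: tans_def lines_at_def)
    have "{x\<in>X. N \<in> x} = tans N - {l}"
    proof (intro equalityI subsetI)
      fix x assume x: "x \<in> tans N - {l}"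
      have "P \<notin> x" using line_unique[of x l P N] x l' N by (auto simp: tans_def lines_at_def)
      then show "x \<in> {x\<in>X. N \<in> x}" using x N by (auto simp: X_def tans_def lines_at_def)
    qed (auto simp: X_def tans_def lines_at_def)
    then show ?thesis using card.remove[OF finite_tans(1) lN] by simp
  qed
  moreover have "card (l - {P}) = q"
  proof -
    have "P \<in> l" using l'(2) by blast
    then show ?thesis using card_line[OF l'(1)] l'(1) by simp
  qed
  ultimately have 1: "(\<Sum>N\<in>l - {P}. card (tans N)) = card X + q"
    by (metis (no_types, lifting) card_eq_sum sum.cong sum.distrib)
  have "(\<Sum>E\<in>planes_on l. card {x\<in>X. x \<subseteq> E}) = card X"
  proof (rule sum_card_unique[OF fX])
    fix x assume x: "x \<in> X"
    then obtain N where N: "N \<in> x" "N \<in> l" by (auto simp: X_def)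
    then show "\<exists>!E. E \<in> planes_on l \<and> x \<subseteq> E"
      using two_lines_plane[of l x N] x l' by (auto simp: X_def)
  qed simp
  moreover have "card {x\<in>X. x \<subseteq> E} = (a E - 1) * m E" if E: "E \<in> planes_on l" for E
  proof -
    have E': "E \<in> Pls" "P \<in> E" "l \<subseteq> E" using E l' by (auto simp: planes_on_def)
    have "{x\<in>X. x \<subseteq> E} = (\<Union>Q\<in>E \<inter> K - {P}. {L\<in>tans Q. L \<subseteq> E})"
    proof (intro equalityI subsetI)
      fix x assume x: "x \<in> {x\<in>X. x \<subseteq> E}"
      then obtain Q where Q: "x \<inter> K = {Q}" by (auto simp: X_def card_1_singleton_iff)
      then have "Q \<noteq> P" "Q \<in> K" "Q \<in> E" using x by (auto simp: X_def)
      moreover have "x \<in> tans Q" using x Q tans_K_iff[OF \<open>Q \<in> K\<close>] by (auto simp: X_def)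
      ultimately show "x \<in> (\<Union>Q\<in>E \<inter> K - {P}. {L\<in>tans Q. L \<subseteq> E})" using x by blast
    next
      fix x assume "x \<in> (\<Union>Q\<in>E \<inter> K - {P}. {L\<in>tans Q. L \<subseteq> E})"
      then obtain Q where Q: "Q \<in> K" "Q \<noteq> P" "x \<in> tans Q" "x \<subseteq> E" by blast
      then have x: "x \<in> Lns" "x \<inter> K = {Q}" using tans_K_iff by auto
      have "P \<notin> x" using P Q(2) x(2) by (metis IntI singletonD)
      then show "x \<in> {x\<in>X. x \<subseteq> E}"
        using x Q lines_meet[OF E'(1), of x l] E' l' by (auto simp: X_def)
    qed
    also have "card \<dots> = (\<Sum>Q\<in>E \<inter> K - {P}. card {L\<in>tans Q. L \<subseteq> E})"
    proof (rule card_UN_disjoint)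
      have "False" if "Q \<in> K" "Q' \<in> K" "Q \<noteq> Q'" "L \<in> tans Q" "L \<in> tans Q'" for Q Q' L
        using that tans_K_iff[of Q L] tans_K_iff[of Q' L] by auto
      then show "\<forall>i\<in>E \<inter> K - {P}. \<forall>j\<in>E \<inter> K - {P}. i \<noteq> j \<longrightarrow>
          {L \<in> tans i. L \<subseteq> E} \<inter> {L \<in> tans j. L \<subseteq> E} = {}"
        by blast
    qed auto
    also have "\<dots> = (\<Sum>Q\<in>E \<inter> K - {P}. m E)"
      by (rule sum.cong) (use card_tans_plane E' in auto)
    also have "\<dots> = (a E - 1) * m E"
      using P E' by (simp add: a_def)
    finally show ?thesis .
  qed
  ultimately show ?thesis using 1 by simp
qed

lemma card_secs_plane:
  assumes "P \<in> K" "E \<in> Pls" "P \<in> E"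
  shows "card {L \<in> secs P. L \<subseteq> E} = a E - 1"
proof -
  have "{L. L \<in> lines_at P \<and> L \<subseteq> E} = {L \<in> secs P. L \<subseteq> E} \<union> {L \<in> tans P. L \<subseteq> E}"
    using tans_or_secs[OF assms(1)] tans_sub secs_sub by blast
  moreover have "{L \<in> secs P. L \<subseteq> E} \<inter> {L \<in> tans P. L \<subseteq> E} = {}" using tans_not_secs by blast
  ultimately have "q + 1 = card {L \<in> secs P. L \<subseteq> E} + card {L \<in> tans P. L \<subseteq> E}"
    using card_lines_in_plane[OF assms(2,3)] card_Un_disjoint[of "{L \<in> secs P. L \<subseteq> E}" "{L \<in> tans P. L \<subseteq> E}"]
    by simp
  then show ?thesis using card_tans_plane[OF assms] a_m[OF assms(2)] by simp
qed

section \<open>Moments of \<open>m\<close> over the planes through a point of the cap\<close>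

lemma sum_planes_at_secants:
  fixes f :: "'a set \<Rightarrow> real"
  assumes "P \<in> K"
  shows "(\<Sum>E\<in>planes_at P. (real (a E) - 1) * f E) = (\<Sum>s\<in>secs P. \<Sum>E\<in>planes_on s. f E)"
proof -
  have c: "(\<Sum>L | L \<in> secs P \<and> L \<subseteq> E. f E) = (real (a E) - 1) * f E" if "E \<in> planes_at P" for E
    using card_secs_plane[OF assms, of E] a_pos[OF assms, of E] that
    by (simp add: planes_at_def of_nat_diff)
  then have "(\<Sum>E\<in>planes_at P. (real (a E) - 1) * f E) = (\<Sum>E\<in>planes_at P. \<Sum>L | L \<in> secs P \<and> L \<subseteq> E. f E)"
    by (intro sum.cong[OF refl] c[symmetric])
  also have "\<dots> = (\<Sum>s\<in>secs P. \<Sum>E\<in>planes_on s. f E)" by (rule sum_planes_at_lines[OF secs_sub])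
  finally show ?thesis .
qed

lemma sum_planes_at_tangents:
  fixes f :: "'a set \<Rightarrow> real"
  assumes "P \<in> K"
  shows "(\<Sum>E\<in>planes_at P. real (m E) * f E) = (\<Sum>s\<in>tans P. \<Sum>E\<in>planes_on s. f E)"
proof -
  have c: "(\<Sum>L | L \<in> tans P \<and> L \<subseteq> E. f E) = real (m E) * f E" if "E \<in> planes_at P" for E
    using card_tans_plane[OF assms, of E] that by (simp add: planes_at_def)
  then have "(\<Sum>E\<in>planes_at P. real (m E) * f E) = (\<Sum>E\<in>planes_at P. \<Sum>L | L \<in> tans P \<and> L \<subseteq> E. f E)"
    by (intro sum.cong[OF refl] c[symmetric])
  also have "\<dots> = (\<Sum>s\<in>tans P. \<Sum>E\<in>planes_on s. f E)" by (rule sum_planes_at_lines[OF tans_sub])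
  finally show ?thesis .
qed

lemma real_a: "E \<in> Pls \<Longrightarrow> real (a E) = real q + 2 - real (m E)"
  using a_m[of E] by (simp add: algebra_simps flip: of_nat_add)

lemma secant_moments:
  assumes P: "P \<in> K"
  shows "(\<Sum>E\<in>planes_at P. (real (a E) - 1)) = (real k - 1) * (real q + 1)"
    and "(\<Sum>E\<in>planes_at P. (real (a E) - 1) * real (m E)) = (real k - 1) * real t"
proof -
  have c: "real (card (secs P)) = real k - 1" using card_secs[OF P] by (simp flip: of_nat_Suc)
  have "(\<Sum>E\<in>planes_at P. (real (a E) - 1) * 1) = (\<Sum>s\<in>secs P. \<Sum>E\<in>planes_on s. 1)"
    by (rule sum_planes_at_secants[OF P])
  also have "\<dots> = (\<Sum>s\<in>secs P. real q + 1)"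
    by (rule sum.cong) (use card_planes_on in \<open>auto simp: secs_def lines_at_def\<close>)
  finally show "(\<Sum>E\<in>planes_at P. (real (a E) - 1)) = (real k - 1) * (real q + 1)" using c by simp
  have "(\<Sum>E\<in>planes_at P. (real (a E) - 1) * real (m E)) = (\<Sum>s\<in>secs P. \<Sum>E\<in>planes_on s. real (m E))"
    by (rule sum_planes_at_secants[OF P])
  also have "\<dots> = (\<Sum>s\<in>secs P. real t)"
    by (rule sum.cong) (use sum_m_secant[OF P] in \<open>auto simp flip: of_nat_sum\<close>)
  finally show "(\<Sum>E\<in>planes_at P. (real (a E) - 1) * real (m E)) = (real k - 1) * real t" using c by simp
qed

text \<open>Since \<open>a = q + 2 - m\<close>, the sum of \<open>(a - 1) m\<close> is a linear term
  minus the second moment of \<open>m\<close>. Few tangents through the outer points of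
  \<open>l\<close> therefore force a large second moment along \<open>l\<close>.\<close>

lemma tangent_moment_bound:
  fixes B :: real
  assumes P: "P \<in> K" and l: "l \<in> tans P" and B: "\<And>N. N \<in> Pts - K \<Longrightarrow> real (card (tans N)) \<le> B"
  shows "(\<Sum>E\<in>planes_on l. (real (a E) - 1) * real (m E)) \<le> real q * (B - 1)"
    and "(\<Sum>E\<in>planes_on l. (real (m E) - 1)^2) \<ge> real q ^ 2 + real q - (real t - 1) - real q * (B - real t)"
proof -
  have l': "l \<in> Lns" "l \<inter> K = {P}" using tans_K_iff[OF P] l by auto
  have pl: "E \<in> Pls" "P \<in> E" if "E \<in> planes_on l" for E using that l' by (auto simp: planes_on_def)
  have "(\<Sum>E\<in>planes_on l. (real (a E) - 1) * real (m E)) + real q =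
      real ((\<Sum>E\<in>planes_on l. (a E - 1) * m E) + q)"
    using a_pos[OF P pl(2)] by (simp add: of_nat_diff)
  also have "\<dots> = (\<Sum>N\<in>l - {P}. real (card (tans N)))"
    using sum_tau_tangent[OF P l] by (metis of_nat_sum)
  also have "\<dots> \<le> (\<Sum>N\<in>l - {P}. B)"
    by (rule sum_mono) (use B l' line_pts[OF l'(1)] in auto)
  also have "\<dots> = real q * B"
  proof -
    have "P \<in> l" using l'(2) by blast
    then show ?thesis using card_line[OF l'(1)] l'(1) by simp
  qed
  finally show 1: "(\<Sum>E\<in>planes_on l. (real (a E) - 1) * real (m E)) \<le> real q * (B - 1)"
    by (simp add: algebra_simps)
  have s: "(\<Sum>E\<in>planes_on l. real (m E)) = real t + real q"
    using sum_m_tangent[OF P l] by (metis of_nat_add of_nat_sum)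
  have c: "(\<Sum>E\<in>planes_on l. (1::real)) = real q + 1" using card_planes_on[OF l'(1)] by simp
  have "(\<Sum>E\<in>planes_on l. (real (m E) - 1)^2) =
      (\<Sum>E\<in>planes_on l. (real q - 1) * real (m E) + 1 * 1 - (real (a E) - 1) * real (m E))"
    by (rule sum.cong[OF refl]) (simp add: real_a[OF pl(1)], simp add: algebra_simps power2_eq_square)
  also have "\<dots> = (real q - 1) * (real t + real q) + (real q + 1) - (\<Sum>E\<in>planes_on l. (real (a E) - 1) * real (m E))"
    unfolding sum_subtractf sum.distrib sum_distrib_left[symmetric] s c by simp
  finally show "(\<Sum>E\<in>planes_on l. (real (m E) - 1)^2) \<ge> real q ^ 2 + real q - (real t - 1) - real q * (B - real t)"
    using 1 by (simp add: algebra_simps power2_eq_square)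
qed

text \<open>Summing the previous upper bound over the \<open>t\<close> tangents at \<open>P\<close>
  counts each plane \<open>m E\<close> times.\<close>

lemma second_moment_bound:
  fixes B :: real
  assumes P: "P \<in> K" and B: "\<And>N. N \<in> Pts - K \<Longrightarrow> real (card (tans N)) \<le> B"
  shows "(\<Sum>E\<in>planes_at P. (real (a E) - 1) * real (m E) ^ 2) \<le> real t * (real q * (B - 1))"
proof -
  have "(\<Sum>E\<in>planes_at P. (real (a E) - 1) * real (m E) ^ 2) =
      (\<Sum>E\<in>planes_at P. real (m E) * ((real (a E) - 1) * real (m E)))"
    by (simp add: power2_eq_square mult_ac)
  also have "\<dots> = (\<Sum>l\<in>tans P. \<Sum>E\<in>planes_on l. (real (a E) - 1) * real (m E))"
    by (rule sum_planes_at_tangents[OF P])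
  also have "\<dots> \<le> (\<Sum>l\<in>tans P. real q * (B - 1))"
    by (intro sum_mono tangent_moment_bound(1)[OF P _ B])
  also have "\<dots> = real t * (real q * (B - 1))" by (simp add: card_tans[OF P])
  finally show ?thesis .
qed

end

section \<open>Hyperovals and nuclei\<close>

text \<open>\<open>segre\<close> is \<open>even_arc.extension\<close> freed of coordinates; it is
  established in \<open>plane_arc_extension\<close>.\<close>

locale pg3_even = pg3 +
  assumes q_ge: "q \<ge> 2048"
    and segre: "E \<in> Pls \<Longrightarrow> A \<subseteq> E \<Longrightarrow> (\<And>L. L \<in> Lns \<Longrightarrow> card (L \<inter> A) \<le> 2) \<Longrightarrow> card A + n = q + 2 \<Longrightarrow>
       n \<ge> 1 \<Longrightarrow> n * (n - 1) < q \<Longrightarrow> \<exists>N\<in>E - A. \<forall>L\<in>Lns. card (L \<inter> insert N A) \<le> 2"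
begin

lemma hyperoval_ex:
  assumes "E \<in> Pls" "A \<subseteq> E" "\<And>L. L \<in> Lns \<Longrightarrow> card (L \<inter> A) \<le> 2" "card A + n = q + 2" "n * (n - 1) < q"
  shows "\<exists>H. A \<subseteq> H \<and> H \<subseteq> E \<and> card H = q + 2 \<and> (\<forall>L\<in>Lns. card (L \<inter> H) \<le> 2)"
  using assms(2-)
proof (induction n arbitrary: A)
  case 0
  then show ?case by (intro exI[of _ A]) auto
next
  case (Suc n)
  then obtain N where N: "N \<in> E - A" "\<forall>L\<in>Lns. card (L \<inter> insert N A) \<le> 2"
    using segre[OF assms(1), of A "Suc n"] by auto
  have "finite A" using Suc.prems(1) assms(1) finite_subset finite_plane by blast
  then have c: "card (insert N A) + n = q + 2" using N Suc.prems by simp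
  have "n * (n - 1) \<le> Suc n * (Suc n - 1)" by (intro mult_le_mono) auto
  then have "n * (n - 1) < q" using Suc.prems(4) by simp
  with c N Suc.prems(1) Suc.IH[of "insert N A"] show ?case by (metis DiffD1 insert_subset)
qed

text \<open>The \<open>q + 1\<close> lines of \<open>E\<close> through \<open>P\<close> each carry
  at most one of the \<open>q + 1\<close> other points of \<open>H\<close>, hence exactly
  one.\<close>

lemma hyperoval_line:
  assumes "E \<in> Pls" "H \<subseteq> E" "card H = q + 2" "\<And>L. L \<in> Lns \<Longrightarrow> card (L \<inter> H) \<le> 2"
    and L: "L \<in> Lns" "L \<subseteq> E" "P \<in> L" "P \<in> H"
  shows "card (L \<inter> H) = 2"
proof -
  let ?B = "{L. L \<in> lines_at P \<and> L \<subseteq> E}"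
  have PE: "P \<in> E" using L by blast
  have fH: "finite H" using assms finite_subset finite_plane by blast
  have c: "card (M \<inter> H) = Suc (card (M \<inter> H - {P}))" if "M \<in> ?B" for M
    by (rule card.remove) (use that fH L in \<open>auto simp: lines_at_def\<close>)
  have le: "card (M \<inter> H - {P}) \<le> 1" if "M \<in> ?B" for M
    using c[OF that] assms(4)[of M] that by (simp add: lines_at_def)
  have "(\<Sum>M\<in>?B. card (M \<inter> H - {P})) = q + 1"
    using sum_lines_in_plane[of E P H] assms fH PE by (simp add: card_Diff_singleton)
  also have "\<dots> = (\<Sum>M\<in>?B. 1)" using card_lines_in_plane[of E P] assms PE by auto
  finally have eq: "(\<Sum>M\<in>?B. card (M \<inter> H - {P})) = (\<Sum>M\<in>?B. 1)" .
  have "card (L \<inter> H - {P}) = 1"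
  proof (rule ccontr)
    assume "card (L \<inter> H - {P}) \<noteq> 1"
    then have "card (L \<inter> H - {P}) < 1" using le[of L] L by (auto simp: lines_at_def)
    then have "(\<Sum>M\<in>?B. card (M \<inter> H - {P})) < (\<Sum>M\<in>?B. 1)"
      by (intro sum_strict_mono_ex1) (use le L in \<open>auto simp: lines_at_def\<close>)
    then show False using eq by simp
  qed
  moreover have "L \<in> ?B" using L by (simp add: lines_at_def)
  ultimately show ?thesis using c[of L] by presburger
qed

end

locale pg3_even_cap = pg3_even + pg3_cap
begin

text \<open>The range of \<open>m\<close> in which \<open>segre\<close> applies, so that
  \<open>E\<close> has a hyperoval through its points of \<open>K\<close>.\<close>

definition nice :: "'a set \<Rightarrow> bool" where "nice E \<longleftrightarrow> m E * (m E - 1) < q"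

definition hyp :: "'a set \<Rightarrow> 'a set" where
  "hyp E = (SOME H. E \<inter> K \<subseteq> H \<and> H \<subseteq> E \<and> card H = q + 2 \<and> (\<forall>L\<in>Lns. card (L \<inter> H) \<le> 2))"

definition nuc :: "'a set \<Rightarrow> 'a set" where "nuc E = hyp E - K"

lemma hyp:
  assumes "E \<in> Pls" "nice E"
  shows "E \<inter> K \<subseteq> hyp E" "hyp E \<subseteq> E" "card (hyp E) = q + 2" "\<And>L. L \<in> Lns \<Longrightarrow> card (L \<inter> hyp E) \<le> 2"
proof -
  have "card (L \<inter> (E \<inter> K)) \<le> 2" if "L \<in> Lns" for L
    using K_line[OF that] card_mono[of "L \<inter> K" "L \<inter> (E \<inter> K)"] by fastforce
  then have "\<exists>H. E \<inter> K \<subseteq> H \<and> H \<subseteq> E \<and> card H = q + 2 \<and> (\<forall>L\<in>Lns. card (L \<inter> H) \<le> 2)"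
    using a_m[OF assms(1)] assms(2) by (intro hyperoval_ex[OF assms(1)]) (auto simp: a_def nice_def)
  from someI_ex[OF this]
  show "E \<inter> K \<subseteq> hyp E" "hyp E \<subseteq> E" "card (hyp E) = q + 2" "\<And>L. L \<in> Lns \<Longrightarrow> card (L \<inter> hyp E) \<le> 2"
    unfolding hyp_def by auto
qed

lemma finite_hyp: "E \<in> Pls \<Longrightarrow> nice E \<Longrightarrow> finite (hyp E)"
  using hyp(2) finite_plane finite_subset by blast

lemma nuc: 
  assumes "E \<in> Pls" "nice E"
  shows "nuc E \<subseteq> E" "card (nuc E) = m E" "finite (nuc E)"
proof -
  show "nuc E \<subseteq> E" using hyp(2)[OF assms] by (auto simp: nuc_def)
  show "finite (nuc E)" using finite_hyp[OF assms] by (simp add: nuc_def)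
  have "nuc E = hyp E - E \<inter> K" using hyp(2)[OF assms] by (auto simp: nuc_def)
  then have "card (nuc E) = q + 2 - a E"
    using hyp[OF assms] finite_hyp[OF assms] by (simp add: card_Diff_subset a_def)
  then show "card (nuc E) = m E" by (simp add: m_def)
qed

lemma nucleus_no_secant:
  assumes "E \<in> Pls" "nice E" "N \<in> nuc E" "L \<in> secs N"
  shows "\<not> L \<subseteq> E"
proof
  assume LE: "L \<subseteq> E"
  have L: "L \<in> Lns" "N \<in> L" "card (L \<inter> K) = 2" using assms by (auto simp: secs_def lines_at_def)
  have "insert N (L \<inter> K) \<subseteq> L \<inter> hyp E" using hyp(1)[OF assms(1,2)] LE assms L by (auto simp: nuc_def)
  then have "card (insert N (L \<inter> K)) \<le> card (L \<inter> hyp E)" using finite_hyp assms by (intro card_mono) auto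
  moreover have "card (insert N (L \<inter> K)) = 3" using L assms by (simp add: nuc_def)
  ultimately show False using hyp(4)[OF assms(1,2) L(1)] by simp
qed

lemma nucleus_tans:
  assumes "E \<in> Pls" "nice E" "N \<in> nuc E"
  shows "card {L \<in> tans N. L \<subseteq> E} = a E"
proof -
  have N: "N \<in> Pts - K" "N \<in> E" using assms nuc(1) plane_pts by (auto simp: nuc_def)
  have "{L \<in> secs N. L \<subseteq> E} = {}" using nucleus_no_secant assms by blast
  then show ?thesis using tau_sigma_plane[OF N(1) assms(1) N(2)] by (metis add.right_neutral card.empty mult_0_right)
qed

text \<open>Because of the secant, \<open>N\<close> is not on the hyperoval of \<open>E\<close>. A
  tangent through \<open>N\<close> contains one point of \<open>K\<close> and so exactly one further
  point of the hyperoval, a nucleus. Distinct tangents meet only in \<open>N\<close> and thus use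
  distinct nuclei.\<close>

lemma nice_tans_le:
  assumes "E \<in> Pls" "nice E" "N \<in> Pts - K" "s \<in> secs N" "s \<subseteq> E"
  shows "card {L \<in> tans N. L \<subseteq> E} \<le> m E"
proof -
  have NE: "N \<in> E" using assms by (auto simp: secs_def lines_at_def)
  have Nh: "N \<notin> hyp E" using nucleus_no_secant[OF assms(1,2) _ assms(4)] assms by (auto simp: nuc_def)
  have ex: "\<exists>x. x \<in> L \<and> x \<in> nuc E" if L: "L \<in> {L \<in> tans N. L \<subseteq> E}" for L
  proof -
    have L': "L \<in> Lns" "card (L \<inter> K) = 1" using L by (auto simp: tans_def lines_at_def)
    then obtain P where P: "L \<inter> K = {P}" by (auto simp: card_1_singleton_iff)
    then have "P \<in> hyp E" using hyp(1)[OF assms(1,2)] L by blast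
    then have "card (L \<inter> hyp E) = 2"
      by (intro hyperoval_line[OF assms(1) hyp(2,3,4)[OF assms(1,2)]]) (use L L' P in auto)
    then have "\<not> L \<inter> hyp E \<subseteq> L \<inter> K" using card_mono[of "L \<inter> K" "L \<inter> hyp E"] L'(2) by fastforce
    then show ?thesis by (auto simp: nuc_def)
  qed
  define f where "f = (\<lambda>L. SOME x. x \<in> L \<and> x \<in> nuc E)"
  have f: "f L \<in> L" "f L \<in> nuc E" if "L \<in> {L \<in> tans N. L \<subseteq> E}" for L
    using someI_ex[OF ex[OF that]] by (auto simp: f_def)
  have "inj_on f {L \<in> tans N. L \<subseteq> E}"
  proof (rule inj_onI)
    fix L L' assume L: "L \<in> {L \<in> tans N. L \<subseteq> E}" "L' \<in> {L \<in> tans N. L \<subseteq> E}" "f L = f L'"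
    moreover have "f L \<noteq> N" using f(2)[OF L(1)] Nh by (auto simp: nuc_def)
    ultimately show "L = L'" using line_unique[of L L' N "f L"] f[OF L(1)] f[OF L(2)]
      by (auto simp: tans_def lines_at_def)
  qed
  then have "card {L \<in> tans N. L \<subseteq> E} \<le> card (nuc E)"
    by (rule card_inj_on_le) (use f nuc(3)[OF assms(1,2)] in auto)
  then show ?thesis using nuc(2)[OF assms(1,2)] by simp
qed

lemma not_nice_ge: "\<not> nice E \<Longrightarrow> m E \<ge> 3"
proof (rule ccontr)
  assume "\<not> nice E" "\<not> m E \<ge> 3"
  then have "m E = 0 \<or> m E = 1 \<or> m E = 2" "m E * (m E - 1) \<ge> q" by (auto simp: nice_def)
  then show False using q_ge by auto
qed

lemma nice_m_less: "nice E \<Longrightarrow> real (m E) < sqrt (real q) + 1"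
proof (rule ccontr)
  assume n: "nice E" and c: "\<not> real (m E) < sqrt (real q) + 1"
  have "sqrt (real q) * sqrt (real q) \<le> real (m E) * (real (m E) - 1)"
    using c by (intro mult_mono) auto
  moreover have "sqrt (real q) \<ge> 0" by simp
  ultimately have "real q \<le> real (m E) * (real (m E) - 1)" by simp
  also have "\<dots> = real (m E * (m E - 1))"
  proof -
    have "real (m E) \<ge> 1" using c \<open>sqrt (real q) \<ge> 0\<close> by linarith
    then show ?thesis by (simp add: of_nat_diff)
  qed
  finally have "q \<le> m E * (m E - 1)" by (simp only: of_nat_le_iff)
  then show False using n by (simp add: nice_def)
qed

lemma card_common_line:
  assumes "E \<in> Pls" "E' \<in> Pls" "E \<noteq> E'"
  shows "card {L \<in> tans N. L \<subseteq> E \<and> L \<subseteq> E'} \<le> 1"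
proof -
  have l: "E \<inter> E' \<in> Lns" by (rule plane_inter[OF assms])
  have "L = E \<inter> E'" if "L \<in> Lns" "L \<subseteq> E" "L \<subseteq> E'" for L
    using card_line[OF l] card_line[OF that(1)] that l by (intro card_subset_eq) auto
  then have "{L \<in> tans N. L \<subseteq> E \<and> L \<subseteq> E'} \<subseteq> {E \<inter> E'}" by (auto simp: tans_def lines_at_def)
  then show ?thesis using card_mono[of "{E \<inter> E'}"] by fastforce
qed

text \<open>The tangents through \<open>N\<close> in three planes with nucleus \<open>N\<close> would be too many, since a plane
  through a secant through \<open>N\<close> contains at most \<open>min 3 m\<close> of them.\<close>

lemma nuclear_planes_le_2:
  assumes N: "N \<in> Pts - K" and s: "s \<in> secs N" and t_le: "real t \<le> 3 * real q - 3 * sqrt (real q)"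
  shows "card {E \<in> Pls. nice E \<and> N \<in> nuc E} \<le> 2"
proof (rule ccontr)
  assume "\<not> ?thesis"
  then obtain S where S: "S \<subseteq> {E \<in> Pls. nice E \<and> N \<in> nuc E}" "card S = 3"
    using obtain_subset_with_card_n[of 3 "{E \<in> Pls. nice E \<and> N \<in> nuc E}"] by force
  then obtain E1 E2 E3 where E: "S = {E1, E2, E3}" "E1 \<noteq> E2" "E1 \<noteq> E3" "E2 \<noteq> E3"
    by (auto simp: card_3_iff)
  have Ei: "E \<in> Pls" "nice E" "N \<in> nuc E" if "E \<in> S" for E using S that by auto
  define T where "T = (\<lambda>E. {L \<in> tans N. L \<subseteq> E})"
  have fT: "finite (T E)" for E by (simp add: T_def)
  have Tc: "card (T E) = a E" if "E \<in> S" for E using nucleus_tans[OF Ei[OF that]] by (simp add: T_def)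
  have TT: "card (T E \<inter> T E') \<le> 1" if "E \<in> Pls" "E' \<in> Pls" "E \<noteq> E'" for E E'
  proof -
    have "T E \<inter> T E' = {L \<in> tans N. L \<subseteq> E \<and> L \<subseteq> E'}" by (auto simp: T_def)
    then show ?thesis using card_common_line[OF that] by simp
  qed
  define T' where "T' = T E1 \<union> T E2 \<union> T E3"
  have "card (T E1) + card (T E2) = card (T E1 \<union> T E2) + card (T E1 \<inter> T E2)"
    by (rule card_Un_Int) (auto simp: fT)
  moreover have "card (T E1 \<union> T E2) + card (T E3) = card T' + card ((T E1 \<union> T E2) \<inter> T E3)"
    unfolding T'_def by (rule card_Un_Int) (auto simp: fT)
  moreover have "card ((T E1 \<union> T E2) \<inter> T E3) \<le> card (T E1 \<inter> T E3) + card (T E2 \<inter> T E3)"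
    unfolding Int_Un_distrib2 by (rule card_Un_le)
  ultimately have "card (T E1) + card (T E2) + card (T E3) \<le> card T' + 3"
    using TT[of E1 E2] TT[of E1 E3] TT[of E2 E3] Ei(1) E by simp
  then have lower: "a E1 + a E2 + a E3 \<le> card T' + 3" using Tc E by simp
  have s': "s \<in> Lns" "N \<in> s" using s by (auto simp: secs_def lines_at_def)
  have T's: "T' \<subseteq> tans N" by (auto simp: T'_def T_def)
  have "s \<notin> T'" using T's s tans_not_secs by blast
  then have T's': "T' - {s} = T'" by blast
  have "T' \<subseteq> lines_at N" using T's tans_sub by blast
  then have "card T' = (\<Sum>E\<in>planes_on s. card {x\<in>T'. x \<subseteq> E})"
    using sum_planes_on_lines[OF s', of T'] by (simp only: T's')
  also have "\<dots> \<le> (\<Sum>E\<in>planes_on s. m E)"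
  proof (rule sum_mono)
    fix E assume "E \<in> planes_on s"
    then have E': "E \<in> Pls" "s \<subseteq> E" by (auto simp: planes_on_def)
    show "card {x\<in>T'. x \<subseteq> E} \<le> m E"
    proof (cases "nice E")
      case True
      have "card {x\<in>T'. x \<subseteq> E} \<le> card {L \<in> tans N. L \<subseteq> E}"
        by (rule card_mono) (use T's in auto)
      then show ?thesis using nice_tans_le[OF E'(1) True N s E'(2)] by simp
    next
      case False
      have ne: "E \<noteq> F" if "F \<in> S" for F using nucleus_no_secant[OF Ei[OF that] s] E' by blast
      have "{x\<in>T'. x \<subseteq> E} = (T E \<inter> T E1 \<union> T E \<inter> T E2) \<union> T E \<inter> T E3" by (auto simp: T'_def T_def)
      then have "card {x\<in>T'. x \<subseteq> E} \<le> card (T E \<inter> T E1) + card (T E \<inter> T E2) + card (T E \<inter> T E3)"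
        using card_Un_le[of "T E \<inter> T E1 \<union> T E \<inter> T E2" "T E \<inter> T E3"] card_Un_le[of "T E \<inter> T E1" "T E \<inter> T E2"]
        by simp
      also have "\<dots> \<le> 1 + 1 + 1"
        by (intro add_mono TT) (use E' Ei(1) ne E in auto)
      also have "\<dots> \<le> m E" using not_nice_ge[OF False] by simp
      finally show ?thesis .
    qed
  qed
  also have "\<dots> = t"
  proof -
    have "s \<inter> K \<noteq> {}" using s by (auto simp: secs_def)
    then obtain P where "P \<in> s \<inter> K" by blast
    then show ?thesis using sum_m_secant[of P s] s by (auto simp: secs_def lines_at_def)
  qed
  finally have "a E1 + a E2 + a E3 \<le> t + 3" using lower by simp
  then have "real (a E1) + real (a E2) + real (a E3) \<le> real t + 3"
    by (metis of_nat_add of_nat_le_iff of_nat_numeral)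
  \<comment> \<open>The three lower bounds add up to more than \<open>3 q + 3 - 3 sqrt q\<close>,
    which is at least \<open>t + 3\<close>. This is the place that dictates the summand
    \<open>3 * sqrt q\<close> in the hypothesis on \<open>k\<close>.\<close>
  moreover have "real (a F) > real q + 1 - sqrt (real q)" if "F \<in> S" for F
    using real_a[OF Ei(1)[OF that]] nice_m_less[OF Ei(2)[OF that]] by simp
  then have "real (a E1) > real q + 1 - sqrt (real q)" "real (a E2) > real q + 1 - sqrt (real q)"
    "real (a E3) > real q + 1 - sqrt (real q)" using E by auto
  ultimately show False using t_le by simp
qed

end

section \<open>Large complete caps\<close>

locale pg3_large_cap = pg3_even_cap +
  assumes complete: "N \<in> Pts - K \<Longrightarrow> secs N \<noteq> {}"
    and k_ge: "real k \<ge> (real q)^2 - 2 * real q + 3 * sqrt (real q) + 2"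
begin

abbreviation r :: real where "r \<equiv> sqrt (real q)"

lemma r_sq: "r * r = real q" by simp

text \<open>\<open>45.2^2 = 2043.04\<close> is just below 2048.\<close>

lemma r_ge: "r \<ge> 45.2"
  by (rule real_le_rsqrt) (use q_ge in \<open>simp add: power2_eq_square\<close>)

lemma r_le: "r \<le> real q / 45.2"
proof -
  have "45.2 * r \<le> r * r" using r_ge by (intro mult_right_mono) auto
  then show ?thesis by simp
qed

lemma real_k: "real k = (real q)^2 + real q + 2 - real t"
  using k_t by (simp add: eq_diff_eq flip: of_nat_add of_nat_power)

lemma t_le: "real t \<le> 3 * real q - 3 * r"
  using k_ge real_k by simp

lemma q_ge': "real q \<ge> 2048" using q_ge by simp

section \<open>A first bound for \<open>t\<close> by counting nuclei\<close>

lemma sum_nice_m: "(\<Sum>E | E \<in> Pls \<and> nice E. m E) \<le> 2 * card (Pts - K)"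
proof -
  have "(\<Sum>E | E \<in> Pls \<and> nice E. m E) = (\<Sum>E | E \<in> Pls \<and> nice E. \<Sum>N | N \<in> Pts - K \<and> N \<in> nuc E. (1::nat))"
  proof (rule sum.cong[OF refl])
    fix E assume "E \<in> {E. E \<in> Pls \<and> nice E}"
    then have E: "E \<in> Pls" "nice E" by auto
    have "{N. N \<in> Pts - K \<and> N \<in> nuc E} = nuc E"
      using nuc(1)[OF E] plane_pts[OF E(1)] by (auto simp: nuc_def)
    then show "m E = (\<Sum>N | N \<in> Pts - K \<and> N \<in> nuc E. (1::nat))" using nuc(2)[OF E] by simp
  qed
  also have "\<dots> = (\<Sum>N\<in>Pts - K. \<Sum>E | E \<in> {E \<in> Pls. nice E} \<and> N \<in> nuc E. (1::nat))"
    by (subst sum.swap_restrict) simp_all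
  also have "\<dots> \<le> (\<Sum>N\<in>Pts - K. 2)"
  proof (rule sum_mono)
    fix N assume N: "N \<in> Pts - K"
    then obtain s where "s \<in> secs N" using complete by blast
    then have "card {E \<in> Pls. nice E \<and> N \<in> nuc E} \<le> 2" by (rule nuclear_planes_le_2[OF N _ t_le])
    moreover have "{E. E \<in> {E \<in> Pls. nice E} \<and> N \<in> nuc E} = {E \<in> Pls. nice E \<and> N \<in> nuc E}" by auto
    ultimately show "(\<Sum>E | E \<in> {E \<in> Pls. nice E} \<and> N \<in> nuc E. (1::nat)) \<le> 2" by simp
  qed
  finally show ?thesis by simp
qed

text \<open>\<open>m (m - 1) >= q\<close> says \<open>(m - 1/2)^2 >= q + 1/4\<close>.\<close>

lemma not_nice_m: "\<not> nice E \<Longrightarrow> real (m E) \<ge> r + 1/2"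
proof -
  assume n: "\<not> nice E"
  then have "q \<le> m E * (m E - 1)" by (simp add: nice_def)
  then have "real q \<le> real (m E) * real (m E - 1)" by (simp flip: of_nat_mult)
  also have "real (m E - 1) = real (m E) - 1" using not_nice_ge[OF n] by (simp add: of_nat_diff)
  finally have "real q \<le> (real (m E) - 1/2)^2" by (simp add: power2_eq_square algebra_simps)
  then have "r \<le> real (m E) - 1/2"
    using not_nice_ge[OF n] by (intro real_le_lsqrt) auto
  then show ?thesis by simp
qed

text \<open>Along a tangent the numbers \<open>m - 1\<close> are nonnegative with sum
  \<open>t - 1\<close>, and each plane that is not nice contributes at least
  \<open>r - 1/2\<close>.\<close>

lemma card_not_nice:
  assumes "P \<in> K" "l \<in> tans P"
  shows "real (card {E \<in> planes_on l. \<not> nice E}) * (r - 1/2) \<le> real t - 1"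
proof -
  have l: "l \<in> Lns" using assms by (auto simp: tans_def lines_at_def)
  have "real (card {E \<in> planes_on l. \<not> nice E}) * (r - 1/2) = (\<Sum>E | E \<in> planes_on l \<and> \<not> nice E. r - 1/2)"
    by simp
  also have "\<dots> \<le> (\<Sum>E | E \<in> planes_on l \<and> \<not> nice E. real (m E) - 1)"
    by (rule sum_mono) (use not_nice_m in force)
  also have "\<dots> \<le> (\<Sum>E\<in>planes_on l. real (m E) - 1)"
    by (rule sum_mono2) (use m_pos[OF assms] in auto)
  also have "\<dots> = real (\<Sum>E\<in>planes_on l. m E) - (real q + 1)"
    using card_planes_on[OF l] by (simp add: sum_subtractf)
  also have "\<dots> = real t - 1" unfolding sum_m_tangent[OF assms] by simp
  finally show ?thesis .
qed

lemma card_not_nice_le: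
  assumes "P \<in> K" "l \<in> tans P"
  shows "real (card {E \<in> planes_on l. \<not> nice E}) \<le> 3 * r"
proof -
  have e: "3 * x * (x - 1/2) = 3 * (x * x) - 3 * x / 2" for x :: real by (simp add: field_simps)
  have "real t - 1 \<le> 3 * r * (r - 1/2)" unfolding e r_sq using t_le r_ge by simp
  then have "real (card {E \<in> planes_on l. \<not> nice E}) * (r - 1/2) \<le> 3 * r * (r - 1/2)"
    using card_not_nice[OF assms] by linarith
  then show ?thesis using r_ge by (simp add: mult_le_cancel_right)
qed

lemma sum_nice_at:
  assumes "P \<in> K"
  shows "(\<Sum>E | E \<in> planes_at P \<and> nice E. real (m E)) \<ge> real t * (real q + 1 - 3 * r)"
proof -
  have "(\<Sum>E | E \<in> planes_at P \<and> nice E. real (m E)) = (\<Sum>E\<in>planes_at P. real (m E) * (if nice E then 1 else 0))"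
    by (simp add: sum.inter_filter[symmetric] if_distrib cong: if_cong)
  also have "\<dots> = (\<Sum>l\<in>tans P. \<Sum>E\<in>planes_on l. (if nice E then 1 else 0))"
    by (rule sum_planes_at_tangents[OF assms])
  also have "\<dots> \<ge> (\<Sum>l\<in>tans P. real q + 1 - 3 * r)"
  proof (rule sum_mono)
    fix l assume l: "l \<in> tans P"
    have l': "l \<in> Lns" using l by (auto simp: tans_def lines_at_def)
    have "(\<Sum>E\<in>planes_on l. (if nice E then 1 else 0)) = (\<Sum>E\<in>planes_on l. 1 - (if \<not> nice E then 1 else (0::real)))"
      by (rule sum.cong) auto
    also have "\<dots> = real (card (planes_on l)) - (\<Sum>E\<in>planes_on l. if \<not> nice E then 1 else (0::real))"
      by (simp only: sum_subtractf) simp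
    also have "\<dots> = real q + 1 - real (card {E \<in> planes_on l. \<not> nice E})"
      using card_planes_on[OF l'] by (subst sum.inter_filter[symmetric]) auto
    finally show "real q + 1 - 3 * r \<le> (\<Sum>E\<in>planes_on l. (if nice E then 1 else 0))"
      using card_not_nice_le[OF assms l] by simp
  qed
  finally show ?thesis by (simp add: card_tans[OF assms])
qed

lemma sum_K_planes:
  fixes f :: "'a set \<Rightarrow> real"
  shows "(\<Sum>P\<in>K. \<Sum>E | E \<in> planes_at P \<and> S E. f E) = (\<Sum>E | E \<in> Pls \<and> S E. real (a E) * f E)"
proof -
  have "(\<Sum>P\<in>K. \<Sum>E | E \<in> planes_at P \<and> S E. f E) = (\<Sum>P\<in>K. \<Sum>E | E \<in> {E\<in>Pls. S E} \<and> P \<in> E. f E)"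
    by (rule sum.cong[OF refl], rule sum.cong) (auto simp: planes_at_def)
  also have "\<dots> = (\<Sum>E\<in>{E\<in>Pls. S E}. \<Sum>P | P \<in> K \<and> P \<in> E. f E)"
    by (rule sum.swap_restrict) auto
  also have "\<dots> = (\<Sum>E | E \<in> Pls \<and> S E. real (a E) * f E)"
    by (rule sum.cong) (auto simp: a_def Int_def conj_commute)
  finally show ?thesis .
qed

text \<open>Summing \<open>sum_nice_at\<close> over \<open>K\<close> weights each nice plane by
  \<open>a m\<close>, and \<open>a m <= (q + 1) m\<close> reduces this to the number of nuclei,
  where each point outside \<open>K\<close> counts at most twice.\<close>

lemma nuclear_count: "real k * (real t * (real q + 1 - 3 * r)) \<le> 2 * (real q + 1) * (real q ^ 3 + real q ^ 2 + real q + 1 - real k)"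
proof -
  have "real k * (real t * (real q + 1 - 3 * r)) = (\<Sum>P\<in>K. real t * (real q + 1 - 3 * r))" by (simp add: k_def)
  also have "\<dots> \<le> (\<Sum>P\<in>K. \<Sum>E | E \<in> planes_at P \<and> nice E. real (m E))"
    by (intro sum_mono sum_nice_at)
  also have "\<dots> = (\<Sum>E | E \<in> Pls \<and> nice E. real (a E) * real (m E))" by (rule sum_K_planes)
  also have "\<dots> \<le> (\<Sum>E | E \<in> Pls \<and> nice E. (real q + 1) * real (m E))"
  proof (rule sum_mono)
    fix E assume "E \<in> {E. E \<in> Pls \<and> nice E}"
    then show "real (a E) * real (m E) \<le> (real q + 1) * real (m E)"
      using real_a[of E] by (cases "m E = 0") (auto intro!: mult_right_mono)
  qed
  also have "\<dots> = (real q + 1) * real (\<Sum>E | E \<in> Pls \<and> nice E. m E)" by (simp add: sum_distrib_left)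
  also have "\<dots> \<le> (real q + 1) * real (2 * card (Pts - K))"
    by (intro mult_left_mono) (use sum_nice_m of_nat_le_iff in \<open>blast, simp\<close>)
  also have "real (2 * card (Pts - K)) = 2 * (real q ^ 3 + real q ^ 2 + real q + 1 - real k)"
  proof -
    have "card (Pts - K) + k = q^3 + q^2 + q + 1"
      using card_Pts K_pts card_mono[OF finite_Pts K_pts] by (simp add: card_Diff_subset k_def)
    then have "real (card (Pts - K)) + real k = real q ^ 3 + real q ^ 2 + real q + 1"
      by (simp flip: of_nat_add of_nat_power of_nat_Suc)
    then show ?thesis by simp
  qed
  finally show ?thesis by (simp add: algebra_simps)
qed

lemma t_le_2: "real t \<le> 2.15 * real q"
proof (rule ccontr)
  assume "\<not> ?thesis"
  then have t: "real t \<ge> 2.15 * real q" by simp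
  define x where "x = real q"
  have x: "x \<ge> 2048" using q_ge by (simp add: x_def)
  have k: "real k \<ge> x^2 - 2 * x" using k_ge r_ge by (simp add: x_def)
  have x2: "x^2 \<ge> 2048 * x" using x by (simp add: power2_eq_square)
  have x3: "x^3 \<ge> 2048 * x^2" using x by (simp add: power3_eq_cube power2_eq_square)
  have x4: "x^4 \<ge> 2048 * x^3" using x by (simp add: power4_eq_xxxx power3_eq_cube)
  \<comment> \<open>0.9336 bounds \<open>1 - 3 / 45.2\<close> from below, and
    \<open>2.15 * 0.9336 = 2.00724\<close> just exceeds the factor 2 of
    \<open>nuclear_count\<close>; this decides the comparison of the terms in
    \<open>x^4\<close>.\<close>
  have s: "x + 1 - 3 * r \<ge> 0.9336 * x"
    using r_le x by (simp add: x_def)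
  have "(x^2 - 2 * x) * (2.15 * x * (0.9336 * x)) \<le> real k * (real t * (x + 1 - 3 * r))"
    using k t s x x2 by (intro mult_mono) (auto simp: x_def)
  also have "\<dots> \<le> 2 * (x + 1) * (x ^ 3 + x ^ 2 + x + 1 - real k)"
    using nuclear_count by (simp add: x_def)
  also have "\<dots> \<le> 2 * (x + 1) * (x ^ 3 + x ^ 2 + x + 1 - (x^2 - 2 * x))"
    using k x by (intro mult_left_mono) auto
  finally have "(x^2 - 2 * x) * (2.15 * x * (0.9336 * x)) \<le> 2 * (x + 1) * (x ^ 3 + 3 * x + 1)" by (simp add: algebra_simps)
  then have "2.00724 * x^4 - 4.01448 * x^3 \<le> 2 * x^4 + 2 * x^3 + 6 * x^2 + 8 * x + 2"
    by (simp add: algebra_simps power2_eq_square power3_eq_cube power4_eq_xxxx)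
  then show False using x x2 x3 x4 by simp
qed

section \<open>The number of tangents through a point outside the cap\<close>

abbreviation tau :: "'a \<Rightarrow> 'a set \<Rightarrow> nat" where "tau N E \<equiv> card {L \<in> tans N. L \<subseteq> E}"

abbreviation sig :: "'a \<Rightarrow> 'a set \<Rightarrow> nat" where "sig N E \<equiv> card {L \<in> secs N. L \<subseteq> E}"

lemma secant_point: "s \<in> secs N \<Longrightarrow> \<exists>P\<in>K. s \<in> secs P"
proof -
  assume s: "s \<in> secs N"
  then have "s \<inter> K \<noteq> {}" by (auto simp: secs_def)
  then obtain P where "P \<in> s" "P \<in> K" by blast
  then show ?thesis using s by (auto simp: secs_def lines_at_def)
qed

lemma sum_m_secs: "s \<in> secs N \<Longrightarrow> (\<Sum>E\<in>planes_on s. m E) = t"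
  using secant_point sum_m_secant by blast

lemma sum_tau_secant:
  assumes "s \<in> secs N"
  shows "(\<Sum>E\<in>planes_on s. tau N E) = card (tans N)"
  using assms tans_not_secs by (intro sum_tau_planes) (auto simp: secs_def lines_at_def)

text \<open>Along a secant through \<open>N\<close> the values \<open>m\<close> sum to
  \<open>t\<close>, and each plane on it has \<open>tau <= m\<close>: nice planes by
  \<open>nice_tans_le\<close>, the others because \<open>tau <= a\<close>. This becomes applicable
  once the planes meeting \<open>K\<close> are under control.\<close>

lemma tau_le_of_planes:
  assumes N: "N \<in> Pts - K" and le: "\<And>E. E \<in> Pls \<Longrightarrow> E \<inter> K \<noteq> {} \<Longrightarrow> nice E \<or> a E \<le> m E"
  shows "card (tans N) \<le> t"
proof -
  obtain s where s: "s \<in> secs N" using complete[OF N] by blast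
  have "card (tans N) = (\<Sum>E\<in>planes_on s. tau N E)" using sum_tau_secant[OF s] by simp
  also have "\<dots> \<le> (\<Sum>E\<in>planes_on s. m E)"
  proof (rule sum_mono)
    fix E assume "E \<in> planes_on s"
    then have E: "E \<in> Pls" "s \<subseteq> E" by (auto simp: planes_on_def)
    then have NE: "N \<in> E" using s by (auto simp: secs_def lines_at_def)
    obtain P where "P \<in> K" "s \<in> secs P" using secant_point[OF s] by blast
    then have "E \<inter> K \<noteq> {}" using E by (auto simp: secs_def lines_at_def)
    then consider "nice E" | "a E \<le> m E" using le E by blast
    then show "tau N E \<le> m E"
    proof cases
      case 1 then show ?thesis using nice_tans_le[OF E(1) _ N s E(2)] by simp
    next
      case 2 then show ?thesis using tau_sigma_plane[OF N E(1) NE] by simp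
    qed
  qed
  also have "\<dots> = t" by (rule sum_m_secs[OF s])
  finally show ?thesis .
qed

lemma sig_pos: "s \<in> secs N \<Longrightarrow> s \<subseteq> E \<Longrightarrow> sig N E \<ge> 1"
  by (metis (mono_tags, lifting) One_nat_def Suc_leI card_gt_0_iff empty_iff finite_Collect_conjI finite_tans(2) mem_Collect_eq
      finite_subset subsetI)

lemma real_tau_sigma_plane:
  assumes "N \<in> Pts - K" "E \<in> Pls" "N \<in> E"
  shows "real (tau N E) + 2 * real (sig N E) = real (a E)"
proof -
  have "real (tau N E + 2 * sig N E) = real (a E)" by (simp only: tau_sigma_plane[OF assms])
  then show ?thesis by (simp only: of_nat_add of_nat_mult of_nat_numeral)
qed

text \<open>In a plane that is not nice, the secant uses up two of the \<open>a\<close> points, so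
  \<open>tau <= a - 2 = q - m\<close>, and \<open>q <= r m\<close>.\<close>

lemma tau_plane_le:
  assumes N: "N \<in> Pts - K" and E: "E \<in> Pls" and s: "s \<in> secs N" "s \<subseteq> E"
  shows "real (tau N E) \<le> (r - 1) * real (m E)"
proof (cases "nice E")
  case True
  have "1 * real (m E) \<le> (r - 1) * real (m E)" using r_ge by (intro mult_right_mono) auto
  then show ?thesis using nice_tans_le[OF E True N s] by simp
next
  case False
  have NE: "N \<in> E" using s by (auto simp: secs_def lines_at_def)
  have "real (tau N E) + 2 * real (sig N E) = real (a E)"
    by (rule real_tau_sigma_plane[OF N E NE])
  then have "real (tau N E) \<le> real q - real (m E)"
    using sig_pos[OF s] real_a[OF E] by simp
  also have "real q = r * r" by simp
  also have "r * r \<le> r * real (m E)" using not_nice_m[OF False] r_ge by (intro mult_left_mono) auto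
  finally show ?thesis by (simp add: algebra_simps)
qed

lemma tau_le_crude:
  assumes N: "N \<in> Pts - K"
  shows "real (card (tans N)) \<le> (r - 1) * real t"
proof -
  obtain s where s: "s \<in> secs N" using complete[OF N] by blast
  have "real (card (tans N)) = (\<Sum>E\<in>planes_on s. real (tau N E))"
    unfolding sum_tau_secant[OF s, symmetric] by simp
  also have "\<dots> \<le> (\<Sum>E\<in>planes_on s. (r - 1) * real (m E))"
    by (rule sum_mono) (rule tau_plane_le[OF N _ s], auto simp: planes_on_def)
  also have "\<dots> = (r - 1) * real (\<Sum>E\<in>planes_on s. m E)" by (simp add: sum_distrib_left)
  finally show ?thesis using sum_m_secs[OF s] by simp
qed

text \<open>Only a plane that is not nice and contains a secant through \<open>N\<close> can
  contribute positively on the left. There \<open>tau > m >= r + 1/2\<close> gives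
  \<open>2 sig <= r (m - 1)\<close>, and what remains is a completed square.\<close>

lemma excess_plane:
  assumes N: "N \<in> Pts - K" and E: "E \<in> Pls" "N \<in> E"
  shows "8 * real (sig N E) * (real (tau N E) - real (m E)) \<le> r * (real (tau N E) * (real (tau N E) - 1))"
proof -
  define x where "x = real (tau N E)"
  define z where "z = real (sig N E)"
  have z0: "z \<ge> 0" by (simp add: z_def)
  define y where "y = real (m E)"
  have x0: "x * (x - 1) \<ge> 0"
  proof -
    obtain n where "x = real n" by (simp add: x_def)
    then show ?thesis by (cases n) auto
  qed
  then have rx: "r * (x * (x - 1)) \<ge> 0" using r_ge by simp
  show ?thesis
  proof (cases "z = 0 \<or> x \<le> y")
    case True
    then have "8 * z * (x - y) \<le> 0" using z0 by (auto simp: mult_nonneg_nonpos)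
    then show ?thesis using rx unfolding x_def y_def z_def by linarith
  next
    case False
    then have "{L \<in> secs N. L \<subseteq> E} \<noteq> {}" by (metis card.empty of_nat_0 z_def)
    then obtain s where s: "s \<in> secs N" "s \<subseteq> E" by blast
    have nn: "\<not> nice E"
      using False nice_tans_le[OF E(1) _ N s] by (auto simp: x_def y_def)
    have y: "y \<ge> r + 1/2" using not_nice_m[OF nn] by (simp add: y_def)
    have "x + 2 * z = real (a E)"
      unfolding x_def z_def by (rule real_tau_sigma_plane[OF N E])
    then have sg: "2 * z = real q + 2 - y - x" using real_a[OF E(1)] by (simp add: y_def)
    have "r * y \<ge> r * (r + 1/2)" using y r_ge by (intro mult_left_mono) auto
    then have ry: "r * y \<ge> real q + r / 2" using r_sq by (simp add: algebra_simps)
    have "2 * z \<le> r * (y - 1)"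
      using sg False y ry r_ge by (simp add: algebra_simps)
    then have "2 * z * (4 * (x - y)) \<le> r * (y - 1) * (4 * (x - y))"
      using False by (intro mult_right_mono) auto
    also have "\<dots> = r * (4 * (y - 1) * (x - y))" by (simp only: mult_ac)
    also have "\<dots> \<le> r * (x * (x - 1))"
    proof (rule mult_left_mono)
      have "x * (x - 1) - 4 * (y - 1) * (x - y) = (x - (2 * y - 3/2))^2 + (2 * y - 9/4)"
        by (simp add: power2_eq_square algebra_simps)
      moreover have "2 * y - 9/4 \<ge> 0" using y r_ge by simp
      ultimately show "4 * (y - 1) * (x - y) \<le> x * (x - 1)"
        by (smt (verit) zero_le_power2)
    qed (use r_ge in simp)
    finally have "8 * z * (x - y) \<le> r * (x * (x - 1))" by (simp add: algebra_simps)
    then show ?thesis unfolding x_def y_def z_def .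
  qed
qed

text \<open>Averaging over all secants through \<open>N\<close> keeps the excess coming from planes that are not nice
  under control.\<close>

lemma excess:
  assumes N: "N \<in> Pts - K"
  shows "4 * (real k - real (card (tans N))) * (real (card (tans N)) - real t)
    \<le> r * (real (card (tans N)) * (real (card (tans N)) - 1))"
proof -
  define T where "T = real (card (tans N))"
  have "real (card (tans N)) + 2 * real (card (secs N)) = real k"
    using tau_sigma[OF N] by (metis of_nat_add of_nat_mult of_nat_numeral)
  then have "4 * (real k - T) * (T - real t) = 8 * (real (card (secs N)) * (T - real t))"
    by (simp add: T_def)
  also have "real (card (secs N)) * (T - real t) = (\<Sum>s\<in>secs N. T - real t)" by simp
  also have "\<dots> = (\<Sum>s\<in>secs N. \<Sum>E\<in>planes_on s. real (tau N E) - real (m E))"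
  proof (rule sum.cong[OF refl])
    fix s assume s: "s \<in> secs N"
    have "(\<Sum>E\<in>planes_on s. real (tau N E)) = T" unfolding T_def sum_tau_secant[OF s, symmetric] by simp
    moreover have "(\<Sum>E\<in>planes_on s. real (m E)) = real t" unfolding sum_m_secs[OF s, symmetric] by simp
    ultimately show "T - real t = (\<Sum>E\<in>planes_on s. real (tau N E) - real (m E))" by (simp add: sum_subtractf)
  qed
  also have "\<dots> = (\<Sum>E\<in>planes_at N. \<Sum>s | s \<in> secs N \<and> s \<subseteq> E. real (tau N E) - real (m E))"
    by (rule sum_planes_at_lines[OF secs_sub, symmetric])
  also have "8 * \<dots> = (\<Sum>E\<in>planes_at N. 8 * real (sig N E) * (real (tau N E) - real (m E)))"
    by (simp add: sum_distrib_left mult.assoc)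
  also have "\<dots> \<le> (\<Sum>E\<in>planes_at N. r * (real (tau N E) * (real (tau N E) - 1)))"
    by (rule sum_mono) (rule excess_plane[OF N], auto simp: planes_at_def)
  \<comment> \<open>\<open>tau (tau - 1)\<close> counts ordered pairs of distinct tangents through
    \<open>N\<close> in \<open>E\<close>. Each pair spans one plane, so the sum over all planes is
    \<open>T (T - 1)\<close>.\<close>
  also have "\<dots> = r * (\<Sum>E\<in>planes_at N. \<Sum>l | l \<in> tans N \<and> l \<subseteq> E. real (tau N E) - 1)"
    by (simp add: sum_distrib_left)
  also have "(\<Sum>E\<in>planes_at N. \<Sum>l | l \<in> tans N \<and> l \<subseteq> E. real (tau N E) - 1)
      = (\<Sum>l\<in>tans N. \<Sum>E\<in>planes_on l. real (tau N E) - 1)"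
    by (rule sum_planes_at_lines[OF tans_sub])
  also have "\<dots> = (\<Sum>l\<in>tans N. T - 1)"
  proof (rule sum.cong[OF refl])
    fix l assume l: "l \<in> tans N"
    then have l': "l \<in> Lns" "N \<in> l" by (auto simp: tans_def lines_at_def)
    have c: "real (tau N E) - 1 = real (card {x \<in> tans N - {l}. x \<subseteq> E})" if "E \<in> planes_on l" for E
    proof -
      have "l \<in> {L \<in> tans N. L \<subseteq> E}" using l that by (auto simp: planes_on_def)
      moreover have "{x \<in> tans N - {l}. x \<subseteq> E} = {L \<in> tans N. L \<subseteq> E} - {l}" by auto
      ultimately have "tau N E = Suc (card {x \<in> tans N - {l}. x \<subseteq> E})"
        using card.remove[of "{L \<in> tans N. L \<subseteq> E}" l] by simp
      then show ?thesis by simp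
    qed
    have "(\<Sum>E\<in>planes_on l. real (tau N E) - 1) = real (\<Sum>E\<in>planes_on l. card {x \<in> tans N - {l}. x \<subseteq> E})"
      unfolding of_nat_sum by (rule sum.cong[OF refl c])
    also have "\<dots> = T - 1"
      unfolding sum_planes_on_lines[OF l' tans_sub] T_def
      using card.remove[OF finite_tans(1) l] by simp
    finally show "(\<Sum>E\<in>planes_on l. real (tau N E) - 1) = T - 1" .
  qed
  also have "\<dots> = T * (T - 1)" by (simp add: T_def)
  finally show ?thesis by (simp add: T_def)
qed

text \<open>Solving \<open>excess\<close> for \<open>T - t\<close> with \<open>k\<close> near
  \<open>q^2\<close>, \<open>T\<close> near \<open>t\<close> and \<open>r <= q / 45.2\<close>
  suggests an error of \<open>t^2 / (4 * 45.2 * q)\<close>, that is \<open>t^2 / (180.8 q)\<close>.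
  The smaller constant 155 absorbs the differences between \<open>T\<close> and \<open>t\<close> and
  between \<open>k - T\<close> and \<open>q^2\<close>.\<close>

definition tau_bound :: real where "tau_bound = real t + real t ^ 2 / (155 * real q)"

text \<open>\<open>excess\<close> is a quadratic inequality in \<open>T\<close> that holds again for
  very large \<open>T\<close>; that branch, here \<open>T >= 8 t\<close>, is excluded by
  \<open>tau_le_crude\<close>.\<close>

lemma tau_le_tau_bound:
  assumes N: "N \<in> Pts - K"
  shows "real (card (tans N)) \<le> tau_bound"
proof (rule ccontr)
  assume neg: "\<not> ?thesis"
  define T where "T = real (card (tans N))"
  define e where "e = T - real t"
  have q: "real q \<ge> 2048" using q_ge by simp
  have TB: "T > tau_bound" using neg by (simp add: T_def)
  have t0: "real t \<ge> 0" by simp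
  have "t \<noteq> 0"
  proof
    assume "t = 0"
    then have "tau_bound = 0" "(r - 1) * real t = 0" by (simp_all add: tau_bound_def)
    then show False using tau_le_crude[OF N] neg by linarith
  qed
  then have tpos: "real t > 0" by simp
  have e1: "real t ^ 2 < 155 * real q * e"
    using TB q by (simp add: tau_bound_def e_def field_simps)
  have epos: "e > 0" using e1 q t0 by (smt (verit) zero_le_power2 zero_less_mult_iff)
  have ex: "4 * (real k - T) * e \<le> r * T ^ 2"
  proof -
    have "4 * (real k - T) * e \<le> r * (T * (T - 1))" using excess[OF N] by (simp add: T_def e_def)
    also have "\<dots> \<le> r * T ^ 2" using r_ge by (intro mult_left_mono) (auto simp: power2_eq_square T_def algebra_simps)
    finally show ?thesis .
  qed
  have k: "real k \<ge> real q ^ 2 - 2 * real q" using k_ge r_ge by simp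
  have q2: "real q ^ 2 \<ge> 2048 * real q" using q by (simp add: power2_eq_square)
  have t2: "real t \<le> 2.15 * real q" by (rule t_le_2)
  show False
  proof (cases "T \<ge> 8 * real t")
    case True
    then have e: "e \<ge> 7 / 8 * T" by (simp add: e_def)
    have T0: "T > 0" using True tpos by simp
    have "T \<le> (r - 1) * real t" using tau_le_crude[OF N] by (simp add: T_def)
    also have "\<dots> \<le> (r - 1) * (3 * real q - 3 * r)" using t_le r_ge by (intro mult_left_mono) auto
    finally have T: "T \<le> (r - 1) * (3 * (r * r) - 3 * r)" by simp
    have kr: "real k \<ge> (r * r)^2 - 2 * (r * r)" using k by simp
    have "(3.5 + r) * T \<le> (3.5 + r) * ((r - 1) * (3 * (r * r) - 3 * r))"
      using T r_ge by (intro mult_left_mono) auto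
    \<comment> \<open>A comparison of leading terms: \<open>3 r^4\<close> on the left,
      \<open>3.5 r^4\<close> on the right.\<close>
    also have "\<dots> < 3.5 * ((r * r)^2 - 2 * (r * r))"
    proof -
      have p: "(3.5 + x) * ((x - 1) * (3 * (x * x) - 3 * x)) < 3.5 * ((x * x)^2 - 2 * (x * x))" if "x \<ge> 45" for x :: real
      proof -
        have "x^2 \<ge> 45 * x" "x^3 \<ge> 45 * x^2" "x^4 \<ge> 45 * x^3"
          using that by (simp_all add: power2_eq_square power3_eq_cube power4_eq_xxxx)
        then have "4.5 * x^3 - 11 * x^2 + 10.5 * x < 0.5 * x^4" using that by simp
        then show ?thesis by (simp add: algebra_simps power2_eq_square power3_eq_cube power4_eq_xxxx)
      qed
      show ?thesis by (rule p) (use r_ge in simp)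
    qed
    also have "\<dots> \<le> 3.5 * real k" using kr by simp
    finally have *: "r * T < 3.5 * (real k - T)" by (simp add: algebra_simps)
    have "0 \<le> r * T" using r_ge T0 by simp
    then have "0 < 3.5 * (real k - T)" using * by (rule order.strict_trans1)
    then have "real k - T \<ge> 0" by simp
    then have "4 * (real k - T) * (7 / 8 * T) \<le> 4 * (real k - T) * e" using e by (intro mult_left_mono) auto
    also have "\<dots> \<le> r * T ^ 2" by (rule ex)
    also have "\<dots> = (r * T) * T" by (simp add: power2_eq_square)
    also have "\<dots> < 3.5 * (real k - T) * T" using * T0 by (intro mult_strict_right_mono) auto
    finally show False by (simp add: algebra_simps)
  next
    case False
    then have e7: "e \<le> 7 * real t" by (simp add: e_def)
    have "T^2 = real t ^ 2 + (2 * real t + e) * e" by (simp add: e_def power2_eq_square algebra_simps)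
    \<comment> \<open>From \<open>e <= 7 t\<close> follows \<open>2 t + e <= 9 t\<close>. The total
      is \<open>155 + 9 * 2.15 = 174.35\<close>, and \<open>174.35 / 45.2 < 3.9\<close>, below the
      factor 4 of \<open>excess\<close>.\<close>
    also have "\<dots> \<le> 155 * real q * e + (9 * (2.15 * real q)) * e"
      by (intro add_mono mult_right_mono) (use e1 e7 t2 epos in auto)
    finally have T2: "T^2 \<le> 174.35 * real q * e" by (simp add: algebra_simps)
    have "r * T ^ 2 \<le> (real q / 45.2) * (174.35 * real q * e)"
      by (intro mult_mono T2 r_le) auto
    also have "\<dots> < 3.9 * real q ^ 2 * e" using epos q by (simp add: power2_eq_square)
    also have "\<dots> \<le> 4 * (real k - T) * e"
      by (intro mult_right_mono) (use k False t2 q2 q epos in auto)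
    finally show False using ex by simp
  qed
qed

section \<open>Distribution of \<open>m\<close> over the planes through a point\<close>

lemma q_tau_bound: "real q * (tau_bound - real t) = real t ^ 2 / 155"
  using q_ge by (simp add: tau_bound_def)

text \<open>In the second moment along \<open>l\<close> one factor \<open>m - 1\<close> is replaced
  by its maximum; the other factors sum to \<open>t - 1\<close>.\<close>

lemma longest_plane:
  assumes P: "P \<in> K" and l: "l \<in> tans P"
    and C: "\<And>N. N \<in> Pts - K \<Longrightarrow> real (card (tans N)) \<le> C"
  shows "\<exists>E\<in>planes_on l. real q ^ 2 + real q - (real t - 1) - real q * (C - real t) \<le> (real (m E) - 1) * (real t - 1)"
proof -
  have l': "l \<in> Lns" using l by (auto simp: tans_def lines_at_def)
  have ne: "planes_on l \<noteq> {}" using card_planes_on[OF l'] by auto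
  have "Max (m ` planes_on l) \<in> m ` planes_on l" using ne by (intro Max_in) auto
  then obtain E where "E \<in> planes_on l" "m E = Max (m ` planes_on l)" by auto
  then have E: "E \<in> planes_on l" "\<And>E'. E' \<in> planes_on l \<Longrightarrow> m E' \<le> m E" by auto
  have "real q ^ 2 + real q - (real t - 1) - real q * (C - real t) \<le> (\<Sum>E\<in>planes_on l. (real (m E) - 1)^2)"
    by (rule tangent_moment_bound(2)[OF P l C])
  also have "\<dots> \<le> (\<Sum>E'\<in>planes_on l. (real (m E) - 1) * (real (m E') - 1))"
    by (rule sum_mono) (use E(2) m_pos[OF P l] in \<open>auto simp: power2_eq_square intro!: mult_right_mono\<close>)
  also have "\<dots> = (real (m E) - 1) * (real (\<Sum>E'\<in>planes_on l. m E') - (real q + 1))"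
    using card_planes_on[OF l'] by (simp add: sum_distrib_left[symmetric] sum_subtractf)
  also have "\<dots> = (real (m E) - 1) * (real t - 1)"
    unfolding sum_m_tangent[OF P l] by simp
  finally show ?thesis using E(1) by blast
qed

lemma quadratic_moment:
  assumes P: "P \<in> K"
  shows "(\<Sum>E\<in>planes_at P. (real (a E) - 1) * (real (m E) ^ 2 - c * real (m E) + d))
    \<le> real t * (real q * (tau_bound - 1)) - c * ((real k - 1) * real t) + d * ((real k - 1) * (real q + 1))"
proof -
  have "(\<Sum>E\<in>planes_at P. f E - c * g E + d * h E) = sum f (planes_at P) - c * sum g (planes_at P) + d * sum h (planes_at P)"
    for f g h :: "'a set \<Rightarrow> real"
    by (simp add: sum.distrib sum_subtractf sum_distrib_left)
  from this[of "\<lambda>E. (real (a E) - 1) * real (m E) ^ 2" "\<lambda>E. (real (a E) - 1) * real (m E)" "\<lambda>E. real (a E) - 1"]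
  have "(\<Sum>E\<in>planes_at P. (real (a E) - 1) * (real (m E) ^ 2 - c * real (m E) + d)) =
      (\<Sum>E\<in>planes_at P. (real (a E) - 1) * real (m E) ^ 2) - c * ((real k - 1) * real t) + d * ((real k - 1) * (real q + 1))"
    unfolding secant_moments[OF P] by (simp add: algebra_simps)
  then show ?thesis using second_moment_bound[OF P tau_le_tau_bound] by linarith
qed

text \<open>The integer \<open>m\<close> satisfies \<open>(m - 1) (m - 2) \<ge> 0\<close>. As the second moment of \<open>m\<close> is almost the square
  of its mean \<open>t / (q + 1)\<close>, this mean is close to 1 or to 2.\<close>

lemma window:
  assumes "1.02 * real q \<le> real t"
  shows "real t > 1.94 * real q"
proof (rule ccontr)
  assume n: "\<not> real t > 1.94 * real q"
  obtain P where P: "P \<in> K" using K_nonempty by blast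
  define x where "x = real q"
  define y where "y = real t"
  have x: "x \<ge> 2048" using q_ge by (simp add: x_def)
  have y: "1.02 * x \<le> y" "y \<le> 1.94 * x" using n assms by (auto simp: x_def y_def)
  have "0 \<le> (\<Sum>E\<in>planes_at P. (real (a E) - 1) * ((real (m E) - 1) * (real (m E) - 2)))"
  proof (rule sum_nonneg)
    fix E assume E: "E \<in> planes_at P"
    have "real (m E) \<le> 1 \<or> real (m E) \<ge> 2" by (simp, linarith)
    then have "(real (m E) - 1) * (real (m E) - 2) \<ge> 0"
      by (auto intro: mult_nonneg_nonneg mult_nonpos_nonpos)
    then show "0 \<le> (real (a E) - 1) * ((real (m E) - 1) * (real (m E) - 2))"
      using a_pos[OF P, of E] E by (simp add: planes_at_def)
  qed
  also have "\<dots> = (\<Sum>E\<in>planes_at P. (real (a E) - 1) * (real (m E) ^ 2 - 3 * real (m E) + 2))"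
    by (rule sum.cong[OF refl]) (simp add: power2_eq_square algebra_simps)
  also have "\<dots> \<le> y * (x * (tau_bound - 1)) - 3 * ((real k - 1) * y) + 2 * ((real k - 1) * (x + 1))"
    unfolding x_def y_def by (rule quadratic_moment[OF P])
  also have "y * (x * (tau_bound - 1)) = y * (x * y + y^2 / 155 - x)"
    using x by (simp add: tau_bound_def x_def[symmetric] y_def[symmetric] field_simps)
  also have "real k - 1 = x^2 + x + 1 - y" using real_k by (simp add: x_def y_def)
  finally have main: "0 \<le> x * y^2 - 3 * x^2 * y + 2 * x^3 + y^3 / 155 + (4 * x^2 - 6 * x * y + 3 * y^2) + (4 * x + 2 - 5 * y)"
    by (simp add: algebra_simps power2_eq_square power3_eq_cube)
  have x2: "x^2 \<ge> 2048 * x" using x by (simp add: power2_eq_square)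
  have x3: "x^3 \<ge> 2048 * x^2" using x by (simp add: power3_eq_cube power2_eq_square)
  \<comment> \<open>For \<open>y = c x\<close> the leading part of \<open>main\<close> is
    \<open>((c - 1) (c - 2) + c^3 / 155) x^3\<close>, which is negative for \<open>c\<close> from
    1.02 to 1.94. Bounding \<open>y^2\<close> by its chord over this interval makes the inequality
    linear in the monomials.\<close>
  have y2: "y^2 \<le> 2.96 * x * y - 1.9788 * x^2"
  proof -
    have "0 \<le> (y - 1.02 * x) * (1.94 * x - y)" using y by simp
    then show ?thesis by (simp add: algebra_simps power2_eq_square)
  qed
  have xy2: "x * y^2 \<le> 2.96 * x^2 * y - 1.9788 * x^3"
    using mult_left_mono[OF y2, of x] x by (simp add: algebra_simps power2_eq_square power3_eq_cube)
  have y3: "y^3 \<le> 2.96 * (x * y^2) - 1.9788 * x^2 * y"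
    using mult_left_mono[OF y2, of y] x y by (simp add: algebra_simps power2_eq_square power3_eq_cube)
  have xy: "x * y \<le> 1.94 * x^2" using mult_left_mono[OF y(2), of x] x by (simp add: power2_eq_square mult_ac)
  have xxy: "1.02 * x^3 \<le> x^2 * y" "x^2 * y \<le> 1.94 * x^3"
    using mult_left_mono[OF y(1), of "x^2"] mult_left_mono[OF y(2), of "x^2"] 
    by (simp_all add: power2_eq_square power3_eq_cube mult_ac)
  show False using main x2 x3 y2 xy2 y3 xy xxy x y by (simp add: algebra_simps)
qed

lemma planes_at_K: "E \<in> planes_at P \<Longrightarrow> E \<in> Pls \<and> P \<in> E" by (simp add: planes_at_def)

lemma card_tans_at: "P \<in> K \<Longrightarrow> E \<in> planes_at P \<Longrightarrow> card {L \<in> tans P. L \<subseteq> E} = m E"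
  using card_tans_plane by (simp add: planes_at_def)

lemma planes_on_at: "l \<in> tans P \<Longrightarrow> E \<in> planes_on l \<Longrightarrow> E \<in> planes_at P"
  by (auto simp: tans_def lines_at_def planes_on_def planes_at_def)

lemma m_le: "P \<in> K \<Longrightarrow> E \<in> planes_at P \<Longrightarrow> m E \<le> q + 1"
  using a_pos[of P E] a_m[of E] by (simp add: planes_at_def)

lemma two_planes:
  assumes P: "P \<in> K" and E: "E1 \<in> planes_at P" "E2 \<in> planes_at P" "E1 \<noteq> E2"
  shows "card {L \<in> tans P. L \<subseteq> E1 \<or> L \<subseteq> E2} + card {L \<in> tans P. L \<subseteq> E1 \<and> L \<subseteq> E2} = m E1 + m E2"
    "card {L \<in> tans P. L \<subseteq> E1 \<and> L \<subseteq> E2} \<le> 1"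
proof -
  have "card {L \<in> tans P. L \<subseteq> E1} + card {L \<in> tans P. L \<subseteq> E2} =
     card ({L \<in> tans P. L \<subseteq> E1} \<union> {L \<in> tans P. L \<subseteq> E2}) + card ({L \<in> tans P. L \<subseteq> E1} \<inter> {L \<in> tans P. L \<subseteq> E2})"
    by (rule card_Un_Int) auto
  moreover have "{L \<in> tans P. L \<subseteq> E1} \<union> {L \<in> tans P. L \<subseteq> E2} = {L \<in> tans P. L \<subseteq> E1 \<or> L \<subseteq> E2}"
    "{L \<in> tans P. L \<subseteq> E1} \<inter> {L \<in> tans P. L \<subseteq> E2} = {L \<in> tans P. L \<subseteq> E1 \<and> L \<subseteq> E2}" by auto
  ultimately show "card {L \<in> tans P. L \<subseteq> E1 \<or> L \<subseteq> E2} + card {L \<in> tans P. L \<subseteq> E1 \<and> L \<subseteq> E2} = m E1 + m E2"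
    using card_tans_at[OF P E(1)] card_tans_at[OF P E(2)] by simp
  show "card {L \<in> tans P. L \<subseteq> E1 \<and> L \<subseteq> E2} \<le> 1"
    by (rule card_common_line) (use E planes_at_K in auto)
qed

lemma three_planes:
  assumes P: "P \<in> K" and E: "E1 \<in> planes_at P" "E2 \<in> planes_at P" "E3 \<in> planes_at P" "E1 \<noteq> E2" "E1 \<noteq> E3" "E2 \<noteq> E3"
  shows "m E1 + m E2 + m E3 \<le> t + 3"
proof -
  let ?U = "{L \<in> tans P. L \<subseteq> E1 \<or> L \<subseteq> E2}" and ?V = "{L \<in> tans P. L \<subseteq> E3}"
  have "m E1 + m E2 \<le> card ?U + 1" using two_planes[OF P E(1,2,4)] by simp
  moreover have "card ?U + card ?V = card (?U \<union> ?V) + card (?U \<inter> ?V)"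
    by (rule card_Un_Int) auto
  moreover have "card (?U \<union> ?V) \<le> t"
    unfolding card_tans[OF P, symmetric] by (rule card_mono) auto
  moreover have "?U \<inter> ?V = {L \<in> tans P. L \<subseteq> E1 \<and> L \<subseteq> E3} \<union> {L \<in> tans P. L \<subseteq> E2 \<and> L \<subseteq> E3}" by auto
  then have "card (?U \<inter> ?V) \<le> 2"
    using card_Un_le[of "{L \<in> tans P. L \<subseteq> E1 \<and> L \<subseteq> E3}" "{L \<in> tans P. L \<subseteq> E2 \<and> L \<subseteq> E3}"]
      two_planes(2)[OF P E(1,3,5)] two_planes(2)[OF P E(2,3,6)] by simp
  ultimately show ?thesis using card_tans_at[OF P E(3)] by simp
qed

lemma other_planes:
  assumes P: "P \<in> K" and E: "E \<in> planes_at P" "E1 \<in> planes_at P" "E2 \<in> planes_at P"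
    and sub: "tans P \<subseteq> {L. L \<subseteq> E1 \<or> L \<subseteq> E2}" and ne: "E \<noteq> E1" "E \<noteq> E2"
  shows "m E \<le> 2"
proof -
  have "{L \<in> tans P. L \<subseteq> E} = {L \<in> tans P. L \<subseteq> E \<and> L \<subseteq> E1} \<union> {L \<in> tans P. L \<subseteq> E \<and> L \<subseteq> E2}"
    using sub by auto
  then have "m E \<le> card {L \<in> tans P. L \<subseteq> E \<and> L \<subseteq> E1} + card {L \<in> tans P. L \<subseteq> E \<and> L \<subseteq> E2}"
    using card_Un_le[of "{L \<in> tans P. L \<subseteq> E \<and> L \<subseteq> E1}" "{L \<in> tans P. L \<subseteq> E \<and> L \<subseteq> E2}"]
    unfolding card_tans_at[OF P E(1), symmetric] by presburger
  then show ?thesis using two_planes(2)[OF P E(1,2) ne(1)] two_planes(2)[OF P E(1,3) ne(2)] by simp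
qed

lemma nice_small: "m E \<le> 2 \<Longrightarrow> nice E"
proof -
  assume "m E \<le> 2"
  then have "m E * (m E - 1) \<le> 2 * 1" by (intro mult_le_mono) auto
  then show ?thesis using q_ge by (simp add: nice_def)
qed

lemma long_plane_a: "E \<in> Pls \<Longrightarrow> real (m E) \<ge> 0.87 * real q \<Longrightarrow> a E \<le> m E"
  using real_a[of E] q_ge' by simp

text \<open>Double count of incident pairs of a point of \<open>K\<close> and a plane with
  \<open>m = j\<close>: each such plane has \<open>q + 2 - j\<close> points of \<open>K\<close>.
  This is the source of the integrality contradictions.\<close>

lemma count_planes:
  assumes "\<And>P. P \<in> K \<Longrightarrow> card {E \<in> planes_at P. m E = j} = n" "j \<le> q + 1"
  shows "(q + 2 - j) dvd k * n"
proof -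
  have "(\<Sum>P\<in>K. \<Sum>E | E \<in> planes_at P \<and> m E = j. 1) = (\<Sum>E | E \<in> Pls \<and> m E = j. real (a E) * 1)"
    by (rule sum_K_planes)
  moreover have "(\<Sum>P\<in>K. \<Sum>E | E \<in> planes_at P \<and> m E = j. (1::real)) = real (k * n)"
    using assms(1) by (simp add: k_def)
  moreover have "a E = q + 2 - j" if "E \<in> Pls" "m E = j" for E using a_m[OF that(1)] that(2) by simp
  then have "(\<Sum>E | E \<in> Pls \<and> m E = j. real (a E) * 1) = real ((q + 2 - j) * card {E \<in> Pls. m E = j})"
    by simp
  ultimately have "k * n = (q + 2 - j) * card {E \<in> Pls. m E = j}" by (simp only: of_nat_eq_iff)
  then show ?thesis by simp
qed

text \<open>With \<open>t = 0\<close> every plane meeting \<open>K\<close> would have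
  \<open>q + 2\<close> points, so \<open>q + 2\<close> would divide
  \<open>(q^2 + q + 2) (q^2 + q + 1)\<close>, which is 12 modulo \<open>q + 2\<close>.\<close>

lemma t_nonzero: "t \<noteq> 0"
proof
  assume t: "t = 0"
  have "card {E \<in> planes_at P. m E = 0} = q^2 + q + 1" if P: "P \<in> K" for P
  proof -
    have "m E = 0" if E: "E \<in> planes_at P" for E
    proof -
      have "tans P = {}" using card_tans[OF P] t by simp
      then show ?thesis using card_tans_at[OF P E] by simp
    qed
    then have "{E \<in> planes_at P. m E = 0} = planes_at P" by auto
    then show ?thesis using card_planes_at[of P] P K_pts by auto
  qed
  from count_planes[OF this] have "(q + 2) dvd k * (q^2 + q + 1)" by simp
  moreover have "k = q^2 + q + 2" using k_t t by simp
  ultimately have "(q + 2) dvd (q^2 + q + 2) * (q^2 + q + 1)" by simp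
  then have "int (q + 2) dvd (int q ^ 2 + int q + 2) * (int q ^ 2 + int q + 1)"
    by (metis (mono_tags, opaque_lifting) int_dvd_int_iff of_nat_1 of_nat_add of_nat_mult of_nat_numeral of_nat_power)
  moreover have "(int q ^ 2 + int q + 2) * (int q ^ 2 + int q + 1) =
     int (q + 2) * ((int q - 1) * (int q ^ 2 + int q + 1) + 4 * (int q - 1)) + 12"
    by (simp add: algebra_simps power2_eq_square)
  ultimately have "int (q + 2) dvd 12" by (metis dvd_add_right_iff dvd_triv_left)
  then have "int (q + 2) \<le> 12" by (rule zdvd_imp_le) simp
  then show False using q_ge by simp
qed

lemma tangent_ex: "P \<in> K \<Longrightarrow> tans P \<noteq> {}"
  using card_tans[of P] t_nonzero by auto

section \<open>All tangents at a point in one plane\<close>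

lemma tangent_plane_long:
  assumes P: "P \<in> K" and l: "l \<in> tans P"
  shows "\<exists>E\<in>planes_on l. real q ^ 2 + real q - (real t - 1) - real t ^ 2 / 155 \<le> (real (m E) - 1) * (real t - 1)"
  using longest_plane[OF P l tau_le_tau_bound] by (simp only: q_tau_bound)

text \<open>Each tangent lies in a plane with \<open>m >= 0.97 q\<close>, and two such planes would
  exceed \<open>t\<close>, so all tangents at \<open>P\<close> lie in one plane. The other planes
  through \<open>P\<close> then have \<open>m <= 1\<close>, which makes \<open>tau <= t\<close>
  exact, and \<open>longest_plane\<close> without error term gives \<open>t >= q + 1\<close>. Then
  all lines through \<open>P\<close> in the tangent plane are tangents; every other plane through
  \<open>P\<close> meets it in one of them, and so contains at most \<open>q + 1\<close> points of
  \<open>K\<close>.\<close>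

lemma small_case:
  assumes small: "real t < 1.02 * real q"
  shows "t = q + 1" "\<And>E. E \<in> Pls \<Longrightarrow> a E \<le> q + 1"
proof -
  \<comment> \<open>\<open>1 - 1.0404 / 155\<close> exceeds 0.99 with room for the lower order
    terms, and \<open>0.99 / 1.02\<close> exceeds 0.97.\<close>
  have arith: "0.99 * A \<le> A + x - (y - 1) - C / 155"
    if "C \<le> 1.0404 * A" "y < 1.02 * x" "2048 * x \<le> A" "x \<ge> 2048" for A C x y :: real
    using that by simp
  have tangent_plane: "\<exists>E\<in>planes_at P. tans P \<subseteq> {L. L \<subseteq> E} \<and> m E = t \<and> real t \<ge> 0.97 * real q" if P: "P \<in> K" for P
  proof -
    have long: "\<exists>E\<in>planes_on l. real (m E) \<ge> 0.97 * real q" if l: "l \<in> tans P" for l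
    proof -
      obtain E where E: "E \<in> planes_on l"
        "real q ^ 2 + real q - (real t - 1) - real t ^ 2 / 155 \<le> (real (m E) - 1) * (real t - 1)"
        using tangent_plane_long[OF P l] by blast
      have m1: "real (m E) \<ge> 1" using m_pos[OF P l E(1)] by simp
      have q2: "real q ^ 2 \<ge> 2048 * real q" using q_ge' by (simp add: power2_eq_square)
      have "real t ^ 2 \<le> (1.02 * real q)^2" using small by (intro power_mono) auto
      then have "real t ^ 2 \<le> 1.0404 * real q ^ 2" by (simp add: power_mult_distrib power2_eq_square)
      then have "0.99 * real q ^ 2 \<le> real q ^ 2 + real q - (real t - 1) - real t ^ 2 / 155"
        using arith[OF _ small q2 q_ge'] by blast
      also have "\<dots> \<le> (real (m E) - 1) * (real t - 1)" by (rule E(2))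
      also have "\<dots> \<le> (real (m E) - 1) * (1.02 * real q)" using small m1 by (intro mult_left_mono) auto
      finally have "(0.99 * real q) * real q \<le> (1.02 * (real (m E) - 1)) * real q"
        by (simp add: power2_eq_square algebra_simps)
      then have "0.99 * real q \<le> 1.02 * (real (m E) - 1)" using q_ge' by simp
      then have "real (m E) \<ge> 0.97 * real q" using q_ge' by simp
      then show ?thesis using E(1) by blast
    qed
    obtain l0 where l0: "l0 \<in> tans P" using tangent_ex[OF P] by blast
    obtain E0 where E0: "E0 \<in> planes_on l0" "real (m E0) \<ge> 0.97 * real q" using long[OF l0] by blast
    have at0: "E0 \<in> planes_at P" by (rule planes_on_at[OF l0 E0(1)])
    have "l \<subseteq> E0" if l: "l \<in> tans P" for l
    proof -
      obtain E where E: "E \<in> planes_on l" "real (m E) \<ge> 0.97 * real q" using long[OF l] by blast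
      have at: "E \<in> planes_at P" by (rule planes_on_at[OF l E(1)])
      have "E = E0"
      proof (rule ccontr)
        assume "E \<noteq> E0"
        from two_planes[OF P at at0 this]
        have "m E + m E0 \<le> card {L \<in> tans P. L \<subseteq> E \<or> L \<subseteq> E0} + 1" by simp
        also have "card {L \<in> tans P. L \<subseteq> E \<or> L \<subseteq> E0} \<le> t"
          unfolding card_tans[OF P, symmetric] by (rule card_mono) auto
        finally have "real (m E) + real (m E0) \<le> real t + 1" by simp
        then show False using E E0 small q_ge' by simp
      qed
      then show ?thesis using E(1) by (auto simp: planes_on_def)
    qed
    then have sub: "tans P \<subseteq> {L. L \<subseteq> E0}" by auto
    then have "{L \<in> tans P. L \<subseteq> E0} = tans P" by auto
    then have "m E0 = t" using card_tans_at[OF P at0] card_tans[OF P] by simp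
    then show ?thesis using sub at0 E0(2) by auto
  qed
  have planes: "E' \<in> Pls \<Longrightarrow> E' \<inter> K \<noteq> {} \<Longrightarrow> nice E' \<or> a E' \<le> m E'" for E'
  proof -
    assume E': "E' \<in> Pls" "E' \<inter> K \<noteq> {}"
    then obtain P where P: "P \<in> K" "P \<in> E'" by blast
    obtain E0 where E0: "E0 \<in> planes_at P" "tans P \<subseteq> {L. L \<subseteq> E0}" "m E0 = t" "real t \<ge> 0.97 * real q"
      using tangent_plane[OF P(1)] by blast
    show ?thesis
    proof (cases "E' = E0")
      case True
      then show ?thesis using long_plane_a[OF E'(1)] E0 q_ge' by simp
    next
      case False
      have at: "E' \<in> planes_at P" using E' P by (simp add: planes_at_def)
      have "{L \<in> tans P. L \<subseteq> E' \<and> L \<subseteq> E0} = {L \<in> tans P. L \<subseteq> E'}" using E0(2) by auto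
      then have "m E' \<le> 1" using two_planes(2)[OF P(1) at E0(1) False] card_tans_at[OF P(1) at] by simp
      then show ?thesis using nice_small by simp
    qed
  qed
  have tau: "real (card (tans N)) \<le> real t" if "N \<in> Pts - K" for N
    using tau_le_of_planes[OF that planes] by simp
  obtain P where P: "P \<in> K" using K_nonempty by blast
  obtain l where l: "l \<in> tans P" using tangent_ex[OF P] by blast
  obtain E where E: "E \<in> planes_on l"
    "real q ^ 2 + real q - (real t - 1) - real q * (real t - real t) \<le> (real (m E) - 1) * (real t - 1)"
    using longest_plane[OF P l tau] by blast
  obtain E0 where E0: "E0 \<in> planes_at P" "tans P \<subseteq> {L. L \<subseteq> E0}" "m E0 = t" using tangent_plane[OF P] by blast
  have tq: "t \<le> q + 1" using m_le[OF P E0(1)] E0(3) by simp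
  have mq: "m E \<le> q + 1" by (rule m_le[OF P planes_on_at[OF l E(1)]])
  have "t \<ge> q + 1"
  proof (rule ccontr)
    assume "\<not> t \<ge> q + 1"
    then have t': "real t \<le> real q" by simp
    have "(real (m E) - 1) * (real t - 1) \<le> real q * (real q - 1)"
      using mq t' t_nonzero by (intro mult_mono) auto
    then show False using E(2) t' q_ge' by (simp add: power2_eq_square algebra_simps)
  qed
  then show tq': "t = q + 1" using tq by simp
  fix E' assume E': "E' \<in> Pls"
  show "a E' \<le> q + 1"
  proof (cases "E' \<inter> K = {}")
    case False
    then obtain P where P: "P \<in> K" "P \<in> E'" by blast
    have at: "E' \<in> planes_at P" using P E' by (simp add: planes_at_def)
    obtain E0 where E0: "E0 \<in> planes_at P" "m E0 = t" using tangent_plane[OF P(1)] by blast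
    have E0': "E0 \<in> Pls" "P \<in> E0" using planes_at_K[OF E0(1)] by auto
    have "card {L \<in> tans P. L \<subseteq> E0} = card {L \<in> lines_at P. L \<subseteq> E0}"
      using card_tans_at[OF P(1) E0(1)] E0(2) tq' card_lines_in_plane[OF E0'] by simp
    then have all: "{L \<in> tans P. L \<subseteq> E0} = {L \<in> lines_at P. L \<subseteq> E0}"
      using tans_sub by (intro card_subset_eq) auto
    have "\<exists>L\<in>tans P. L \<subseteq> E'"
    proof (cases "E' = E0")
      case True
      then show ?thesis using card_tans_at[OF P(1) at] E0(2) t_nonzero by (metis (no_types, lifting) card.empty empty_Collect_eq)
    next
      case False
      then have "E' \<inter> E0 \<in> lines_at P" using plane_inter[OF E' E0'(1)] P E0' by (simp add: lines_at_def)
      then show ?thesis using all by blast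
    qed
    then have "{L \<in> tans P. L \<subseteq> E'} \<noteq> {}" by blast
    then have "m E' \<noteq> 0" using card_tans_at[OF P(1) at] by (metis card_0_eq finite_Collect_conjI finite_tans(1) finite_subset[of _ "tans P"] mem_Collect_eq subsetI)
    then show ?thesis using a_m[OF E'] by simp
  qed (simp add: a_def)
qed

text \<open>On an interval the square lies below its chord; this turns polynomial estimates into
  linear ones in the monomials.\<close>

lemma square_le_chord: "c \<le> y \<Longrightarrow> y \<le> d \<Longrightarrow> y^2 \<le> (c + d) * y - c * d" for y :: real
proof -
  assume "c \<le> y" "y \<le> d"
  then have "0 \<le> (y - c) * (d - y)" by simp
  then show ?thesis by (simp add: algebra_simps power2_eq_square)
qed

section \<open>All tangents at a point in two planes\<close>

lemma plane_excess:
  assumes P: "P \<in> K" and E: "E \<in> planes_at P" and t: "1.94 * real q < real t"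
  shows "(real (a E) - 1) * (real (m E) - 2)^2 \<le> 0.092 * real q ^ 3"
proof -
  define x where "x = real q"
  define y where "y = real t"
  have x: "x \<ge> 2048" using q_ge' by (simp add: x_def)
  have y: "1.94 * x \<le> y" "y \<le> 2.15 * x" using t t_le_2 by (auto simp: x_def y_def)
  have "(real (a E) - 1) * (real (m E) - 2)^2 \<le> (\<Sum>E\<in>planes_at P. (real (a E) - 1) * (real (m E) - 2)^2)"
    by (rule member_le_sum[OF E]) (use a_pos[OF P] planes_at_K in auto)
  also have "\<dots> = (\<Sum>E\<in>planes_at P. (real (a E) - 1) * (real (m E) ^ 2 - 4 * real (m E) + 4))"
    by (rule sum.cong[OF refl]) (simp add: power2_eq_square algebra_simps)
  also have "\<dots> \<le> y * (x * (tau_bound - 1)) - 4 * ((real k - 1) * y) + 4 * ((real k - 1) * (x + 1))"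
    unfolding x_def y_def by (rule quadratic_moment[OF P])
  also have "y * (x * (tau_bound - 1)) = y * (x * y + y^2 / 155 - x)"
    using x by (simp add: tau_bound_def x_def[symmetric] y_def[symmetric] field_simps)
  also have "real k - 1 = x^2 + x + 1 - y" using real_k by (simp add: x_def y_def)
  also have "y * (x * y + y\<^sup>2 / 155 - x) - 4 * ((x\<^sup>2 + x + 1 - y) * y) + 4 * ((x\<^sup>2 + x + 1 - y) * (x + 1)) =
      (x * y^2 - 4 * (x^2 * y) + 4 * x^3) + y^3 / 155 + (8 * x^2 - 9 * (x * y) + 4 * y^2) + (8 * x + 4 - 8 * y)"
    by (simp add: algebra_simps power2_eq_square power3_eq_cube)
  also have "\<dots> \<le> 0.092 * x^3"
  proof -
    have y2: "y^2 \<le> 4.09 * (x * y) - 4.171 * x^2"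
    proof -
      have "(1.94 * x + 2.15 * x) * y - 1.94 * x * (2.15 * x) = 4.09 * (x * y) - 4.171 * x^2"
        by (simp add: power2_eq_square field_simps)
      then show ?thesis using square_le_chord[OF y] by simp
    qed
    have xy2: "x * y^2 \<le> 4.09 * (x^2 * y) - 4.171 * x^3"
      using mult_left_mono[OF y2, of x] x by (simp add: algebra_simps power2_eq_square power3_eq_cube)
    have y3: "y^3 \<le> 4.09 * (x * y^2) - 4.171 * (x^2 * y)"
      using mult_left_mono[OF y2, of y] x y by (simp add: algebra_simps power2_eq_square power3_eq_cube)
    have xy: "1.94 * x^2 \<le> x * y" "x * y \<le> 2.15 * x^2"
      using mult_left_mono[OF y(1), of x] mult_left_mono[OF y(2), of x] x by (simp_all add: power2_eq_square mult_ac)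
    have xxy: "1.94 * x^3 \<le> x^2 * y" "x^2 * y \<le> 2.15 * x^3"
      using mult_left_mono[OF y(1), of "x^2"] mult_left_mono[OF y(2), of "x^2"]
      by (simp_all add: power2_eq_square power3_eq_cube mult_ac)
    have x3: "x^3 \<ge> 2048 * x^2" using x by (simp add: power3_eq_cube power2_eq_square)
    \<comment> \<open>For \<open>y = c x\<close> the leading coefficient is
      \<open>(c - 2)^2 + c^3 / 155\<close>, below 0.087 for \<open>c\<close> from 1.94 to 2.15. The
      lower order terms account for the rest of 0.092.\<close>
    have bound: "(XYY - 4 * XXY + 4 * XXX) + YYY / 155 + (8 * XX - 9 * XY + 4 * YY) + (8 * x + 4 - 8 * y) \<le> 0.092 * XXX"
      if "YY \<le> 4.09 * XY - 4.171 * XX" "XYY \<le> 4.09 * XXY - 4.171 * XXX" "YYY \<le> 4.09 * XYY - 4.171 * XXY"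
        "1.94 * XX \<le> XY" "XY \<le> 2.15 * XX" "1.94 * XXX \<le> XXY" "XXY \<le> 2.15 * XXX" "XXX \<ge> 2048 * XX"
        "1.94 * x \<le> y" "x \<ge> 2048" "XX \<ge> 0" "XXX \<ge> 0" for XYY XXY XXX YYY XX XY YY :: real
      using that by simp
    show ?thesis by (rule bound[OF y2 xy2 y3 xy xxy x3 y(1) x]) (use x in simp_all)
  qed
  finally show ?thesis by (simp add: x_def)
qed

text \<open>A gap argument. Averaging yields a plane with \<open>u = m - 2 >= 0.449 q\<close>. By
  \<open>plane_excess\<close> the ratio \<open>v = u / q\<close> satisfies
  \<open>v^2 (1 - v) <= 0.092\<close> up to lower order terms, but this function exceeds 0.092
  between 0.449 and 0.87, so the plane must be nearly full of tangents.\<close>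

lemma long_plane_ex:
  assumes P: "P \<in> K" and l: "l \<in> tans P" and t: "1.94 * real q < real t"
  shows "\<exists>E\<in>planes_on l. real (m E) - 1 \<ge> 0.87 * real q"
proof -
  obtain E where E: "E \<in> planes_on l"
    "real q ^ 2 + real q - (real t - 1) - real t ^ 2 / 155 \<le> (real (m E) - 1) * (real t - 1)"
    using tangent_plane_long[OF P l] by blast
  define x where "x = real q"
  define u where "u = real (m E) - 2"
  have x: "x \<ge> 2048" using q_ge' by (simp add: x_def)
  have m1: "real (m E) \<ge> 1" using m_pos[OF P l E(1)] by simp
  have x2: "x^2 \<ge> 2048 * x" using x by (simp add: power2_eq_square)
  have "real t ^ 2 \<le> (2.15 * x)^2" using t_le_2 by (intro power_mono) (auto simp: x_def)
  then have "real t ^ 2 \<le> 4.6225 * x ^ 2" by (simp add: power_mult_distrib power2_eq_square)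
  moreover have "0.969 * A \<le> A + x - (y - 1) - C / 155"
    if "C \<le> 4.6225 * A" "y \<le> 2.15 * x" "2048 * x \<le> A" for A C y :: real
    using that x by simp
  ultimately have "0.969 * x ^ 2 \<le> x ^ 2 + x - (real t - 1) - real t ^ 2 / 155"
    using x2 t_le_2 unfolding x_def by blast
  also have "\<dots> \<le> (real (m E) - 1) * (real t - 1)" using E(2) by (simp add: x_def)
  also have "\<dots> \<le> (real (m E) - 1) * (2.15 * x)" using t_le_2 m1 by (intro mult_left_mono) (auto simp: x_def)
  finally have "(0.969 * x) * x \<le> (2.15 * (real (m E) - 1)) * x"
    by (simp add: power2_eq_square algebra_simps)
  then have "0.969 * x \<le> 2.15 * (real (m E) - 1)" using x by simp
  then have u1: "u \<ge> 0.449 * x" using x by (simp add: u_def)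
  have pl: "E \<in> Pls" using E(1) by (simp add: planes_on_def)
  have "(real (a E) - 1) * u^2 \<le> 0.092 * x ^ 3"
    using plane_excess[OF P planes_on_at[OF l E(1)] t] by (simp add: x_def u_def)
  moreover have "real (a E) - 1 = x - 1 - u" using real_a[OF pl] by (simp add: x_def u_def)
  ultimately have main: "(x - 1 - u) * u^2 \<le> 0.092 * x ^ 3" by simp
  have "u > 0.87 * x - 1"
  proof (rule ccontr)
    assume "\<not> u > 0.87 * x - 1"
    then have u2: "u \<le> 0.87 * x" by simp
    have v2: "u^2 \<le> 1.319 * (x * u) - 0.39063 * x^2"
    proof -
      have "(0.449 * x + 0.87 * x) * u - 0.449 * x * (0.87 * x) = 1.319 * (x * u) - 0.39063 * x^2"
        by (simp add: power2_eq_square field_simps)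
      then show ?thesis using square_le_chord[OF u1 u2] by simp
    qed
    have v3: "u^3 \<le> 1.319 * (x * u^2) - 0.39063 * (x^2 * u)"
      using mult_left_mono[OF v2, of u] x u1 by (simp add: algebra_simps power2_eq_square power3_eq_cube)
    have xv2: "x * u^2 \<le> 1.319 * (x^2 * u) - 0.39063 * x^3"
      using mult_left_mono[OF v2, of x] x by (simp add: algebra_simps power2_eq_square power3_eq_cube)
    have xxv: "x^2 * u \<le> 0.87 * x^3"
      using mult_left_mono[OF u2, of "x^2"] by (simp add: power2_eq_square power3_eq_cube mult_ac)
    have xv: "x * u \<le> 0.87 * x^2" using mult_left_mono[OF u2, of x] x by (simp add: power2_eq_square mult_ac)
    have x3: "x^3 \<ge> 2048 * x^2" using x by (simp add: power3_eq_cube power2_eq_square)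
    have m': "x * u^2 - u^2 - u^3 \<le> 0.092 * x^3"
      using main by (simp add: algebra_simps power2_eq_square power3_eq_cube)
    have contra: "False" if "XVV - VV - VVV \<le> 0.092 * XXX" "VV \<le> 1.319 * XV - 0.39063 * XX"
      "VVV \<le> 1.319 * XVV - 0.39063 * XXV" "XVV \<le> 1.319 * XXV - 0.39063 * XXX" "XXV \<le> 0.87 * XXX"
      "XV \<le> 0.87 * XX" "XXX \<ge> 2048 * XX" "XX > 0" for XVV VV VVV XXX XV XX XXV :: real
      using that by simp
    show False by (rule contra[OF m' v2 v3 xv2 xxv xv x3]) (use x in simp)
  qed
  then have "real (m E) - 1 \<ge> 0.87 * real q" by (simp add: u_def x_def)
  then show ?thesis using E(1) by blast
qed

text \<open>One plane holds at most \<open>q + 1 < t\<close> tangents at \<open>P\<close>, while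
  three long planes would need about \<open>2.61 q\<close>, more than
  \<open>t <= 2.15 q\<close>.\<close>

lemma two_long_planes:
  assumes P: "P \<in> K" and t: "1.94 * real q < real t"
  shows "\<exists>E1 E2. E1 \<in> planes_at P \<and> E2 \<in> planes_at P \<and> E1 \<noteq> E2 \<and> tans P \<subseteq> {L. L \<subseteq> E1 \<or> L \<subseteq> E2} \<and>
    real (m E1) \<ge> 0.87 * real q + 1 \<and> real (m E2) \<ge> 0.87 * real q + 1"
proof -
  have long: "\<exists>E\<in>planes_at P. l \<subseteq> E \<and> real (m E) \<ge> 0.87 * real q + 1" if l: "l \<in> tans P" for l
  proof -
    obtain E where E: "E \<in> planes_on l" "real (m E) - 1 \<ge> 0.87 * real q" using long_plane_ex[OF P l t] by blast
    then show ?thesis using planes_on_at[OF l E(1)] by (intro bexI[of _ E]) (auto simp: planes_on_def)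
  qed
  obtain l1 where "l1 \<in> tans P" using tangent_ex[OF P] by blast
  then obtain E1 where E1: "E1 \<in> planes_at P" "real (m E1) \<ge> 0.87 * real q + 1" using long by blast
  have "\<exists>l\<in>tans P. \<not> l \<subseteq> E1"
  proof (rule ccontr)
    assume "\<not> ?thesis"
    then have "{L \<in> tans P. L \<subseteq> E1} = tans P" by auto
    then have "m E1 = t" using card_tans_at[OF P E1(1)] card_tans[OF P] by simp
    then show False using m_le[OF P E1(1)] t q_ge' by simp
  qed
  then obtain l2 where l2: "l2 \<in> tans P" "\<not> l2 \<subseteq> E1" by blast
  then obtain E2 where E2: "E2 \<in> planes_at P" "l2 \<subseteq> E2" "real (m E2) \<ge> 0.87 * real q + 1" using long by blast
  have ne: "E1 \<noteq> E2" using l2 E2 by auto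
  have "l \<subseteq> E1 \<or> l \<subseteq> E2" if l: "l \<in> tans P" for l
  proof (rule ccontr)
    assume n: "\<not> (l \<subseteq> E1 \<or> l \<subseteq> E2)"
    obtain E3 where E3: "E3 \<in> planes_at P" "l \<subseteq> E3" "real (m E3) \<ge> 0.87 * real q + 1" using long[OF l] by blast
    have "m E1 + m E2 + m E3 \<le> t + 3"
      by (rule three_planes[OF P E1(1) E2(1) E3(1)]) (use n E3 ne in auto)
    then have "real (m E1) + real (m E2) + real (m E3) \<le> real t + 3" by linarith
    then show False using E1 E2 E3 t_le_2 q_ge' by simp
  qed
  then show ?thesis using E1 E2 ne by blast
qed

text \<open>Long planes satisfy \<open>a <= m\<close>, and all other planes meeting \<open>K\<close>
  have \<open>m <= 2\<close> and are nice, so the error term of \<open>tau_bound\<close> is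
  gone.\<close>

lemma tau_le_large:
  assumes t: "1.94 * real q < real t" and N: "N \<in> Pts - K"
  shows "real (card (tans N)) \<le> real t"
proof -
  have "nice E \<or> a E \<le> m E" if E: "E \<in> Pls" "E \<inter> K \<noteq> {}" for E
  proof -
    obtain P where P: "P \<in> K" "P \<in> E" using E by blast
    have at: "E \<in> planes_at P" using E P by (simp add: planes_at_def)
    obtain E1 E2 where E12: "E1 \<in> planes_at P" "E2 \<in> planes_at P" "tans P \<subseteq> {L. L \<subseteq> E1 \<or> L \<subseteq> E2}"
      "real (m E1) \<ge> 0.87 * real q + 1" "real (m E2) \<ge> 0.87 * real q + 1"
      using two_long_planes[OF P(1) t] by blast
    show ?thesis
    proof (cases "E = E1 \<or> E = E2")
      case True
      then show ?thesis using long_plane_a[OF E(1)] E12 by fastforce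
    next
      case False
      then have "m E \<le> 2" using other_planes[OF P(1) at E12(1,2,3)] by simp
      then show ?thesis using nice_small by blast
    qed
  qed
  then show ?thesis using tau_le_of_planes[OF N] by simp
qed

text \<open>Take a tangent \<open>l\<close> in \<open>E1\<close> but not in \<open>E2\<close>. The
  planes on \<open>l\<close> other than \<open>E1\<close> have \<open>m\<close> equal to 1 or 2,
  where \<open>(m - 1)^2 = m - 1\<close>, so the second moment along \<open>l\<close> is determined
  by \<open>m E1\<close> and \<open>t\<close>.\<close>

lemma long_plane_eq:
  assumes t: "1.94 * real q < real t" and P: "P \<in> K" and E: "E1 \<in> planes_at P" "E2 \<in> planes_at P" "E1 \<noteq> E2"
    and sub: "tans P \<subseteq> {L. L \<subseteq> E1 \<or> L \<subseteq> E2}" and m1: "m E1 \<ge> 2"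
  shows "real q ^ 2 + real q \<le> real (m E1) ^ 2 - 3 * real (m E1) + 2 * real t"
proof -
  have "\<not> {L \<in> tans P. L \<subseteq> E1} \<subseteq> {L \<in> tans P. L \<subseteq> E1 \<and> L \<subseteq> E2}"
  proof
    assume "{L \<in> tans P. L \<subseteq> E1} \<subseteq> {L \<in> tans P. L \<subseteq> E1 \<and> L \<subseteq> E2}"
    then have "card {L \<in> tans P. L \<subseteq> E1} \<le> card {L \<in> tans P. L \<subseteq> E1 \<and> L \<subseteq> E2}" by (intro card_mono) auto
    then show False using two_planes(2)[OF P E] card_tans_at[OF P E(1)] m1 by simp
  qed
  then obtain l where l: "l \<in> tans P" "l \<subseteq> E1" "\<not> l \<subseteq> E2" by blast
  have on: "E1 \<in> planes_on l" using l E planes_at_K by (auto simp: planes_on_def)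
  have l': "l \<in> Lns" using l by (auto simp: tans_def lines_at_def)
  have fin: "finite (planes_on l)" by simp
  have sum1: "(\<Sum>E\<in>planes_on l. real (m E) - 1) = real t - 1"
  proof -
    have "(\<Sum>E\<in>planes_on l. real (m E) - 1) = real (\<Sum>E\<in>planes_on l. m E) - (real q + 1)"
      using card_planes_on[OF l'] by (simp add: sum_subtractf)
    then show ?thesis unfolding sum_m_tangent[OF P l(1)] by simp
  qed
  have "real q ^ 2 + real q - (real t - 1) - real q * (real t - real t) \<le> (\<Sum>E\<in>planes_on l. (real (m E) - 1)^2)"
    by (rule tangent_moment_bound(2)[OF P l(1) tau_le_large[OF t]])
  also have "\<dots> = (real (m E1) - 1)^2 + (\<Sum>E\<in>planes_on l - {E1}. (real (m E) - 1)^2)"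
    by (rule sum.remove[OF fin on])
  also have "(\<Sum>E\<in>planes_on l - {E1}. (real (m E) - 1)^2) = (\<Sum>E\<in>planes_on l - {E1}. real (m E) - 1)"
  proof (rule sum.cong[OF refl])
    fix E assume E': "E \<in> planes_on l - {E1}"
    have "E \<noteq> E2" using E' l(3) by (auto simp: planes_on_def)
    then have "m E \<le> 2" using other_planes[OF P planes_on_at[OF l(1)] E(1,2) sub, of E] E' by auto
    moreover have "m E \<ge> 1" using m_pos[OF P l(1), of E] E' by auto
    ultimately have "m E = 1 \<or> m E = 2" by linarith
    then show "(real (m E) - 1)^2 = real (m E) - 1" by auto
  qed
  also have "(\<Sum>E\<in>planes_on l - {E1}. real (m E) - 1) = (real t - 1) - (real (m E1) - 1)"
    using sum.remove[OF fin on, of "\<lambda>E. real (m E) - 1"] sum1 by simp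
  finally show ?thesis by (simp add: power2_eq_square algebra_simps)
qed

text \<open>The line \<open>E1 \<inter> E2\<close> is one of the \<open>q + 1\<close> lines of
  \<open>E1\<close> through \<open>P\<close>; unless it is a tangent, it is lost for
  \<open>m E1\<close>.\<close>

lemma common_line_m:
  assumes P: "P \<in> K" and E: "E1 \<in> planes_at P" "E2 \<in> planes_at P" "E1 \<noteq> E2"
  shows "m E1 \<le> q + card {L \<in> tans P. L \<subseteq> E1 \<and> L \<subseteq> E2}"
proof (cases "{L \<in> tans P. L \<subseteq> E1 \<and> L \<subseteq> E2} = {}")
  case True
  have E': "E1 \<in> Pls" "P \<in> E1" "E2 \<in> Pls" "P \<in> E2" using E planes_at_K by auto
  have l: "E1 \<inter> E2 \<in> {L \<in> lines_at P. L \<subseteq> E1}" using plane_inter[of E1 E2] E' E(3) by (auto simp: lines_at_def)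
  have "{L \<in> tans P. L \<subseteq> E1} \<subseteq> {L \<in> lines_at P. L \<subseteq> E1} - {E1 \<inter> E2}" using True tans_sub by blast
  then have "card {L \<in> tans P. L \<subseteq> E1} \<le> card ({L \<in> lines_at P. L \<subseteq> E1} - {E1 \<inter> E2})"
    by (intro card_mono) auto
  also have "\<dots> = q" using l card_lines_in_plane[OF E'(1,2)] by simp
  finally show ?thesis using card_tans_at[OF P E(1)] by simp
next
  case False
  then have "card {L \<in> tans P. L \<subseteq> E1 \<and> L \<subseteq> E2} \<ge> 1"
    by (metis (no_types, lifting) One_nat_def Suc_leI card_gt_0_iff finite_tans(1) finite_subset mem_Collect_eq subsetI)
  then show ?thesis using m_le[OF P E(1)] by simp
qed

text \<open>The three types of points: the tangents are all lines through \<open>P\<close> in two planes, or all of these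
  lines except one, which lies in only one of the planes or in both of them.\<close>

lemma point_types:
  assumes t: "1.94 * real q < real t" and P: "P \<in> K"
  defines "n \<equiv> \<lambda>j. card {E \<in> planes_at P. m E = j}"
  shows "t = 2 * q + 1 \<and> n 1 = q - 1 \<or> t = 2 * q \<and> n 0 = 0 \<and> n 1 = 2 * q - 1 \<or>
    t = 2 * q \<and> n 0 = q - 1 \<and> n 1 = 0"
proof -
  obtain E1 E2 where E: "E1 \<in> planes_at P" "E2 \<in> planes_at P" "E1 \<noteq> E2"
      and sub: "tans P \<subseteq> {L. L \<subseteq> E1 \<or> L \<subseteq> E2}"
      and m12: "real (m E1) \<ge> 0.87 * real q + 1" "real (m E2) \<ge> 0.87 * real q + 1"
    using two_long_planes[OF P t] by blast
  have m2: "m E1 > 2" "m E2 > 2" using m12 q_ge' by simp_all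
  define c where "c = card {L \<in> tans P. L \<subseteq> E1 \<and> L \<subseteq> E2}"
  have c1: "c \<le> 1" using two_planes(2)[OF P E] by (simp add: c_def)
  have "{L \<in> tans P. L \<subseteq> E1 \<or> L \<subseteq> E2} = tans P" using sub by auto
  then have tc: "t + c = m E1 + m E2" using two_planes(1)[OF P E] card_tans[OF P] by (simp add: c_def)
  have le1: "m E1 \<le> q + c" using common_line_m[OF P E] by (simp add: c_def)
  have c': "c = card {L \<in> tans P. L \<subseteq> E2 \<and> L \<subseteq> E1}" unfolding c_def by (rule arg_cong[where f=card]) auto
  have le2: "m E2 \<le> q + c" using common_line_m[OF P E(2,1) E(3)[symmetric]] by (simp add: c')
  have sub': "tans P \<subseteq> {L. L \<subseteq> E2 \<or> L \<subseteq> E1}" using sub by auto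
  have i1: "real q ^ 2 + real q \<le> real (m E1) ^ 2 - real (m E1) + 2 * (real (m E2) - real c)"
    using long_plane_eq[OF t P E sub] m2 tc by (simp add: algebra_simps flip: of_nat_add)
  have i2: "real q ^ 2 + real q \<le> real (m E2) ^ 2 - real (m E2) + 2 * (real (m E1) - real c)"
    using long_plane_eq[OF t P E(2,1) E(3)[symmetric] sub'] m2 tc by (simp add: algebra_simps flip: of_nat_add)
  \<comment> \<open>For \<open>M <= q - 1\<close> the right side is at most
    \<open>(q - 1) (q - 2) + 2 q\<close>, which is below \<open>q^2 + q\<close>.\<close>
  have ge: "M \<ge> q" if "real q ^ 2 + real q \<le> real M ^ 2 - real M + 2 * (real M' - real c)" "M' \<le> q + c" "M > 2" for M M'
  proof (rule ccontr)
    assume "\<not> M \<ge> q"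
    then have "real M \<le> real q - 1" by simp
    then have "real M * (real M - 1) \<le> (real q - 1) * (real q - 2)" using that(3) by (intro mult_mono) auto
    then show False using that(1,2) q_ge' by (simp add: power2_eq_square algebra_simps)
  qed
  have ge1: "m E1 \<ge> q" and ge2: "m E2 \<ge> q" using ge[OF i1 le2 m2(1)] ge[OF i2 le1 m2(2)] by auto
  \<comment> \<open>For \<open>m E1 = q\<close> the inequality \<open>i1\<close> leaves no slack and
    forces the largest value of \<open>m E2\<close>.\<close>
  have eq1: "m E2 = q + c" if "m E1 = q" using i1 le2 that by (simp add: power2_eq_square)
  have eq2: "m E1 = q + c" if "m E2 = q" using i2 le1 that by (simp add: power2_eq_square)
  define Q where "Q = planes_at P - {E1, E2}"
  have Q2: "m E' \<le> 2" if "E' \<in> Q" for E'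
    using other_planes[OF P _ E(1,2) sub, of E'] that by (auto simp: Q_def)
  have split: "sum f (planes_at P) = sum f Q + f E1 + f E2" for f :: "'a set \<Rightarrow> real"
  proof -
    have "sum f (planes_at P) = f E1 + sum f (planes_at P - {E1})" by (rule sum.remove) (use E in auto)
    also have "sum f (planes_at P - {E1}) = f E2 + sum f (planes_at P - {E1} - {E2})" by (rule sum.remove) (use E in auto)
    also have "planes_at P - {E1} - {E2} = Q" by (auto simp: Q_def)
    finally show ?thesis by simp
  qed
  have PP: "P \<in> Pts" using P K_pts by blast
  have s0: "(\<Sum>E\<in>Q. 1::real) = real q ^ 2 + real q - 1"
    using split[of "\<lambda>E. 1"] card_planes_at[OF PP] by simp
  have "(\<Sum>E\<in>planes_at P. real (m E) * 1) = (\<Sum>l\<in>tans P. \<Sum>E\<in>planes_on l. 1)"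
    by (rule sum_planes_at_tangents[OF P])
  also have "\<dots> = (\<Sum>l\<in>tans P. real q + 1)"
    by (rule sum.cong) (use card_planes_on in \<open>auto simp: tans_def lines_at_def\<close>)
  finally have s1: "(\<Sum>E\<in>Q. real (m E)) = real t * (real q + 1) - real (m E1) - real (m E2)"
    using split[of "\<lambda>E. real (m E)"] card_tans[OF P] by simp
  have "(\<Sum>E\<in>planes_at P. real (m E) * (real (m E) - 1)) = (\<Sum>l\<in>tans P. \<Sum>E\<in>planes_on l. real (m E) - 1)"
    by (rule sum_planes_at_tangents[OF P])
  also have "\<dots> = (\<Sum>l\<in>tans P. real t - 1)"
  proof (rule sum.cong[OF refl])
    fix l assume l: "l \<in> tans P"
    then have l': "l \<in> Lns" by (auto simp: tans_def lines_at_def)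
    have "(\<Sum>E\<in>planes_on l. real (m E) - 1) = real (\<Sum>E\<in>planes_on l. m E) - (real q + 1)"
      using card_planes_on[OF l'] by (simp add: sum_subtractf)
    then show "(\<Sum>E\<in>planes_on l. real (m E) - 1) = real t - 1" unfolding sum_m_tangent[OF P l] by simp
  qed
  finally have s2: "(\<Sum>E\<in>Q. real (m E) * (real (m E) - 1)) =
      real t * (real t - 1) - real (m E1) * (real (m E1) - 1) - real (m E2) * (real (m E2) - 1)"
    using split[of "\<lambda>E. real (m E) * (real (m E) - 1)"] card_tans[OF P] by simp
  have nQ: "n j = card {E \<in> Q. m E = j}" if "j \<le> 2" for j
    unfolding n_def by (rule arg_cong[where f=card]) (use m2 that in \<open>auto simp: Q_def\<close>)
  have fQ: "finite Q" by (simp add: Q_def)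
  have ind: "real (card {E \<in> Q. m E = j}) = (\<Sum>E\<in>Q. if m E = j then 1 else 0)" for j
    using fQ by (simp add: sum.inter_filter[symmetric])
  have m012: "m E' = 0 \<or> m E' = 1 \<or> m E' = 2" if "E' \<in> Q" for E' using Q2[OF that] by linarith
  have n1Q: "n 1 = card {E \<in> Q. m E = 1}" and n0Q: "n 0 = card {E \<in> Q. m E = 0}" by (rule nQ, simp)+
  \<comment> \<open>As \<open>m\<close> takes only the values 0, 1, 2 on \<open>Q\<close>, the
    indicator of \<open>m = 1\<close> is \<open>m - m (m - 1)\<close>, and twice that of
    \<open>m = 0\<close> is \<open>(m - 1) (m - 2)\<close>. The three sums \<open>s0\<close>,
    \<open>s1\<close>, \<open>s2\<close> therefore determine \<open>n 0\<close> and
    \<open>n 1\<close>.\<close>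
  have "real (n 1) = (\<Sum>E\<in>Q. real (m E) - real (m E) * (real (m E) - 1))"
    unfolding n1Q ind by (rule sum.cong[OF refl]) (use m012 in fastforce)
  then have n1: "real (n 1) = real t * (real q + 1) - real (m E1) - real (m E2) -
     (real t * (real t - 1) - real (m E1) * (real (m E1) - 1) - real (m E2) * (real (m E2) - 1))"
    unfolding sum_subtractf s1 s2 .
  have "2 * real (n 0) = (\<Sum>E\<in>Q. 2 * 1 - 2 * real (m E) + real (m E) * (real (m E) - 1))"
    unfolding n0Q ind sum_distrib_left by (rule sum.cong[OF refl]) (use m012 in fastforce)
  then have n0: "2 * real (n 0) = 2 * (real q ^ 2 + real q - 1) - 2 * (real t * (real q + 1) - real (m E1) - real (m E2)) +
     (real t * (real t - 1) - real (m E1) * (real (m E1) - 1) - real (m E2) * (real (m E2) - 1))"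
    unfolding sum.distrib sum_subtractf sum_distrib_left[symmetric] s0 s1 s2 .
  consider "c = 0" "m E1 = q" "m E2 = q" | "c = 1" "m E1 = q + 1" "m E2 = q + 1"
    | "c = 1" "m E1 = q" "m E2 = q + 1" | "c = 1" "m E1 = q + 1" "m E2 = q"
    using c1 ge1 ge2 le1 le2 eq1 eq2 by linarith
  then show ?thesis
  proof cases
    case 1
    then have "t = 2 * q" using tc by simp
    moreover from this 1 have "real (n 1) = 0" "real (n 0) = real q - 1"
      using n1 n0 by (simp_all add: power2_eq_square algebra_simps)
    then have "n 1 = 0" "n 0 = q - 1" by linarith+
    ultimately show ?thesis by simp
  next
    case 2
    then have "t = 2 * q + 1" using tc by simp
    moreover from this 2 have "real (n 1) = real q - 1"
      using n1 by (simp add: power2_eq_square algebra_simps)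
    then have "n 1 = q - 1" by linarith
    ultimately show ?thesis by simp
  next
    case 3
    then have "t = 2 * q" using tc by simp
    moreover from this 3 have "real (n 1) = 2 * real q - 1" "real (n 0) = 0"
      using n1 n0 by (simp_all add: power2_eq_square algebra_simps)
    then have "n 1 = 2 * q - 1" "n 0 = 0" by linarith+
    ultimately show ?thesis by simp
  next
    case 4
    then have "t = 2 * q" using tc by simp
    moreover from this 4 have "real (n 1) = 2 * real q - 1" "real (n 0) = 0"
      using n1 n0 by (simp_all add: power2_eq_square algebra_simps)
    then have "n 1 = 2 * q - 1" "n 0 = 0" by linarith+
    ultimately show ?thesis by simp
  qed
qed

lemma dvd_int_bound: "int d dvd int d * x + c \<Longrightarrow> c \<noteq> 0 \<Longrightarrow> int d \<le> \<bar>c\<bar>"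
  by (metis dvd_add_right_iff dvd_imp_le_int dvd_triv_left abs_of_nat)

text \<open>\<open>count_planes\<close> is applied to each type and evaluated modulo
  \<open>q + 1\<close> or \<open>q + 2\<close>; the remainders -6, -12 and -24 are nonzero and too
  small in absolute value to be divisible.\<close>

lemma large_case:
  assumes t: "1.94 * real q < real t"
  shows False
proof -
  have q1: "int (q - 1) = int q - 1" "int (2 * q - 1) = 2 * int q - 1" using q_ge by auto
  have kt: "int k = int q ^ 2 + int q + 2 - int t"
    using k_t by (simp add: eq_diff_eq flip: of_nat_add of_nat_power)
  obtain P0 where P0: "P0 \<in> K" using K_nonempty by blast
  show False
  proof (cases "t = 2 * q + 1")
    case True
    have kq1: "int k = int q ^ 2 - int q + 1" using kt True by simp
    from True have "card {E \<in> planes_at P. m E = 1} = q - 1" if "P \<in> K" for P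
      using point_types[OF t that] by auto
    from count_planes[OF this] have "(q + 1) dvd k * (q - 1)" using q_ge by simp
    then have "int (q + 1) dvd int k * (int q - 1)" unfolding q1(1)[symmetric] of_nat_mult[symmetric] int_dvd_int_iff .
    also have "int k * (int q - 1) = int (q + 1) * (int q ^ 2 - 3 * int q + 5) + (- 6)"
      unfolding kq1 by (simp add: algebra_simps power2_eq_square)
    finally have "int (q + 1) \<le> \<bar>- 6\<bar>" by (rule dvd_int_bound) simp
    then show False using q_ge by simp
  next
    case False
    then have t2: "t = 2 * q" using point_types[OF t P0] by blast
    have kq: "int k = int q ^ 2 - int q + 2" using kt t2 by simp
    let ?A = "\<lambda>P. card {E \<in> planes_at P. m E = 0} = 0 \<and> card {E \<in> planes_at P. m E = 1} = 2 * q - 1"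
    let ?B = "\<lambda>P. card {E \<in> planes_at P. m E = 0} = q - 1 \<and> card {E \<in> planes_at P. m E = 1} = 0"
    have AB: "?A P \<or> ?B P" if "P \<in> K" for P using point_types[OF t that] False by blast
    \<comment> \<open>The two types with \<open>t = 2 q\<close> cannot coexist: on the secant
      \<open>P Q\<close> the type of \<open>P\<close> excludes \<open>m = 0\<close> and that of
      \<open>Q\<close> excludes \<open>m = 1\<close>, so the \<open>q + 1\<close> planes would
      contribute at least \<open>2 q + 2 > t\<close>.\<close>
    have mixed: False if PQ: "P \<in> K" "?A P" "Q \<in> K" "?B Q" for P Q
    proof -
      have "P \<noteq> Q"
      proof
        assume "P = Q"
        then have "q - 1 = 0" using conjunct1[OF PQ(2)] conjunct1[OF PQ(4)] by metis
        then show False using q_ge by simp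
      qed
      then obtain s where s: "s \<in> Lns" "P \<in> s" "Q \<in> s" using line_ex PQ K_pts by blast
      have "Q \<in> s \<inter> K" using s PQ(3) by blast
      then have "s \<notin> tans P" using \<open>P \<noteq> Q\<close> tans_K_iff[OF PQ(1)] by (metis singletonD)
      then have sec: "s \<in> secs P" using tans_or_secs[OF PQ(1)] s(1,2) by (simp add: lines_at_def)
      have "2 \<le> m E" if E: "E \<in> planes_on s" for E
      proof -
        have at: "E \<in> planes_at P" "E \<in> planes_at Q" using E s by (auto simp: planes_on_def planes_at_def)
        have "m E \<noteq> 0" using PQ(2) at(1) by auto
        moreover have "m E \<noteq> 1" using PQ(4) at(2) by auto
        ultimately show ?thesis by linarith
      qed
      then have "(\<Sum>E\<in>planes_on s. 2) \<le> (\<Sum>E\<in>planes_on s. m E)" by (intro sum_mono) auto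
      then show False using sum_m_secant[OF PQ(1) sec] card_planes_on[OF s(1)] t2 by simp
    qed
    show False
    proof (cases "?A P0")
      case True
      then have "card {E \<in> planes_at P. m E = 1} = 2 * q - 1" if "P \<in> K" for P
        using AB[OF that] mixed[OF P0 True that] by blast
      from count_planes[OF this] have "(q + 1) dvd k * (2 * q - 1)" using q_ge by simp
      then have "int (q + 1) dvd int k * (2 * int q - 1)" unfolding q1(2)[symmetric] of_nat_mult[symmetric] int_dvd_int_iff .
      also have "int k * (2 * int q - 1) = int (q + 1) * (2 * int q ^ 2 - 5 * int q + 10) + (- 12)"
        unfolding kq by (simp add: algebra_simps power2_eq_square)
      finally have "int (q + 1) \<le> \<bar>- 12\<bar>" by (rule dvd_int_bound) simp
      then show False using q_ge by simp
    next
      case False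
      then have "?B P0" using AB[OF P0] by blast
      then have "card {E \<in> planes_at P. m E = 0} = q - 1" if "P \<in> K" for P
        using AB[OF that] mixed[OF that _ P0] by blast
      from count_planes[OF this] have "(q + 2) dvd k * (q - 1)" by simp
      then have "int (q + 2) dvd int k * (int q - 1)" unfolding q1(1)[symmetric] of_nat_mult[symmetric] int_dvd_int_iff .
      also have "int k * (int q - 1) = int (q + 2) * (int q ^ 2 - 4 * int q + 11) + (- 24)"
        unfolding kq by (simp add: algebra_simps power2_eq_square)
      finally have "int (q + 2) \<le> \<bar>- 24\<bar>" by (rule dvd_int_bound) simp
      then show False using q_ge by simp
    qed
  qed
qed

lemma large_cap: "k = q^2 + 1" "E \<in> Pls \<Longrightarrow> a E \<le> q + 1"
proof -
  have s: "real t < 1.02 * real q" using large_case window by force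
  show "k = q^2 + 1" using small_case(1)[OF s] k_t by simp
  show "E \<in> Pls \<Longrightarrow> a E \<le> q + 1" by (rule small_case(2)[OF s])
qed

text \<open>On a tangent at most \<open>3 r < q + 1\<close> planes are not nice. This supplies a
  planar hyperoval, from which a second complete cap is grown later, without an algebraic
  construction.\<close>

lemma hyperoval_plane: "\<exists>E\<in>Pls. \<exists>H\<subseteq>E. card H = q + 2 \<and> (\<forall>L\<in>Lns. card (L \<inter> H) \<le> 2)"
proof -
  obtain P where P: "P \<in> K" using K_nonempty by blast
  obtain l where l: "l \<in> tans P" using tangent_ex[OF P] by blast
  have l': "l \<in> Lns" using l by (auto simp: tans_def lines_at_def)
  have "\<exists>E\<in>planes_on l. nice E"
  proof (rule ccontr)
    assume "\<not> ?thesis"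
    then have "{E \<in> planes_on l. \<not> nice E} = planes_on l" by auto
    then have "real q + 1 \<le> 3 * r" using card_not_nice_le[OF P l] card_planes_on[OF l'] by simp
    then show False using r_le q_ge' by simp
  qed
  then obtain E where "E \<in> Pls" "nice E" by (auto simp: planes_on_def)
  then show ?thesis using hyp by metis
qed

end

section \<open>Projective geometry of a finite vector space\<close>

text \<open>Otherwise the pairs \<open>{x, - x}\<close> partition the nonzero elements, and the
  field has odd order.\<close>

lemma char_2_of_even_card:
  assumes "even CARD('f::{field,finite})"
  shows "(2::'f) = 0"
proof (rule ccontr)
  assume 2: "(2::'f) \<noteq> 0"
  have ne: "- x \<noteq> x" if "x \<noteq> 0" for x :: 'f
  proof
    assume "- x = x"
    then have "2 * x = 0" by (metis add.right_inverse mult_2)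
    then show False using that 2 by simp
  qed
  let ?C = "(\<lambda>x::'f. {x, - x}) ` (UNIV - {0})"
  have "2 dvd card (\<Union>?C)"
  proof (rule dvd_partition)
    show "\<forall>c\<in>?C. 2 dvd card c" using ne by (auto simp: card_insert_if)
    show "\<forall>c1\<in>?C. \<forall>c2\<in>?C. c1 \<noteq> c2 \<longrightarrow> c1 \<inter> c2 = {}" by auto
  qed simp
  moreover have "\<Union>?C = UNIV - {0}" by auto
  ultimately have "even (CARD('f) - 1)" by (simp add: card_Diff_singleton)
  moreover have "CARD('f) \<ge> 1" by (simp add: Suc_leI)
  ultimately show False using assms by simp
qed

lemma card_span_independent:
  fixes B :: "('f::{field,finite} ^ 'n::finite) set"
  assumes "vec.independent B"
  shows "card (vec.span B) = CARD('f) ^ card B"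
proof -
  have "finite B" by simp
  then show ?thesis using assms
  proof (induction B rule: finite_induct)
    case (insert b B)
    have b: "b \<notin> vec.span B" and B: "vec.independent B"
      using insert.prems insert.hyps by (simp_all add: vec.independent_insert)
    let ?f = "\<lambda>(c, y). c *s b + y"
    have "bij_betw ?f (UNIV \<times> vec.span B) (vec.span (insert b B))"
    proof (rule bij_betw_imageI)
      show "inj_on ?f (UNIV \<times> vec.span B)"
      proof (rule inj_onI, clarify)
        fix c y c' y' assume y: "y \<in> vec.span B" "y' \<in> vec.span B" and eq: "c *s b + y = c' *s b + y'"
        have "c = c'"
        proof (rule ccontr)
          assume "c \<noteq> c'"
          have "(c - c') *s b = y' - y" using eq by (simp add: vec.scale_left_diff_distrib algebra_simps)
          then have "inverse (c - c') *s ((c - c') *s b) \<in> vec.span B"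
            using y by (simp add: vec.span_diff vec.span_scale)
          then show False using b \<open>c \<noteq> c'\<close> by (simp add: vec.scale_scale)
        qed
        then show "c = c' \<and> y = y'" using eq by simp
      qed
      show "?f ` (UNIV \<times> vec.span B) = vec.span (insert b B)"
      proof (intro equalityI subsetI)
        fix x assume "x \<in> vec.span (insert b B)"
        then obtain c where "x - c *s b \<in> vec.span B" by (auto simp: vec.span_insert)
        then show "x \<in> ?f ` (UNIV \<times> vec.span B)"
          by (intro image_eqI[where x="(c, x - c *s b)"]) auto
      next
        fix x assume "x \<in> ?f ` (UNIV \<times> vec.span B)"
        then obtain c y where "x = c *s b + y" "y \<in> vec.span B" by auto
        then have "x - c *s b \<in> vec.span B" by simp
        then show "x \<in> vec.span (insert b B)" by (auto simp: vec.span_insert)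
      qed
    qed
    then have "card (vec.span (insert b B)) = card ((UNIV :: 'f set) \<times> vec.span B)"
      by (metis bij_betw_same_card)
    then show ?case using insert.IH[OF B] insert.hyps by (simp add: card_cartesian_product)
  qed simp
qed

lemma card_subspace:
  fixes W :: "('f::{field,finite} ^ 'n::finite) set"
  assumes "vec.subspace W"
  shows "card W = CARD('f) ^ vec.dim W"
proof -
  obtain B where B: "B \<subseteq> W" "vec.independent B" "W \<subseteq> vec.span B" "card B = vec.dim W"
    using vec.basis_exists by blast
  then have "vec.span B = W" using assms by (intro vec.span_subspace)
  then show ?thesis using card_span_independent[OF B(2)] B(4) by simp
qed

text \<open>Passage from a vector subspace to the set of its projective points, the form in which
  lines and planes enter \<open>pg3\<close>.\<close>

definition pts :: "('f::field ^ 'n::finite) set \<Rightarrow> ('f ^ 'n) set set" where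
  "pts W = {P \<in> pg_points. P \<subseteq> W}"

lemma pg_point_span: "v \<noteq> 0 \<Longrightarrow> vec.span {v} \<in> pg_points"
  by (simp add: pg_points_def vec.dim_span)

lemma pg_pointE:
  assumes "P \<in> pg_points"
  obtains v where "v \<noteq> 0" "P = vec.span {v}"
proof -
  have P: "vec.subspace P" "vec.dim P = 1" using assms by (auto simp: pg_points_def)
  obtain v where v: "v \<in> P" "v \<noteq> 0"
  proof -
    have "\<not> P \<subseteq> {0}" using P(2) by (metis vec.dim_eq_0 zero_neq_one)
    then show ?thesis using that by blast
  qed
  have "vec.span {v} = P"
    by (rule vec.subspace_dim_equal) (use P v in \<open>auto simp: vec.span_minimal\<close>)
  then show ?thesis using that v by blast
qed

lemma pg_point_eq:
  assumes "P \<in> pg_points" "v \<in> P" "v \<noteq> 0"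
  shows "P = vec.span {v}"
proof -
  have P: "vec.subspace P" "vec.dim P = 1" using assms by (auto simp: pg_points_def)
  have "vec.span {v} = P"
    by (rule vec.subspace_dim_equal) (use P assms in \<open>auto simp: vec.span_minimal\<close>)
  then show ?thesis by simp
qed

lemma span_in_pts: "vec.subspace W \<Longrightarrow> v \<noteq> 0 \<Longrightarrow> vec.span {v} \<in> pts W \<longleftrightarrow> v \<in> W"
  using pg_point_span[of v] vec.span_base[of v "{v}"] vec.span_minimal[of "{v}" W] by (auto simp: pts_def)

lemma pts_mono_iff:
  assumes "vec.subspace W" "vec.subspace W'"
  shows "pts W \<subseteq> pts W' \<longleftrightarrow> W \<subseteq> W'"
proof
  assume sub: "pts W \<subseteq> pts W'"
  show "W \<subseteq> W'"
  proof
    fix v assume v: "v \<in> W"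
    show "v \<in> W'"
    proof (cases "v = 0")
      case False
      then show ?thesis using sub v span_in_pts[OF assms(1) False] span_in_pts[OF assms(2) False] by auto
    qed (use assms vec.subspace_0 in auto)
  qed
qed (auto simp: pts_def)

lemma pts_Int: "pts W \<inter> pts W' = pts (W \<inter> W')" by (auto simp: pts_def)

text \<open>The nonzero vectors of \<open>W\<close> are partitioned by the points,
  \<open>q - 1\<close> on each; the product form avoids a division.\<close>

lemma card_pts:
  fixes W :: "('f::{field,finite} ^ 'n::finite) set"
  assumes "vec.subspace W"
  shows "card (pts W) * (CARD('f) - 1) = CARD('f) ^ vec.dim W - 1"
proof -
  have "(\<Sum>P\<in>pts W. card {x\<in>W - {0}. x \<in> P}) = card (W - {0})"
  proof (rule sum_card_unique)
    fix x assume x: "x \<in> W - {0}"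
    then have "vec.span {x} \<in> pts W" using span_in_pts[OF assms] by simp
    moreover have "P = vec.span {x}" if "P \<in> pts W" "x \<in> P" for P
      using pg_point_eq[of P x] that x by (simp add: pts_def)
    ultimately show "\<exists>!P. P \<in> pts W \<and> x \<in> P" using vec.span_base[of x "{x}"] by blast
  qed simp_all
  moreover have "card {x\<in>W - {0}. x \<in> P} = CARD('f) - 1" if P: "P \<in> pts W" for P
  proof -
    have P': "vec.subspace P" "vec.dim P = 1" "P \<subseteq> W" using P by (auto simp: pts_def pg_points_def)
    have "{x\<in>W - {0}. x \<in> P} = P - {0}" using P' by auto
    then show ?thesis using card_subspace[OF P'(1)] P' vec.subspace_0[OF P'(1)] by (simp add: card_Diff_singleton)
  qed
  moreover have "card (W - {0}) = CARD('f) ^ vec.dim W - 1"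
    using card_subspace[OF assms] vec.subspace_0[OF assms] by (simp add: card_Diff_singleton)
  ultimately show ?thesis by simp
qed

lemma span_pair:
  fixes v w :: "'f::field ^ 'n::finite"
  assumes "vec.subspace W" "vec.dim W = 2" "v \<in> W" "w \<in> W" "v \<noteq> 0" "vec.span {v} \<noteq> vec.span {w}" "w \<noteq> 0"
  shows "W = vec.span {v, w}"
proof -
  have "w \<notin> vec.span {v}"
    using pg_point_eq[OF pg_point_span[OF assms(5)], of w] assms by metis
  then have "vec.dim {w, v} = 2" using assms by (simp add: vec.dim_insert)
  then have d: "vec.dim (vec.span {v, w}) = 2" by (simp add: vec.dim_span insert_commute)
  have "vec.span {v, w} = W"
    by (rule vec.subspace_dim_equal) (use assms d in \<open>auto simp: vec.span_minimal\<close>)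
  then show ?thesis by simp
qed

lemma line_through:
  fixes v w :: "'f::field ^ 'n::finite"
  assumes "v \<noteq> 0" "w \<noteq> 0" "vec.span {v} \<noteq> vec.span {w}"
  shows "vec.subspace (vec.span {v, w}) \<and> vec.dim (vec.span {v, w}) = 2"
proof -
  have "w \<notin> vec.span {v}"
    using pg_point_eq[OF pg_point_span[OF assms(1)], of w] assms by metis
  then have "vec.dim {w, v} = 2" using assms by (simp add: vec.dim_insert)
  then show ?thesis by (simp add: vec.dim_span insert_commute)
qed

lemma dim_Int_ge:
  fixes S T U :: "('f::field ^ 'n::finite) set"
  assumes "vec.subspace S" "vec.subspace T" "vec.subspace U" "S \<subseteq> U" "T \<subseteq> U"
  shows "vec.dim S + vec.dim T \<le> vec.dim U + vec.dim (S \<inter> T)"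
proof -
  have "{x + y |x y. x \<in> S \<and> y \<in> T} \<subseteq> U" using assms vec.subspace_add by blast
  then have "vec.dim {x + y |x y. x \<in> S \<and> y \<in> T} \<le> vec.dim U" by (rule vec.dim_subset)
  then show ?thesis using vec.dim_sums_Int[OF assms(1,2)] by simp
qed

definition pg_line_sets :: "('f::field ^ 'n::finite) set set set" where
  "pg_line_sets = pts ` pg_lines"

definition pg_plane_sets :: "('f::field ^ 'n::finite) set set set" where
  "pg_plane_sets = pts ` {W. vec.subspace W \<and> vec.dim W = 3}"

lemma pg3_axioms:
  "pg3 CARD('f) (pg_points :: ('f::{field,finite} ^ 4) set set) pg_line_sets pg_plane_sets"
proof
  let ?q = "CARD('f)"
  have "card {0, 1 :: 'f} \<le> ?q" by (rule card_mono) auto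
  then have q2: "?q \<ge> 2" by simp
  then show "?q > 0" by simp
  \<comment> \<open>Writing \<open>q = s + 2\<close> removes the truncated subtraction from the
    counts of points.\<close>
  obtain s where s: "?q = s + 2" using q2 by (metis add.commute le_Suc_ex)
  have c: "card (pts W) = ?q ^ 2 + ?q + 1" if "vec.subspace W" "vec.dim W = 3" for W :: "('f^4) set"
  proof -
    have "card (pts W) * (s + 1) = (s + 2) ^ 3 - 1" using card_pts[OF that(1)] that(2) s by simp
    also have "\<dots> = ((s + 2)^2 + (s + 2) + 1) * (s + 1)" by (simp add: power2_eq_square power3_eq_cube algebra_simps)
    finally show ?thesis unfolding s mult_cancel2 by simp
  qed
  have c2: "card (pts W) = ?q + 1" if "vec.subspace W" "vec.dim W = 2" for W :: "('f^4) set"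
  proof -
    have "card (pts W) * (s + 1) = (s + 2) ^ 2 - 1" using card_pts[OF that(1)] that(2) s by simp
    also have "\<dots> = ((s + 2) + 1) * (s + 1)" by (simp add: power2_eq_square algebra_simps)
    finally show ?thesis unfolding s mult_cancel2 by simp
  qed
  show "card (pg_points :: ('f^4) set set) = ?q^3 + ?q^2 + ?q + 1"
  proof -
    have "(pg_points :: ('f^4) set set) = pts UNIV" by (auto simp: pts_def)
    moreover have "vec.dim (UNIV :: ('f^4) set) = 4" by (simp add: vec.dim_UNIV card_cart_basis)
    ultimately have "card (pg_points :: ('f^4) set set) * (s + 1) = (s + 2) ^ 4 - 1"
      using card_pts[of "UNIV :: ('f^4) set"] s by simp
    also have "\<dots> = ((s + 2)^3 + (s + 2)^2 + (s + 2) + 1) * (s + 1)"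
      by (simp add: power2_eq_square power3_eq_cube power4_eq_xxxx algebra_simps)
    finally show ?thesis unfolding s mult_cancel2 by simp
  qed
  show "L \<subseteq> pg_points" "card L = ?q + 1" if "L \<in> pg_line_sets" for L :: "('f^4) set set"
    using that c2 by (auto simp: pg_line_sets_def pts_def pg_lines_def)
  show "E \<subseteq> pg_points" "card E = ?q^2 + ?q + 1" if "E \<in> pg_plane_sets" for E :: "('f^4) set set"
    using that c by (auto simp: pg_plane_sets_def pts_def)
  show "\<exists>L\<in>pg_line_sets. P \<in> L \<and> Q \<in> L" if PQ: "P \<in> pg_points" "Q \<in> pg_points" "P \<noteq> Q" for P Q :: "('f^4) set"
  proof -
    obtain v w where vw: "v \<noteq> 0" "P = vec.span {v}" "w \<noteq> 0" "Q = vec.span {w}"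
      using PQ pg_pointE by metis
    have W: "vec.subspace (vec.span {v, w})" "vec.dim (vec.span {v, w}) = 2"
      using line_through[of v w] vw PQ(3) by auto
    have "P \<in> pts (vec.span {v, w})" "Q \<in> pts (vec.span {v, w})"
      using vw span_in_pts[OF W(1)] vec.span_base[of _ "{v, w}"] by auto
    then show ?thesis using W by (auto simp: pg_line_sets_def pg_lines_def)
  qed
  show "L = L'" if L: "L \<in> pg_line_sets" "L' \<in> pg_line_sets" "P \<in> L" "Q \<in> L" "P \<in> L'" "Q \<in> L'" "P \<noteq> Q"
    for L L' and P Q :: "('f^4) set"
  proof -
    obtain W W' where W: "L = pts W" "vec.subspace W" "vec.dim W = 2" "L' = pts W'" "vec.subspace W'" "vec.dim W' = 2"
      using L by (auto simp: pg_line_sets_def pg_lines_def)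
    obtain v w where vw: "v \<noteq> 0" "P = vec.span {v}" "w \<noteq> 0" "Q = vec.span {w}"
      using L W by (auto simp: pts_def elim!: pg_pointE)
    have "v \<in> W" "w \<in> W" "v \<in> W'" "w \<in> W'" using L vw W span_in_pts by metis+
    then have "W = vec.span {v, w}" "W' = vec.span {v, w}" using span_pair vw W L(7) by metis+
    then show ?thesis using W by simp
  qed
  show "\<exists>E\<in>pg_plane_sets. L \<subseteq> E \<and> P \<in> E" if L: "L \<in> pg_line_sets" "P \<in> pg_points" "P \<notin> L"
    for L and P :: "('f^4) set"
  proof -
    obtain W where W: "L = pts W" "vec.subspace W" "vec.dim W = 2"
      using L by (auto simp: pg_line_sets_def pg_lines_def)
    obtain v where v: "v \<noteq> 0" "P = vec.span {v}" using L pg_pointE by metis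
    have "v \<notin> W" using L v W span_in_pts by metis
    moreover have sp: "vec.span W = W" using W(2) by (simp only: vec.span_eq_iff)
    ultimately have "v \<notin> vec.span W" by metis
    then have d: "vec.dim (vec.span (insert v W)) = 3"
      using W(3) by (simp add: vec.dim_insert)
    have "W \<subseteq> vec.span (insert v W)" "v \<in> vec.span (insert v W)" using vec.span_superset[of "insert v W"] by auto
    then have "L \<subseteq> pts (vec.span (insert v W))" "P \<in> pts (vec.span (insert v W))"
      using v W pts_mono_iff[of W] span_in_pts[of _ v] by auto
    then show ?thesis using d by (auto simp: pg_plane_sets_def)
  qed
  show "L \<subseteq> E" if L: "E \<in> pg_plane_sets" "L \<in> pg_line_sets" "P \<in> E" "Q \<in> E" "P \<in> L" "Q \<in> L" "P \<noteq> Q"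
    for L E and P Q :: "('f^4) set"
  proof -
    obtain W where W: "L = pts W" "vec.subspace W" "vec.dim W = 2"
      using L by (auto simp: pg_line_sets_def pg_lines_def)
    obtain U where U: "E = pts U" "vec.subspace U" using L by (auto simp: pg_plane_sets_def)
    obtain v w where vw: "v \<noteq> 0" "P = vec.span {v}" "w \<noteq> 0" "Q = vec.span {w}"
      using L W by (auto simp: pts_def elim!: pg_pointE)
    have m: "v \<in> W" "w \<in> W" "v \<in> U" "w \<in> U" using L vw W U span_in_pts by metis+
    then have "W = vec.span {v, w}" using span_pair vw W L(7) by metis
    then have "W \<subseteq> U" using m U by (simp add: vec.span_minimal)
    then show ?thesis using W U by (simp add: pts_mono_iff)
  qed
  show "E \<inter> E' \<in> pg_line_sets" if E: "E \<in> pg_plane_sets" "E' \<in> pg_plane_sets" "E \<noteq> E'" for E E' :: "('f^4) set set"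
  proof -
    obtain U U' where U: "E = pts U" "vec.subspace U" "vec.dim U = 3" "E' = pts U'" "vec.subspace U'" "vec.dim U' = 3"
      using E by (auto simp: pg_plane_sets_def)
    have s: "vec.subspace (U \<inter> U')" using U by (intro vec.subspace_inter)
    have "vec.dim (UNIV :: ('f^4) set) = 4" by (simp add: vec.dim_UNIV card_cart_basis)
    then have "vec.dim (U \<inter> U') \<ge> 2" using dim_Int_ge[of U U' UNIV] U by simp
    moreover have "vec.dim (U \<inter> U') < 3"
    proof (rule ccontr)
      assume "\<not> vec.dim (U \<inter> U') < 3"
      then have d: "vec.dim (U \<inter> U') \<ge> 3" by simp
      have "U \<inter> U' = U" by (rule vec.subspace_dim_equal) (use U s d in simp_all)
      moreover have "U \<inter> U' = U'" by (rule vec.subspace_dim_equal) (use U s d in simp_all)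
      ultimately have "U = U'" by metis
      then show False using E U by auto
    qed
    ultimately have "vec.dim (U \<inter> U') = 2" by simp
    then show ?thesis using s U by (auto simp: pg_line_sets_def pg_lines_def pts_Int)
  qed
  show "L \<inter> L' \<noteq> {}" if L: "E \<in> pg_plane_sets" "L \<in> pg_line_sets" "L' \<in> pg_line_sets" "L \<subseteq> E" "L' \<subseteq> E"
    for E L L' :: "('f^4) set set"
  proof -
    obtain W W' where W: "L = pts W" "vec.subspace W" "vec.dim W = 2" "L' = pts W'" "vec.subspace W'" "vec.dim W' = 2"
      using L by (auto simp: pg_line_sets_def pg_lines_def)
    obtain U where U: "E = pts U" "vec.subspace U" "vec.dim U = 3" using L by (auto simp: pg_plane_sets_def)
    have "vec.dim (W \<inter> W') \<ge> 1" using dim_Int_ge[of W W' U] U W L(4,5) pts_mono_iff[of W U] pts_mono_iff[of W' U] by simp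
    then have "\<not> W \<inter> W' \<subseteq> {0}" by (metis not_one_le_zero vec.dim_eq_0)
    then obtain v where "v \<in> W" "v \<in> W'" "v \<noteq> 0" by blast
    then have "vec.span {v} \<in> L \<inter> L'" using W span_in_pts by auto
    then show ?thesis by blast
  qed
qed

section \<open>Coordinates in a plane and the extension theorem there\<close>

lemma in_span_pair: "x \<in> vec.span {v, w} \<longleftrightarrow> (\<exists>c d. x = c *s v + d *s w)"
  for v w :: "'f::field ^ 'n::finite"
proof
  assume "x \<in> vec.span {v, w}"
  then obtain c where "x - c *s v \<in> vec.span {w}" by (auto simp: vec.span_insert[of v "{w}"])
  then obtain d where "x - c *s v = d *s w" by (auto simp: vec.span_singleton)
  then have "x = c *s v + d *s w" by (simp add: algebra_simps)
  then show "\<exists>c d. x = c *s v + d *s w" by blast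
next
  assume "\<exists>c d. x = c *s v + d *s w"
  then obtain c d where "x = c *s v + d *s w" by blast
  moreover have "v \<in> vec.span {v, w}" "w \<in> vec.span {v, w}" by (simp_all add: vec.span_base)
  ultimately show "x \<in> vec.span {v, w}" by (simp add: vec.span_add vec.span_scale)
qed

lemma plane_coordinates:
  fixes W :: "('f::{field,finite} ^ 'n::finite) set"
  assumes "vec.subspace W" "vec.dim W = 3"
  shows "\<exists>\<phi> :: 'f \<times> 'f \<times> 'f \<Rightarrow> 'f ^ 'n. inj \<phi> \<and> range \<phi> = W \<and>
    (\<forall>u v. \<phi> (u + v) = \<phi> u + \<phi> v) \<and> (\<forall>c u. \<phi> (smul c u) = c *s \<phi> u)"
proof -
  obtain B where B: "B \<subseteq> W" "vec.independent B" "W \<subseteq> vec.span B" "card B = vec.dim W"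
    using vec.basis_exists by blast
  then obtain b1 b2 b3 where b: "B = {b1, b2, b3}" using assms(2) by (auto simp: card_3_iff)
  define \<phi> where "\<phi> = (\<lambda>(x, y, z). x *s b1 + y *s b2 + z *s b3)"
  have "range \<phi> \<subseteq> W"
    using B(1) b assms(1) by (auto simp: \<phi>_def intro!: vec.subspace_add vec.subspace_scale)
  moreover have "W \<subseteq> range \<phi>"
  proof
    fix x assume "x \<in> W"
    then have "x \<in> vec.span {b1, b2, b3}" using B b by auto
    then obtain c where "x - c *s b1 \<in> vec.span {b2, b3}" by (auto simp: vec.span_insert[of b1 "{b2, b3}"])
    then obtain d e where "x - c *s b1 = d *s b2 + e *s b3" by (auto simp: in_span_pair)
    then have "x = \<phi> (c, d, e)" by (simp add: \<phi>_def algebra_simps)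
    then show "x \<in> range \<phi>" by blast
  qed
  ultimately have r: "range \<phi> = W" by blast
  \<comment> \<open>Injectivity comes from counting: domain and range both have \<open>q^3\<close>
    elements.\<close>
  have "card (range \<phi>) = card (UNIV :: ('f \<times> 'f \<times> 'f) set)"
    unfolding r using card_subspace[OF assms(1)] assms(2) by (simp add: power3_eq_cube)
  then have "inj \<phi>" by (intro eq_card_imp_inj_on) auto
  moreover have "\<phi> (u + v) = \<phi> u + \<phi> v" for u v
    by (cases u; cases v) (simp add: \<phi>_def vec.scale_left_distrib algebra_simps)
  moreover have "\<phi> (smul c u) = c *s \<phi> u" for c u
    by (cases u) (simp add: \<phi>_def vec.scale_right_distrib vec.scale_scale)
  ultimately show ?thesis using r by blast
qed

lemma triple_det_eq_0_imp_comb: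
  fixes P Q R :: "'f::field \<times> 'f \<times> 'f"
  assumes "triple_det P Q R = 0" "cross P Q \<noteq> 0"
  shows "\<exists>c d. R = smul c P + smul d Q"
proof -
  obtain X where X: "triple_det P Q X \<noteq> 0" using ex_dot_nonzero[OF assms(2)] by (auto simp: triple_det_def)
  have "smul (triple_det P Q X) R = smul (triple_det R Q X) P + smul (triple_det P R X) Q"
    using cramer_primal[of P Q X R] assms(1) by simp
  then have "smul (1 / triple_det P Q X) (smul (triple_det P Q X) R) =
      smul (1 / triple_det P Q X) (smul (triple_det R Q X) P + smul (triple_det P R X) Q)" by simp
  then have "R = smul (1 / triple_det P Q X * triple_det R Q X) P + smul (1 / triple_det P Q X * triple_det P R X) Q"
    using X by (simp only: smul_smul smul_add times_divide_eq_left mult_1_left divide_self_if if_False smul_one)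
  then show ?thesis by blast
qed

lemma triple_det_comb: "triple_det P Q (smul c P + smul d Q) = 0"
  by (simp add: triple_det_def dot_add dot_smul)

lemma plane_arc_extension:
  fixes A :: "('f::{field,finite} ^ 4) set set"
  assumes even: "even CARD('f)" and q: "CARD('f) \<ge> 2048"
    and E: "E \<in> pg_plane_sets" and AE: "A \<subseteq> E"
    and arc: "\<And>L. L \<in> pg_line_sets \<Longrightarrow> card (L \<inter> A) \<le> 2"
    and card: "card A + n = CARD('f) + 2" and n1: "n \<ge> 1" and n2: "n * (n - 1) < CARD('f)"
  shows "\<exists>N\<in>E - A. \<forall>L\<in>pg_line_sets. card (L \<inter> insert N A) \<le> 2"
proof -
  obtain W where W: "E = pts W" "vec.subspace W" "vec.dim W = 3" using E by (auto simp: pg_plane_sets_def)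
  obtain \<phi> :: "'f \<times> 'f \<times> 'f \<Rightarrow> 'f ^ 4" where inj: "inj \<phi>" and r: "range \<phi> = W"
    and add: "\<And>u v. \<phi> (u + v) = \<phi> u + \<phi> v" and scale: "\<And>c u. \<phi> (smul c u) = c *s \<phi> u"
    using plane_coordinates[OF W(2,3)] by blast
  have \<phi>0: "\<phi> u = 0 \<longleftrightarrow> u = 0" for u
  proof -
    have "\<phi> 0 = 0" using scale[of 0 0] by simp
    then show ?thesis using inj by (metis injD)
  qed
  define T where "T = (\<lambda>P. SOME u. u \<noteq> 0 \<and> P = vec.span {\<phi> u})"
  have T: "T P \<noteq> 0 \<and> P = vec.span {\<phi> (T P)}" if P: "P \<in> A" for P
  proof -
    have P': "P \<in> pg_points" "P \<subseteq> W" using P AE W by (auto simp: pts_def)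
    then obtain v where v: "v \<noteq> 0" "P = vec.span {v}" using pg_pointE by blast
    then have "v \<in> W" using P'(2) vec.span_base[of v "{v}"] by auto
    then obtain u where "v = \<phi> u" using r by blast
    then have "\<exists>u. u \<noteq> 0 \<and> P = vec.span {\<phi> u}" using v \<phi>0 by blast
    then show ?thesis unfolding T_def by (rule someI_ex)
  qed
  have T0: "\<phi> (T P) \<noteq> 0" if "P \<in> A" for P using T[OF that] \<phi>0 by blast
  have injT: "inj_on T A" by (rule inj_onI) (metis T)
  have cr: "cross (T P) (T Q) \<noteq> 0" if PQ: "P \<in> A" "Q \<in> A" "P \<noteq> Q" for P Q
  proof
    assume "cross (T P) (T Q) = 0"
    then obtain s where "T Q = smul s (T P)" using cross_eq_0_imp_proportional T[OF PQ(1)] by blast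
    then have "\<phi> (T Q) \<in> P" using T[OF PQ(1)] scale by (metis vec.span_base vec.span_scale singletonI)
    then have "P = vec.span {\<phi> (T Q)}" using pg_point_eq T0 PQ AE W by (auto simp: pts_def)
    then show False using T[OF PQ(2)] PQ(3) by simp
  qed
  have fA: "finite A" by (rule finite_subset[OF subset_UNIV]) simp
  have line: "pts (vec.span {\<phi> (T P), \<phi> (T Q)}) \<in> pg_line_sets"
    "P \<in> pts (vec.span {\<phi> (T P), \<phi> (T Q)})" "Q \<in> pts (vec.span {\<phi> (T P), \<phi> (T Q)})"
    if PQ: "P \<in> A" "Q \<in> A" "P \<noteq> Q" for P Q
  proof -
    have l: "vec.subspace (vec.span {\<phi> (T P), \<phi> (T Q)}) \<and> vec.dim (vec.span {\<phi> (T P), \<phi> (T Q)}) = 2"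
      by (rule line_through) (use T0 T PQ in metis)+
    then show "pts (vec.span {\<phi> (T P), \<phi> (T Q)}) \<in> pg_line_sets"
      by (auto simp: pg_line_sets_def pg_lines_def)
    show "P \<in> pts (vec.span {\<phi> (T P), \<phi> (T Q)})"
      using span_in_pts[of "vec.span {\<phi> (T P), \<phi> (T Q)}" "\<phi> (T P)"] l T0[OF PQ(1)] T[OF PQ(1)]
        vec.span_base[of "\<phi> (T P)" "{\<phi> (T P), \<phi> (T Q)}"] by auto
    show "Q \<in> pts (vec.span {\<phi> (T P), \<phi> (T Q)})"
      using span_in_pts[of "vec.span {\<phi> (T P), \<phi> (T Q)}" "\<phi> (T Q)"] l T0[OF PQ(2)] T[OF PQ(2)]
        vec.span_base[of "\<phi> (T Q)" "{\<phi> (T P), \<phi> (T Q)}"] by auto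
  qed
  have det: "triple_det (T P) (T Q) (T R) \<noteq> 0"
    if PQR: "P \<in> A" "Q \<in> A" "R \<in> A" "P \<noteq> Q" "P \<noteq> R" "Q \<noteq> R" for P Q R
  proof
    assume "triple_det (T P) (T Q) (T R) = 0"
    then obtain c d where "T R = smul c (T P) + smul d (T Q)"
      using triple_det_eq_0_imp_comb cr[OF PQR(1,2,4)] by blast
    then have "\<phi> (T R) \<in> vec.span {\<phi> (T P), \<phi> (T Q)}" by (auto simp: in_span_pair add scale)
    then have "R \<in> pts (vec.span {\<phi> (T P), \<phi> (T Q)})"
      using span_in_pts[of "vec.span {\<phi> (T P), \<phi> (T Q)}" "\<phi> (T R)"] T0[OF PQR(3)] T[OF PQR(3)] by auto
    then have "{P, Q, R} \<subseteq> pts (vec.span {\<phi> (T P), \<phi> (T Q)}) \<inter> A"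
      using line[OF PQR(1,2,4)] PQR by auto
    then have "card {P, Q, R} \<le> card (pts (vec.span {\<phi> (T P), \<phi> (T Q)}) \<inter> A)"
      using fA by (intro card_mono) auto
    then show False using arc[OF line(1)[OF PQR(1,2,4)]] PQR by simp
  qed
  \<comment> \<open>Needed for the locale assumption \<open>t_le\<close>: if \<open>2 n > q\<close>,
    then \<open>n >= 3\<close> and \<open>n (n - 1) >= 2 n > q\<close>.\<close>
  have n3: "2 * n \<le> CARD('f)"
  proof (rule ccontr)
    assume n: "\<not> 2 * n \<le> CARD('f)"
    then have "2 \<le> n - 1" using q by simp
    then have "2 * n \<le> (n - 1) * n" by (rule mult_le_mono1)
    then have "2 * n \<le> n * (n - 1)" by (simp only: mult.commute)
    then show False using n n2 by linarith
  qed
  have "even_arc (T ` A) n"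
  proof
    show "(2::'f) = 0" by (rule char_2_of_even_card[OF even])
    show "card (T ` A) + n = CARD('f) + 2" "n + 2 \<le> card (T ` A)"
      using card n3 by (simp_all add: card_image[OF injT])
    show "triple_det P Q R \<noteq> 0"
      if PQR: "P \<in> T ` A" "Q \<in> T ` A" "R \<in> T ` A" "P \<noteq> Q" "P \<noteq> R" "Q \<noteq> R" for P Q R
    proof -
      obtain P' Q' R' where "P = T P'" "Q = T Q'" "R = T R'" "P' \<in> A" "Q' \<in> A" "R' \<in> A"
        using PQR(1-3) by blast
      then show ?thesis using det PQR(4-6) by blast
    qed
  qed (rule n1)
  from even_arc.extension[OF this n2]
  obtain N where N': "\<forall>P\<in>T ` A. \<forall>Q\<in>T ` A. P \<noteq> Q \<longrightarrow> triple_det P Q N \<noteq> 0" by blast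
  have N: "triple_det (T P) (T Q) N \<noteq> 0" if "P \<in> A" "Q \<in> A" "P \<noteq> Q" for P Q
    using N' that inj_onD[OF injT, of P Q] by blast
  have cA: "card A \<ge> 2" using card n3 by simp
  have other: "\<exists>Q\<in>A. Q \<noteq> P" for P
  proof (rule ccontr)
    assume "\<not> ?thesis"
    then have "A \<subseteq> {P}" by auto
    then have "card A \<le> 1" using card_mono[of "{P}" A] by simp
    then show False using cA by simp
  qed
  have N0: "N \<noteq> 0"
  proof -
    obtain P where "P \<in> A" using other by blast
    moreover obtain Q where "Q \<in> A" "Q \<noteq> P" using other by blast
    ultimately have "triple_det (T P) (T Q) N \<noteq> 0" using N by blast
    then show ?thesis by (auto simp: triple_det_def)
  qed
  define M where "M = vec.span {\<phi> N}"
  have ME: "M \<in> E" unfolding M_def W(1) using span_in_pts[OF W(2), of "\<phi> N"] N0 \<phi>0 r by auto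
  have MA: "M \<notin> A"
  proof
    assume M: "M \<in> A"
    have "\<phi> N \<in> vec.span {\<phi> (T M)}" using T[OF M] vec.span_base[of "\<phi> N" "{\<phi> N}"] by (simp add: M_def)
    then obtain c where "\<phi> N = c *s \<phi> (T M)" by (auto simp: vec.span_singleton)
    then have "\<phi> N = \<phi> (smul c (T M))" by (simp only: scale)
    then have "N = smul c (T M)" using inj by (simp only: inj_eq)
    moreover obtain Q where "Q \<in> A" "Q \<noteq> M" using other by blast
    ultimately show False using N[of M Q] M by (simp add: triple_det_def dot_smul)
  qed
  have "card (L \<inter> insert M A) \<le> 2" if L: "L \<in> pg_line_sets" for L
  proof (cases "M \<in> L")
    case False
    then show ?thesis using arc[OF L] by simp
  next
    case True
    have "P = Q" if PQ: "P \<in> L \<inter> A" "Q \<in> L \<inter> A" for P Q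
    proof (rule ccontr)
      assume ne: "P \<noteq> Q"
      obtain U where U: "L = pts U" "vec.subspace U" "vec.dim U = 2"
        using L by (auto simp: pg_line_sets_def pg_lines_def)
      have "\<phi> (T P) \<in> U" "\<phi> (T Q) \<in> U"
        using PQ T T0 U span_in_pts[OF U(2)] by (metis IntD1 IntD2)+
      then have "U = vec.span {\<phi> (T P), \<phi> (T Q)}"
        using span_pair[OF U(2,3)] T T0 PQ ne by (metis IntD2)
      moreover have "\<phi> N \<in> U" using True U span_in_pts[OF U(2), of "\<phi> N"] N0 \<phi>0 by (simp add: M_def)
      ultimately obtain c d where "\<phi> N = c *s \<phi> (T P) + d *s \<phi> (T Q)" by (auto simp: in_span_pair)
      then have "\<phi> N = \<phi> (smul c (T P) + smul d (T Q))" by (simp only: add scale)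
      then have "N = smul c (T P) + smul d (T Q)" using inj by (simp only: inj_eq)
      then show False using N[of P Q] PQ ne by (simp only: triple_det_comb) blast
    qed
    then have "\<exists>P. L \<inter> A \<subseteq> {P}" by (cases "L \<inter> A = {}") blast+
    then obtain P where "insert M (L \<inter> A) \<subseteq> {M, P}" by blast
    then have "card (insert M (L \<inter> A)) \<le> card {M, P}" by (intro card_mono) auto
    also have "\<dots> \<le> 2" by (simp add: card_insert_if)
    finally have "card (insert M (L \<inter> A)) \<le> 2" .
    moreover have "L \<inter> insert M A = insert M (L \<inter> A)" using True by auto
    ultimately show ?thesis by simp
  qed
  then show ?thesis using ME MA by blast
qed

section \<open>Existence of caps\<close>

lemma is_cap_iff:
  fixes K :: "('f::{field,finite} ^ 4) set set"
  shows "is_cap k K \<longleftrightarrow> K \<subseteq> pg_points \<and> card K = k \<and> (\<forall>L\<in>pg_line_sets. card (L \<inter> K) \<le> 2)"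
proof -
  have fin: "finite X" for X :: "('f ^ 4) set set" by (rule finite_subset[OF subset_UNIV]) simp
  have eq: "(\<forall>P\<in>K. \<forall>Q\<in>K. \<forall>R\<in>K. P \<noteq> Q \<and> P \<noteq> R \<and> Q \<noteq> R \<longrightarrow> \<not> pg_collinear {P, Q, R}) \<longleftrightarrow>
    (\<forall>L\<in>pg_line_sets. card (L \<inter> K) \<le> 2)" if K: "K \<subseteq> pg_points"
  proof
    assume c: "\<forall>P\<in>K. \<forall>Q\<in>K. \<forall>R\<in>K. P \<noteq> Q \<and> P \<noteq> R \<and> Q \<noteq> R \<longrightarrow> \<not> pg_collinear {P, Q, R}"
    show "\<forall>L\<in>pg_line_sets. card (L \<inter> K) \<le> 2"
    proof (rule ballI, rule ccontr)
      fix L :: "('f ^ 4) set set" assume L: "L \<in> pg_line_sets" and "\<not> card (L \<inter> K) \<le> 2"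
      then obtain S where S: "S \<subseteq> L \<inter> K" "card S = 3"
        using obtain_subset_with_card_n[of 3 "L \<inter> K"] by force
      then obtain P Q R where PQR: "S = {P, Q, R}" "P \<noteq> Q" "P \<noteq> R" "Q \<noteq> R" by (auto simp: card_3_iff)
      have "pg_collinear {P, Q, R}"
        using L S PQR by (auto simp: pg_line_sets_def pg_collinear_def pts_def)
      moreover have "P \<in> K" "Q \<in> K" "R \<in> K" using S(1) PQR(1) by auto
      ultimately show False using c PQR(2-4) by blast
    qed
  next
    assume c: "\<forall>L\<in>pg_line_sets. card (L \<inter> K) \<le> 2"
    show "\<forall>P\<in>K. \<forall>Q\<in>K. \<forall>R\<in>K. P \<noteq> Q \<and> P \<noteq> R \<and> Q \<noteq> R \<longrightarrow> \<not> pg_collinear {P, Q, R}"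
    proof (intro ballI impI notI)
      fix P Q R assume PQR: "P \<in> K" "Q \<in> K" "R \<in> K" "P \<noteq> Q \<and> P \<noteq> R \<and> Q \<noteq> R" "pg_collinear {P, Q, R}"
      then obtain W where W: "W \<in> pg_lines" "P \<subseteq> W" "Q \<subseteq> W" "R \<subseteq> W" by (auto simp: pg_collinear_def)
      then have "{P, Q, R} \<subseteq> pts W \<inter> K" using PQR K by (auto simp: pts_def)
      then have "card {P, Q, R} \<le> card (pts W \<inter> K)" by (intro card_mono fin)
      moreover have "card (pts W \<inter> K) \<le> 2" using c W(1) by (simp add: pg_line_sets_def)
      ultimately show False using PQR(4) by simp
    qed
  qed
  show ?thesis
  proof (cases "K \<subseteq> pg_points")
    case True
    show ?thesis unfolding is_cap_def eq[OF True] using fin[of K] by blast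
  qed (simp add: is_cap_def)
qed

lemma complete_extension:
  fixes K :: "('f::{field,finite} ^ 4) set set"
  assumes "is_cap k K"
  shows "\<exists>k' K'. is_complete_cap k' K' \<and> K \<subseteq> K'"
proof -
  have fin: "finite X" for X :: "('f ^ 4) set set" by (rule finite_subset[OF subset_UNIV]) simp
  define Q where "Q = (\<lambda>K' :: ('f ^ 4) set set. K \<subseteq> K' \<and> is_cap (card K') K')"
  have "Q K" using assms by (auto simp: Q_def is_cap_def)
  moreover have "\<forall>K'. Q K' \<longrightarrow> card K' < Suc (card (UNIV :: ('f ^ 4) set set))"
    by (intro allI impI le_imp_less_Suc card_mono[OF fin subset_UNIV])
  ultimately obtain K' where K': "Q K'" "\<And>K''. Q K'' \<Longrightarrow> card K'' \<le> card K'"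
    using ex_has_greatest_nat[of Q K card "Suc (card (UNIV :: ('f ^ 4) set set))"] by blast
  have "is_complete_cap (card K') K'"
    unfolding is_complete_cap_def
  proof (intro conjI notI)
    show "is_cap (card K') K'" using K'(1) by (simp add: Q_def)
    assume "\<exists>K''. is_cap (card K' + 1) K'' \<and> K' \<subseteq> K''"
    then obtain K'' where K'': "is_cap (card K' + 1) K''" "K' \<subseteq> K''" by blast
    then have "card K'' = card K' + 1" by (simp add: is_cap_def)
    moreover from this have "Q K''" using K'' K'(1) by (auto simp: Q_def)
    ultimately show False using K'(2)[of K''] by simp
  qed
  then show ?thesis using K'(1) by (auto simp: Q_def)
qed

lemma pg3_even_axioms:
  assumes "even CARD('f::{field,finite})" "CARD('f) \<ge> 2048"
  shows "pg3_even CARD('f) (pg_points :: ('f ^ 4) set set) pg_line_sets pg_plane_sets"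
  unfolding pg3_even_def pg3_even_axioms_def
  using pg3_axioms[where 'f='f] plane_arc_extension[OF assms] assms(2) by blast

text \<open>Completeness turns into a secant through every outer point \<open>N\<close>: a line with
  three points of \<open>insert N K\<close> must contain \<open>N\<close> and two points of
  \<open>K\<close>.\<close>

lemma pg3_large_cap_axioms:
  fixes K :: "('f::{field,finite} ^ 4) set set"
  assumes ev: "even CARD('f)" and q: "CARD('f) \<ge> 2048" and K: "is_complete_cap k K"
    and k: "real k \<ge> (real CARD('f))^2 - 2 * real CARD('f) + 3 * sqrt (real CARD('f)) + 2"
  shows "pg3_large_cap CARD('f) (pg_points :: ('f ^ 4) set set) pg_line_sets pg_plane_sets K"
proof -
  have K': "K \<subseteq> pg_points" "card K = k" "\<And>L. L \<in> pg_line_sets \<Longrightarrow> card (L \<inter> K) \<le> 2"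
    using K by (auto simp: is_complete_cap_def is_cap_iff)
  have fin: "finite X" for X :: "('f ^ 4) set set" by (rule finite_subset[OF subset_UNIV]) simp
  interpret E: pg3_even "CARD('f)" "pg_points :: ('f ^ 4) set set" pg_line_sets pg_plane_sets
    by (rule pg3_even_axioms[OF ev q])
  have "0 < (real CARD('f) - 2) * real CARD('f)" using q by (intro mult_pos_pos) auto
  then have "(real CARD('f))^2 - 2 * real CARD('f) > 0" by (simp add: power2_eq_square algebra_simps)
  moreover have "sqrt (real CARD('f)) \<ge> 0" by simp
  ultimately have "real k > 0" using k by linarith
  then have "K \<noteq> {}" using K'(2) by auto
  interpret C: pg3_even_cap "CARD('f)" "pg_points :: ('f ^ 4) set set" pg_line_sets pg_plane_sets K
    by unfold_locales (use K' \<open>K \<noteq> {}\<close> in auto)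
  show ?thesis
  proof unfold_locales
    show "C.secs N \<noteq> {}" if N: "N \<in> pg_points - K" for N
    proof -
      have "\<not> is_cap (k + 1) (insert N K)" using K by (auto simp: is_complete_cap_def)
      moreover have "card (insert N K) = k + 1" using N K'(2) fin[of K] by simp
      ultimately obtain L where L: "L \<in> pg_line_sets" "\<not> card (L \<inter> insert N K) \<le> 2"
        using N K'(1) by (auto simp: is_cap_iff)
      have NL: "N \<in> L" using L K'(3)[OF L(1)] by (cases "N \<in> L") auto
      then have "L \<inter> insert N K = insert N (L \<inter> K)" by auto
      then have "card (L \<inter> K) \<ge> 2" using L(2) N fin[of "L \<inter> K"] by simp
      then have "card (L \<inter> K) = 2" using K'(3)[OF L(1)] by simp
      then have "L \<in> C.secs N" using L(1) NL by (simp add: C.secs_def E.lines_at_def)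
      then show ?thesis by blast
    qed
    show "(real CARD('f))\<^sup>2 - 2 * real CARD('f) + 3 * sqrt (real CARD('f)) + 2 \<le> real (pg3_cap.k K)"
      using k K'(2) by (simp add: C.k_def)
  qed
qed

text \<open>\<open>x^2 + x\<close> has the same value at 0 and -1, so it is not injective and, the
  field being finite, misses a value. This works in every characteristic.\<close>

lemma ex_irreducible_quadratic:
  "\<exists>c::'f::{field,finite}. \<forall>x. x^2 + x + c \<noteq> 0"
proof (rule ccontr)
  assume "\<not> ?thesis"
  then have "\<forall>c::'f. \<exists>x. x^2 + x + c = 0" by blast
  then have "surj (\<lambda>x::'f. - (x^2 + x))" unfolding surj_def by (metis add.commute add_eq_0_iff)
  then have "inj (\<lambda>x::'f. - (x^2 + x))" by (rule finite_UNIV_surj_inj[OF finite])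
  then have "(0::'f) = - 1" by (rule injD) simp
  then show False by simp
qed

text \<open>The elliptic quadric \<open>x\<^sub>1 x\<^sub>4 = x\<^sub>2\<^sup>2 + x\<^sub>2 x\<^sub>3 + c x\<^sub>3\<^sup>2\<close>.\<close>

lemma elliptic_quadric:
  "\<exists>Ov :: ('f::{field,finite} ^ 4) set set. is_cap (CARD('f)^2 + 1) Ov"
proof -
  obtain c :: 'f where c: "\<And>x. x^2 + x + c \<noteq> 0" using ex_irreducible_quadratic by blast
  \<comment> \<open>An anisotropic binary quadratic form, by the choice of \<open>c\<close>.\<close>
  define n where "n = (\<lambda>y z. y^2 + y * z + c * z^2)"
  have n0: "y = 0 \<and> z = 0" if "n y z = 0" for y z
  proof (cases "z = 0")
    case False
    then have "(y / z)^2 + y / z + c = n y z / z^2" by (simp add: n_def field_simps power2_eq_square)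
    then show ?thesis using c[of "y / z"] that by simp
  qed (use that in \<open>simp add: n_def\<close>)
  \<comment> \<open>The points with first coordinate 1; \<open>e\<close> is the only point of the
    quadric with first coordinate 0. The index type of \<open>w\<close>, with \<open>None\<close>
    for \<open>e\<close>, has \<open>q^2 + 1\<close> elements.\<close>
  define f :: "'f \<Rightarrow> 'f \<Rightarrow> 'f ^ 4" where
    "f = (\<lambda>y z. \<chi> i. if i = 1 then 1 else if i = 2 then y else if i = 3 then z else n y z)"
  define e :: "'f ^ 4" where "e = (\<chi> i. if i = 4 then 1 else 0)"
  have fi: "f y z $ 1 = 1" "f y z $ 2 = y" "f y z $ 3 = z" "f y z $ 4 = n y z" for y z
    by (simp_all add: f_def)
  have ei: "e $ 1 = 0" "e $ 2 = 0" "e $ 3 = 0" "e $ 4 = 1" by (simp_all add: e_def)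
  define w where "w = (\<lambda>p. case p of None \<Rightarrow> e | Some (y, z) \<Rightarrow> f y z)"
  have w0: "w p \<noteq> 0" for p
    by (cases p) (auto simp: w_def vec_eq_iff forall_4 fi ei)
  have w_prop: "p = p'" if "w p' = s *s w p" for p p' s
    using that by (cases p; cases p') (auto simp: w_def vec_eq_iff forall_4 fi ei split: prod.splits)
  have comb: "\<exists>s s'. u = s *s w p + s' *s w p'"
    if "vec.subspace W" "vec.dim W = 2" "w p \<in> W" "w p' \<in> W" "u \<in> W" "p \<noteq> p'" for W p p' u
  proof -
    have "vec.span {w p} \<noteq> vec.span {w p'}"
    proof
      assume "vec.span {w p} = vec.span {w p'}"
      then have "w p' \<in> vec.span {w p}" using vec.span_base[of "w p'" "{w p'}"] by simp
      then show False using w_prop that(6) by (auto simp: vec.span_singleton)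
    qed
    then have "W = vec.span {w p, w p'}" using span_pair[OF that(1-4)] w0 by blast
    then show ?thesis using that(5) by (simp add: in_span_pair)
  qed
  have affine: False if W: "vec.subspace W" "vec.dim W = 2" "f y z \<in> W" "f y' z' \<in> W" "w p \<in> W"
      and ne: "(y, z) \<noteq> (y', z')" "p \<noteq> Some (y, z)" "p \<noteq> Some (y', z')" for W y z y' z' p
  proof -
    obtain s s' where s: "w p = s *s f y z + s' *s f y' z'"
      using comb[OF W(1,2), of "Some (y, z)" "Some (y', z')" "w p"] W(3-5) ne(1) by (auto simp: w_def)
    show False
    proof (cases p)
      case None
      then have "s + s' = 0" "s * y + s' * y' = 0" "s * z + s' * z' = 0" "s * n y z + s' * n y' z' = 1"
        using s by (auto simp: w_def vec_eq_iff forall_4 fi ei)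
      then have s': "s' = - s" and "s * (y - y') = 0" "s * (z - z') = 0" "s * (n y z - n y' z') = 1"
        by (simp_all add: add_eq_0_iff algebra_simps)
      then show False using ne(1) by auto
    next
      case (Some p')
      obtain a b where p: "p = Some (a, b)" using Some by (cases p') auto
      then have e: "s + s' = 1" "a = s * y + s' * y'" "b = s * z + s' * z'" "n a b = s * n y z + s' * n y' z'"
        using s by (auto simp: w_def vec_eq_iff forall_4 fi)
      have s': "s' = 1 - s" using e(1) by (simp add: algebra_simps)
      \<comment> \<open>For \<open>s + s' = 1\<close> a quadratic form deviates from linear
        interpolation by exactly \<open>s s' n\<close> of the difference; as \<open>n\<close> is
        anisotropic, a third point on the secant must coincide with one of the two.\<close>
      have "s * s' * n (y - y') (z - z') = s * n y z + s' * n y' z' - n a b"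
        unfolding e(2,3) s' n_def by (simp add: algebra_simps power2_eq_square)
      then have "s * s' * n (y - y') (z - z') = 0" using e(4) by simp
      moreover have "n (y - y') (z - z') \<noteq> 0" using n0[of "y - y'" "z - z'"] ne(1) by auto
      ultimately have "s = 0 \<or> s' = 0" by simp
      then show False using e p ne(2,3) s' by auto
    qed
  qed
  have three: False if W: "vec.subspace W" "vec.dim W = 2" "w p \<in> W" "w p' \<in> W" "w p'' \<in> W"
      and ne: "p \<noteq> p'" "p \<noteq> p''" "p' \<noteq> p''" for W p p' p''
  proof -
    have A: False if h: "w a \<in> W" "w b \<in> W" "w d \<in> W" "a \<noteq> b" "a \<noteq> d" "b \<noteq> d" "a \<noteq> None" "b \<noteq> None" for a b d
    proof -
      obtain y z y' z' where "a = Some (y, z)" "b = Some (y', z')" using h(7,8) by auto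
      then show False using affine[OF W(1,2), of y z y' z' d] h(1-6) by (auto simp: w_def)
    qed
    \<comment> \<open>At most one of three distinct points is \<open>e\<close>, so two of them are
      affine.\<close>
    consider "p \<noteq> None" "p' \<noteq> None" | "p \<noteq> None" "p'' \<noteq> None" | "p' \<noteq> None" "p'' \<noteq> None" using ne by metis
    then show False
    proof cases
      case 1 then show ?thesis using A[of p p' p''] W(3-5) ne by blast
    next
      case 2 then show ?thesis using A[of p p'' p'] W(3-5) ne by blast
    next
      case 3 then show ?thesis using A[of p' p'' p] W(3-5) ne by blast
    qed
  qed
  define Ov where "Ov = range (\<lambda>p. vec.span {w p})"
  have "is_cap (CARD('f)^2 + 1) Ov"
    unfolding is_cap_def
  proof (intro conjI ballI impI notI)
    show "Ov \<subseteq> pg_points" using pg_point_span w0 by (auto simp: Ov_def)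
    show "finite Ov" by (simp add: Ov_def)
    have "inj (\<lambda>p. vec.span {w p})"
    proof (rule injI)
      fix p p' assume "vec.span {w p} = vec.span {w p'}"
      then have "w p' \<in> vec.span {w p}" using vec.span_base[of "w p'" "{w p'}"] by simp
      then show "p = p'" using w_prop by (auto simp: vec.span_singleton)
    qed
    then show "card Ov = CARD('f)^2 + 1" by (simp add: Ov_def card_image power2_eq_square)
    fix P Q R assume PQR: "P \<in> Ov" "Q \<in> Ov" "R \<in> Ov" "P \<noteq> Q \<and> P \<noteq> R \<and> Q \<noteq> R" "pg_collinear {P, Q, R}"
    then obtain p p' p'' where p: "P = vec.span {w p}" "Q = vec.span {w p'}" "R = vec.span {w p''}" by (auto simp: Ov_def)
    obtain W where W: "vec.subspace W" "vec.dim W = 2" "P \<subseteq> W" "Q \<subseteq> W" "R \<subseteq> W"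
      using PQR(5) by (auto simp: pg_collinear_def pg_lines_def)
    have "w p \<in> W" "w p' \<in> W" "w p'' \<in> W" using W p vec.span_base[of _ "{_}"] by blast+
    then show False using three[OF W(1,2), of p p' p''] PQR(4) p by blast
  qed
  then show ?thesis by blast
qed

theorem theorem4p1:
  fixes q :: nat
  assumes "CARD('f::{field,finite}) = q"
    and "even q"
    and "q \<ge> 2048"
  shows "real (m2' TYPE('f ^ 4)) < (real q)\<^sup>2 - 2 * real q + 3 * sqrt (real q) + 2"
proof -
  define b where "b = (real q)\<^sup>2 - 2 * real q + 3 * sqrt (real q) + 2"
  define S where "S = complete_cap_sizes TYPE('f ^ 4)"
  have ev: "even CARD('f)" and q: "CARD('f) \<ge> 2048" using assms by auto
  have large: "k = q^2 + 1 \<and> (\<forall>E\<in>pg_plane_sets. card (E \<inter> K) \<le> q + 1) \<and>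
      (\<exists>E\<in>(pg_plane_sets :: ('f ^ 4) set set set). \<exists>H\<subseteq>E. card H = q + 2 \<and> (\<forall>L\<in>pg_line_sets. card (L \<inter> H) \<le> 2))"
    if K: "is_complete_cap k K" "real k \<ge> b" for k and K :: "('f ^ 4) set set"
  proof -
    interpret pg3_large_cap "CARD('f)" "pg_points :: ('f ^ 4) set set" pg_line_sets pg_plane_sets K
      by (rule pg3_large_cap_axioms[OF ev q K(1)]) (use K(2) in \<open>simp add: b_def assms(1)\<close>)
    have "card K = k" using K(1) by (simp add: is_complete_cap_def is_cap_def)
    then have "k = q^2 + 1" using large_cap(1) by (simp add: assms(1) k_def)
    moreover have "\<forall>E\<in>pg_plane_sets. card (E \<inter> K) \<le> q + 1"
      using large_cap(2) by (simp add: assms(1) a_def)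
    moreover have "\<exists>E\<in>(pg_plane_sets :: ('f ^ 4) set set set). \<exists>H\<subseteq>E. card H = q + 2 \<and> (\<forall>L\<in>pg_line_sets. card (L \<inter> H) \<le> 2)"
      using hyperoval_plane unfolding assms(1) .
    ultimately show ?thesis by blast
  qed
  have r: "3 * sqrt (real q) + 1 \<le> 2 * real q"
  proof -
    have "45 \<le> sqrt (real q)" by (rule real_le_rsqrt) (use assms(3) in simp)
    then have "45 * sqrt (real q) \<le> sqrt (real q) * sqrt (real q)" by (intro mult_right_mono) auto
    then show ?thesis using assms(3) by simp
  qed
  then have b_le: "b \<le> real (q^2 + 1)" by (simp add: b_def)
  have SI: "k \<in> S \<longleftrightarrow> (\<exists>K :: ('f ^ 4) set set. is_complete_cap k K)" for k
    by (simp add: S_def complete_cap_sizes_def)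
  have fin: "finite X" for X :: "('f ^ 4) set set" by (rule finite_subset[OF subset_UNIV]) simp
  have "S \<subseteq> {..card (UNIV :: ('f ^ 4) set set)}"
  proof
    fix k assume "k \<in> S"
    then obtain K :: "('f ^ 4) set set" where "is_complete_cap k K" using SI by blast
    then have "card K = k" by (simp add: is_complete_cap_def is_cap_def)
    moreover have "card K \<le> card (UNIV :: ('f ^ 4) set set)" by (rule card_mono[OF fin subset_UNIV])
    ultimately show "k \<in> {..card (UNIV :: ('f ^ 4) set set)}" by (simp only: atMost_iff)
  qed
  then have finS: "finite S" by (rule finite_subset) simp
  obtain Ov :: "('f ^ 4) set set" where Ov: "is_cap (q^2 + 1) Ov" using elliptic_quadric assms(1) by metis
  then obtain k1 and K1 :: "('f ^ 4) set set" where K1: "is_complete_cap k1 K1" "Ov \<subseteq> K1"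
    using complete_extension by blast
  have "q^2 + 1 \<le> k1"
    using Ov K1 card_mono[of K1 Ov] by (auto simp: is_complete_cap_def is_cap_def)
  then have k1b: "real k1 \<ge> b" using b_le by (metis of_nat_le_iff order.trans)
  have k1: "k1 = q^2 + 1" using large[OF K1(1) k1b] by blast
  \<comment> \<open>The complete cap above the elliptic quadric attains \<open>q^2 + 1\<close> and
    at the same time provides the hyperoval for a second one.\<close>
  obtain E H :: "('f ^ 4) set set" where E: "E \<in> pg_plane_sets" and H: "H \<subseteq> E" "card H = q + 2" "\<forall>L\<in>pg_line_sets. card (L \<inter> H) \<le> 2"
    using large[OF K1(1) k1b] by blast
  have "is_cap (q + 2) H"
    using E H by (auto simp: is_cap_iff pg_plane_sets_def pts_def)
  then obtain k2 and K2 :: "('f ^ 4) set set" where K2: "is_complete_cap k2 K2" "H \<subseteq> K2"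
    using complete_extension by blast
  \<comment> \<open>A complete cap of size at least \<open>b\<close> meets every plane in at most
    \<open>q + 1\<close> points, but the plane of \<open>H\<close> contains \<open>q + 2\<close>
    points of \<open>K2\<close>.\<close>
  have k2: "\<not> real k2 \<ge> b"
  proof
    assume "real k2 \<ge> b"
    then have "card (E \<inter> K2) \<le> q + 1" using large[OF K2(1)] E by blast
    moreover have "card H \<le> card (E \<inter> K2)"
      by (rule card_mono) (use H K2 fin in auto)
    ultimately show False using H(2) by simp
  qed
  have k1S: "k1 \<in> S" and k2S: "k2 \<in> S" using K1 K2 SI by auto
  have S_cases: "k = q^2 + 1 \<or> real k < b" if "k \<in> S" for k
    using that large by (metis SI linorder_not_le)
  have "Max S = q^2 + 1"
  proof (rule Max_eqI[OF finS])
    show "k \<le> q^2 + 1" if "k \<in> S" for k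
      using S_cases[OF that] b_le by (metis less_le_trans less_imp_le of_nat_le_iff order_refl)
    show "q^2 + 1 \<in> S" using k1 k1S by simp
  qed
  moreover have "k2 \<noteq> q^2 + 1" using k2 b_le by auto
  \<comment> \<open>The second size keeps the outer \<open>Max\<close> away from the empty set,
    where its value is unspecified.\<close>
  ultimately have ne: "S - {Max S} \<noteq> {}" using k2S by auto
  have "Max (S - {Max S}) \<in> S - {Max S}" by (rule Max_in) (use finS ne in auto)
  then have "real (Max (S - {Max S})) < b" using S_cases \<open>Max S = q^2 + 1\<close> by auto
  then show ?thesis by (simp add: m2'_def S_def b_def)
qed

end
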